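(* The semigroup $\{P(t)\}_{t\ge 0}$ is strongly stable if and only if $$m\{x\in E:\liminf_{\lambda\downarrow 0}f_\lambda(x)<1\}=0,$$ where, for $\lambda>0$, $f_\lambda(x)=\lim_{n\to\infty}(BR(\lambda,A))^{*n}1(x)$.
   Context: $(E,\mathcal E,m)$ is a $\sigma$-finite measure space, $L^1=L^1(E,\mathcal E,m)$ with norm $\|\cdot\|$, $L^\infty=L^\infty(E,\mathcal E,m)$, $L^1_+$ is the cone of nonnegative elements of $L^1$, and for a linear subspace $\mathcal D\subseteq L^1$, $\mathcal D_+=\mathcal D\cap L^1_+$. A substochastic semigroup is a strongly continuous semigroup of positive contractions on $L^1$. A semigroup $\{P(t)\}_{t\ge0}$ is strongly stable if $\lim_{t\to\infty}P(t)u=0$ in $L^1$ for all $u\in L^1$. $R(\lambda,A)=(\lambda-A)^{-1}$ is the resolvent. Standing assumptions: $(A,\mathcal D(A))$ and $(B,\mathcal D(B))$ are linear operators in $L^1$ such that: (G1) $(A,\mathcal D(A))$ generates a substochastic semigroup $\{S(t)\}_{t\ge0}$; (G2) $\mathcal D(B)\supseteq\mathcal D(A)$ and $Bu\ge0$ for $u\in\mathcal D(A)_+$; (G3) $\int_E(Au+Bu)\,dm=0$ for every $u\in\mathcal D(A)_+$. Under these assumptions (Kato--Voigt perturbation theorem) there is a smallest substochastic semigroup $\{P(t)\}_{t\ge0}$ on $L^1$ whose generator is an extension of $(A+B,\mathcal D(A))$ (smallest: $P(t)u\le \widetilde P(t)u$ for all $t\ge 0$, $u\in L^1_+$ and every such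 semigroup $\widetilde P$). Its generator $C$ is characterized by $R(\lambda,C)u=\lim_{N\to\infty}R(\lambda,A)\sum_{n=0}^N(BR(\lambda,A))^nu$ for $u\in L^1$, $\lambda>0$. This is the semigroup $\{P(t)\}_{t\ge0}$ of the claim. For $\lambda>0$ the operator $BR(\lambda,A)$ is an everywhere defined positive contraction on $L^1$; $(BR(\lambda,A))^*$ is its adjoint on $L^\infty$, and the limit defining $f_\lambda$ exists a.e. because the sequence is non-increasing. Each $f_\lambda$ is defined up to $m$-null sets, and $f_\mu\le f_\lambda$ a.e. for $\mu>\lambda>0$; accordingly $\liminf_{\lambda\downarrow0}f_\lambda$ is understood as the a.e. defined limit $\lim_{k\to\infty} f_{\lambda_k}$ along any sequence $\lambda_k\downarrow0$ (it does not depend on the sequence up to null sets). *)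

theory Defs
  imports "HOL-Analysis.Analysis"
begin

text \<open>
  Elements of \<open>L\<^sup>1(M)\<close> are represented by integrable functions, with equality almost everywhere
  in place of equality of classes. Accordingly a linear operator in \<open>L\<^sup>1(M)\<close> is a map on functions
  together with a domain; both are required to be compatible with equality almost everywhere.
\<close>

definition L1 :: "'a measure \<Rightarrow> ('a \<Rightarrow> real) set" where
  "L1 M = {u. integrable M u}"

definition L1_norm :: "'a measure \<Rightarrow> ('a \<Rightarrow> real) \<Rightarrow> real" where
  "L1_norm M u = (LINT x|M. \<bar>u x\<bar>)"

definition Linf :: "'a measure \<Rightarrow> ('a \<Rightarrow> real) set" where
  "Linf M = {g \<in> borel_measurable M. \<exists>c. AE x in M. \<bar>g x\<bar> \<le> c}"

definition nonneg_part :: "'a measure \<Rightarrow> ('a \<Rightarrow> real) set \<Rightarrow> ('a \<Rightarrow> real) set" where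
  "nonneg_part M D = {u \<in> D. AE x in M. 0 \<le> u x}"

definition linear_operator ::
  "'a measure \<Rightarrow> (('a \<Rightarrow> real) \<Rightarrow> 'a \<Rightarrow> real) \<Rightarrow> ('a \<Rightarrow> real) set \<Rightarrow> bool" where
  "linear_operator M T D \<longleftrightarrow>
     D \<subseteq> L1 M \<and>
     (\<lambda>x. 0) \<in> D \<and>
     (\<forall>u\<in>D. \<forall>v\<in>D. (\<lambda>x. u x + v x) \<in> D) \<and>
     (\<forall>c. \<forall>u\<in>D. (\<lambda>x. c * u x) \<in> D) \<and>
     (\<forall>u\<in>D. \<forall>v\<in>L1 M. (AE x in M. u x = v x) \<longrightarrow> v \<in> D) \<and>
     (\<forall>u\<in>D. T u \<in> L1 M) \<and>
     (\<forall>u\<in>D. \<forall>v\<in>D. (AE x in M. u x = v x) \<longrightarrow> (AE x in M. T u x = T v x)) \<and>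
     (\<forall>u\<in>D. \<forall>v\<in>D. AE x in M. T (\<lambda>y. u y + v y) x = T u x + T v x) \<and>
     (\<forall>c. \<forall>u\<in>D. AE x in M. T (\<lambda>y. c * u y) x = c * T u x)"

definition positive_on ::
  "'a measure \<Rightarrow> (('a \<Rightarrow> real) \<Rightarrow> 'a \<Rightarrow> real) \<Rightarrow> ('a \<Rightarrow> real) set \<Rightarrow> bool" where
  "positive_on M T D \<longleftrightarrow> (\<forall>u\<in>nonneg_part M D. AE x in M. 0 \<le> T u x)"

definition substochastic_semigroup ::
  "'a measure \<Rightarrow> (real \<Rightarrow> ('a \<Rightarrow> real) \<Rightarrow> 'a \<Rightarrow> real) \<Rightarrow> bool" where
  "substochastic_semigroup M S \<longleftrightarrow>
     (\<forall>t\<ge>0. linear_operator M (S t) (L1 M)) \<and>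
     (\<forall>t\<ge>0. positive_on M (S t) (L1 M)) \<and>
     (\<forall>t\<ge>0. \<forall>u\<in>L1 M. L1_norm M (S t u) \<le> L1_norm M u) \<and>
     (\<forall>u\<in>L1 M. AE x in M. S 0 u x = u x) \<and>
     (\<forall>s\<ge>0. \<forall>t\<ge>0. \<forall>u\<in>L1 M. AE x in M. S (s + t) u x = S s (S t u) x) \<and>
     (\<forall>u\<in>L1 M. ((\<lambda>t. L1_norm M (\<lambda>x. S t u x - u x)) \<longlongrightarrow> 0) (at_right 0))"

definition generator_graph ::
  "'a measure \<Rightarrow> (real \<Rightarrow> ('a \<Rightarrow> real) \<Rightarrow> 'a \<Rightarrow> real) \<Rightarrow> (('a \<Rightarrow> real) \<times> ('a \<Rightarrow> real)) set" where
  "generator_graph M S =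
     {(u, v). u \<in> L1 M \<and> v \<in> L1 M \<and>
        ((\<lambda>h. L1_norm M (\<lambda>x. (S h u x - u x) / h - v x)) \<longlongrightarrow> 0) (at_right 0)}"

definition generates ::
  "'a measure \<Rightarrow> (('a \<Rightarrow> real) \<Rightarrow> 'a \<Rightarrow> real) \<Rightarrow> ('a \<Rightarrow> real) set \<Rightarrow>
   (real \<Rightarrow> ('a \<Rightarrow> real) \<Rightarrow> 'a \<Rightarrow> real) \<Rightarrow> bool" where
  "generates M A D S \<longleftrightarrow>
     D = Domain (generator_graph M S) \<and> (\<forall>u\<in>D. (u, A u) \<in> generator_graph M S)"

text \<open>Substochastic semigroups whose generator is an extension of \<open>(A + B, D)\<close>.\<close>

definition perturbed_semigroup ::
  "'a measure \<Rightarrow> (('a \<Rightarrow> real) \<Rightarrow> 'a \<Rightarrow> real) \<Rightarrow> (('a \<Rightarrow> real) \<Rightarrow> 'a \<Rightarrow> real) \<Rightarrow> ('a \<Rightarrow> real) set \<Rightarrow>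
   (real \<Rightarrow> ('a \<Rightarrow> real) \<Rightarrow> 'a \<Rightarrow> real) \<Rightarrow> bool" where
  "perturbed_semigroup M A B D P \<longleftrightarrow>
     substochastic_semigroup M P \<and>
     (\<forall>u\<in>D. (u, \<lambda>x. A u x + B u x) \<in> generator_graph M P)"

definition smallest_perturbed_semigroup ::
  "'a measure \<Rightarrow> (('a \<Rightarrow> real) \<Rightarrow> 'a \<Rightarrow> real) \<Rightarrow> (('a \<Rightarrow> real) \<Rightarrow> 'a \<Rightarrow> real) \<Rightarrow> ('a \<Rightarrow> real) set \<Rightarrow>
   (real \<Rightarrow> ('a \<Rightarrow> real) \<Rightarrow> 'a \<Rightarrow> real) \<Rightarrow> bool" where
  "smallest_perturbed_semigroup M A B D P \<longleftrightarrow>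
     perturbed_semigroup M A B D P \<and>
     (\<forall>Q. perturbed_semigroup M A B D Q \<longrightarrow>
        (\<forall>t\<ge>0. \<forall>u\<in>nonneg_part M (L1 M). AE x in M. P t u x \<le> Q t u x))"

definition strongly_stable ::
  "'a measure \<Rightarrow> (real \<Rightarrow> ('a \<Rightarrow> real) \<Rightarrow> 'a \<Rightarrow> real) \<Rightarrow> bool" where
  "strongly_stable M P \<longleftrightarrow> (\<forall>u\<in>L1 M. ((\<lambda>t. L1_norm M (P t u)) \<longlongrightarrow> 0) at_top)"

text \<open>
  In the next two definitions the choice operator selects a representative: \<open>(\<lambda> - A)\<^sup>-\<^sup>1 v\<close>, for
  \<open>\<lambda>\<close> in the resolvent set, and \<open>T\<^sup>* g \<in> L\<^sup>\<infinity>\<close>, for bounded \<open>T\<close> and \<open>\<sigma>\<close>-finite \<open>M\<close>, exist and are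
  unique up to null sets.
\<close>

definition resolvent ::
  "'a measure \<Rightarrow> (('a \<Rightarrow> real) \<Rightarrow> 'a \<Rightarrow> real) \<Rightarrow> ('a \<Rightarrow> real) set \<Rightarrow> real \<Rightarrow>
   ('a \<Rightarrow> real) \<Rightarrow> 'a \<Rightarrow> real" where
  "resolvent M A D l v = (SOME u. u \<in> D \<and> (AE x in M. l * u x - A u x = v x))"

definition adjoint_Linf ::
  "'a measure \<Rightarrow> (('a \<Rightarrow> real) \<Rightarrow> 'a \<Rightarrow> real) \<Rightarrow> ('a \<Rightarrow> real) \<Rightarrow> 'a \<Rightarrow> real" where
  "adjoint_Linf M T g =
     (SOME h. h \<in> Linf M \<and> (\<forall>u\<in>L1 M. (LINT x|M. T u x * g x) = (LINT x|M. u x * h x)))"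

definition f_lim ::
  "'a measure \<Rightarrow> (('a \<Rightarrow> real) \<Rightarrow> 'a \<Rightarrow> real) \<Rightarrow> (('a \<Rightarrow> real) \<Rightarrow> 'a \<Rightarrow> real) \<Rightarrow> ('a \<Rightarrow> real) set \<Rightarrow>
   real \<Rightarrow> 'a \<Rightarrow> real" where
  "f_lim M A B D l x =
     lim (\<lambda>n. (adjoint_Linf M (\<lambda>u. B (resolvent M A D l u)) ^^ n) (\<lambda>_. 1) x)"

end

theory Submission
  imports Defs "HOL-Probability.Discrete_Topology"
begin

text \<open>
  For \<open>u \<ge> 0\<close> the conservation law (G3) says \<open>l \<parallel>R(l, A) u\<parallel> + \<parallel>B R(l, A) u\<parallel> = \<parallel>u\<parallel>\<close>. Iterating it along the
  series \<open>R(l, C) u = \<Sum>\<^sub>n R(l, A) (B R(l, A))\<^sup>n u\<close> and using that the norm is additive on the positive cone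
  gives the identity (\<open>norm_Kn_tendsto\<close>)

  \<open>l \<parallel>R(l, C) u\<parallel> = \<parallel>u\<parallel> - lim\<^sub>n \<parallel>(B R(l, A))\<^sup>n u\<parallel> = \<integral> u (1 - f\<^sub>l) dm\<close>.

  The left-hand side is an Abel mean of the nonincreasing function \<open>t \<mapsto> \<parallel>P(t) u\<parallel>\<close>, so it tends to
  \<open>lim\<^sub>t \<parallel>P(t) u\<parallel>\<close> as \<open>l\<close> decreases to 0. On the right-hand side \<open>f\<^sub>l\<close> increases to a function \<open>f\<^sub>0 \<le> 1\<close>. Hence
  \<open>P\<close> is strongly stable if and only if \<open>\<integral> u (1 - f\<^sub>0) dm = 0\<close> for all \<open>u \<ge> 0\<close>, that is, \<open>f\<^sub>0 = 1\<close> almost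
  everywhere (\<open>liminf_eq_1_iff_integrals\<close>).

  The two directions use different facts about \<open>P\<close>. The partial sums of the series lie
  in the domain of \<open>A\<close>, where the generator of \<open>P\<close> is \<open>A + B\<close>; if \<open>P\<close> is stable, a differential inequality
  for their mass along \<open>P\<close> bounds \<open>l \<parallel>R(l, C) u\<parallel>\<close> (\<open>resolvent_mass_bound\<close>). Conversely, minimality
  is used by comparing \<open>P\<close> with a semigroup \<open>Q\<close> whose resolvent is the series: then \<open>P \<le> Q\<close>, and the
  orbits of \<open>Q\<close> decay (\<open>orbit_eventually_small\<close>). In both directions difference quotients along an orbit,
  controlled uniformly in time, take the place of Laplace transforms.

  The semigroup \<open>Q\<close> is constructed in two steps. The series defines the resolvents, for all \<open>l > 0\<close>, of one
  operator \<open>C\<close> that extends \<open>A + B\<close> (\<open>m_dissipative_kato_graph\<close>); the resolvent identity comes from inserting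
  the partial sums for one value of \<open>l\<close> into the series for another. Then \<open>Q(t) = lim\<^sub>k (I - t/2\<^sup>k C)\<^bsup>-2^k\<^esup>\<close>
  exists by an error estimate on the domain of \<open>C\<^sup>2\<close> (\<open>J_two_steps\<close>), which also gives the semigroup law
  and the generator. The resolvents of \<open>A\<close> itself come from integrals of orbits (\<open>m_dissipative_gen\<close>).

  All of this is done in a closed subspace of a Banach space with a cone on which the norm is
  additive. The space \<open>L\<^sup>1\<close> is such a subspace after the isometric embedding \<open>emb\<close>, which sends a function
  to its integrals against bounded test functions; equality almost everywhere becomes equality.
  The adjoints in the definition of \<open>f\<^sub>l\<close> exist by the Radon-Nikodym theorem
  (\<open>positive_functional_density\<close>).
\<close>

section \<open>Positive operators and semigroups on an abstract \<open>L\<^sup>1\<close> space\<close>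

text \<open>
  The subspace \<open>X\<close> plays the part of \<open>L\<^sup>1\<close>, \<open>pos\<close> that of its positive cone and \<open>e\<close> that of the integral.
  Since \<open>L\<^sup>1\<close> of a variable measure is not a type, \<open>X\<close> is a closed subset of a Banach space, and
  operators are functions on the whole type that are only ever considered on \<open>X\<close>. The assumption
  \<open>decomp\<close> is the splitting into positive and negative parts.
\<close>

locale AL_space =
  fixes X pos :: "'b::banach set" and e :: "'b \<Rightarrow> real"
  assumes subspace_X: "subspace X" and closed_X: "closed X"
    and pos_subset: "pos \<subseteq> X" and closed_pos: "closed pos"
    and pos_0: "0 \<in> pos"
    and pos_add: "p \<in> pos \<Longrightarrow> q \<in> pos \<Longrightarrow> p + q \<in> pos"
    and pos_scale: "p \<in> pos \<Longrightarrow> 0 \<le> c \<Longrightarrow> c *\<^sub>R p \<in> pos"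
    and decomp: "x \<in> X \<Longrightarrow> \<exists>p\<in>pos. \<exists>q\<in>pos. x = p - q \<and> norm x = norm p + norm q"
    and e_add: "x \<in> X \<Longrightarrow> y \<in> X \<Longrightarrow> e (x + y) = e x + e y"
    and e_scale: "x \<in> X \<Longrightarrow> e (c *\<^sub>R x) = c * e x"
    and e_pos: "p \<in> pos \<Longrightarrow> e p = norm p"
begin

lemmas X_0 = subspace_0[OF subspace_X]
  and X_add = subspace_add[OF subspace_X]
  and X_diff = subspace_diff[OF subspace_X]
  and X_scale = subspace_scale[OF subspace_X]
  and X_sum = subspace_sum[OF subspace_X]

lemma pos_X: "p \<in> pos \<Longrightarrow> p \<in> X"
  using pos_subset by blast

lemma pos_sum: "(\<And>i. i \<in> I \<Longrightarrow> f i \<in> pos) \<Longrightarrow> sum f I \<in> pos"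
  by (induction I rule: infinite_finite_induct) (auto simp: pos_0 pos_add)

lemma e_diff: "x \<in> X \<Longrightarrow> y \<in> X \<Longrightarrow> e (x - y) = e x - e y"
  using e_add[of "x - y" y] X_diff by fastforce

lemma abs_e_le: "x \<in> X \<Longrightarrow> \<bar>e x\<bar> \<le> norm x"
proof -
  assume "x \<in> X"
  then obtain p q where "p \<in> pos" "q \<in> pos" "x = p - q" "norm x = norm p + norm q"
    using decomp by blast
  moreover from this have "e x = norm p - norm q" by (simp add: e_diff pos_X e_pos)
  ultimately show ?thesis using norm_ge_zero[of p] norm_ge_zero[of q] by linarith
qed

lemma norm_add_pos: "p \<in> pos \<Longrightarrow> q \<in> pos \<Longrightarrow> norm (p + q) = norm p + norm q"
  using e_add[of p q] by (simp add: e_pos pos_add pos_X)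

lemma norm_sum_pos: "(\<And>i. i \<in> I \<Longrightarrow> f i \<in> pos) \<Longrightarrow> norm (sum f I) = (\<Sum>i\<in>I. norm (f i))"
  by (induction I rule: infinite_finite_induct) (auto simp: norm_add_pos pos_sum)

lemma norm_mono_pos:
  assumes "p \<in> pos" "q - p \<in> pos"
  shows "norm p \<le> norm q"
  using norm_add_pos[OF assms] by simp

definition linear_on_X :: "('b \<Rightarrow> 'b) \<Rightarrow> bool" where
  "linear_on_X T \<longleftrightarrow> (\<forall>x\<in>X. T x \<in> X) \<and> (\<forall>x\<in>X. \<forall>y\<in>X. T (x + y) = T x + T y) \<and>
     (\<forall>c. \<forall>x\<in>X. T (c *\<^sub>R x) = c *\<^sub>R T x)"

definition substochastic :: "('b \<Rightarrow> 'b) \<Rightarrow> bool" where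
  "substochastic T \<longleftrightarrow> linear_on_X T \<and> (\<forall>p\<in>pos. T p \<in> pos) \<and> (\<forall>x\<in>X. norm (T x) \<le> norm x)"

lemma lin_X: "linear_on_X T \<Longrightarrow> x \<in> X \<Longrightarrow> T x \<in> X"
  and lin_add: "linear_on_X T \<Longrightarrow> x \<in> X \<Longrightarrow> y \<in> X \<Longrightarrow> T (x + y) = T x + T y"
  and lin_scale: "linear_on_X T \<Longrightarrow> x \<in> X \<Longrightarrow> T (c *\<^sub>R x) = c *\<^sub>R T x"
  by (auto simp: linear_on_X_def)

lemma lin_0: "linear_on_X T \<Longrightarrow> T 0 = 0"
  using lin_scale[of T 0 0] X_0 by simp

lemma lin_diff: "linear_on_X T \<Longrightarrow> x \<in> X \<Longrightarrow> y \<in> X \<Longrightarrow> T (x - y) = T x - T y"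
  using lin_add[of T "x - y" y] X_diff by fastforce

lemma lin_sum:
  "linear_on_X T \<Longrightarrow> (\<And>i. i \<in> I \<Longrightarrow> f i \<in> X) \<Longrightarrow> T (sum f I) = (\<Sum>i\<in>I. T (f i))"
  by (induction I rule: infinite_finite_induct) (auto simp: lin_0 lin_add X_sum)

lemma sub_lin: "substochastic T \<Longrightarrow> linear_on_X T"
  and sub_pos: "substochastic T \<Longrightarrow> p \<in> pos \<Longrightarrow> T p \<in> pos"
  and sub_norm: "substochastic T \<Longrightarrow> x \<in> X \<Longrightarrow> norm (T x) \<le> norm x"
  by (auto simp: substochastic_def)

lemmas sub_X = lin_X[OF sub_lin] and sub_diff = lin_diff[OF sub_lin]
  and sub_add = lin_add[OF sub_lin] and sub_scale = lin_scale[OF sub_lin]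

lemma sub_norm_diff:
  "substochastic T \<Longrightarrow> x \<in> X \<Longrightarrow> y \<in> X \<Longrightarrow> norm (T x - T y) \<le> norm (x - y)"
  using sub_norm[of T "x - y"] by (simp add: sub_diff X_diff)

text \<open>
  The decomposition into positive parts is additive for the norm, so a positive-cone bound
  passes to all of \<open>X\<close> without loss of the constant.
\<close>

lemma norm_le_from_pos:
  assumes T: "linear_on_X T" and "\<And>p. p \<in> pos \<Longrightarrow> norm (T p) \<le> c * norm p" and x: "x \<in> X"
  shows "norm (T x) \<le> c * norm x"
proof -
  obtain p q where pq: "p \<in> pos" "q \<in> pos" "x = p - q" "norm x = norm p + norm q"
    using decomp[OF x] by blast
  have "norm (T x) \<le> norm (T p) + norm (T q)"
    using pq by (simp add: lin_diff[OF T] pos_X norm_triangle_ineq4)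
  also have "\<dots> \<le> c * norm x"
    using assms(2)[OF pq(1)] assms(2)[OF pq(2)] pq(4) by (simp add: algebra_simps)
  finally show ?thesis .
qed

lemma sub_id: "substochastic (\<lambda>x. x)"
  by (auto simp: substochastic_def linear_on_X_def)

lemma sub_comp: "substochastic T \<Longrightarrow> substochastic U \<Longrightarrow> substochastic (\<lambda>x. T (U x))"
  unfolding substochastic_def linear_on_X_def by (metis order_trans)

lemma sub_funpow: "substochastic T \<Longrightarrow> substochastic (T ^^ n)"
proof (induction n)
  case 0
  then show ?case using sub_id by (simp add: id_def)
next
  case (Suc n)
  then show ?case using sub_comp[of T "T ^^ n"] by (simp add: comp_def)
qed

lemma sub_limit:
  assumes T: "\<And>k. substochastic (T k)" and lim: "\<And>x. x \<in> X \<Longrightarrow> (\<lambda>k. T k x) \<longlonglongrightarrow> U x"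
  shows "substochastic U"
  unfolding substochastic_def linear_on_X_def
proof (intro conjI ballI allI)
  fix x assume x: "x \<in> X"
  show "U x \<in> X"
    by (rule Lim_in_closed_set[OF closed_X _ _ lim[OF x]]) (auto simp: sub_X[OF T] x)
  show "norm (U x) \<le> norm x"
    by (rule LIMSEQ_le_const2[OF tendsto_norm[OF lim[OF x]]]) (auto simp: sub_norm[OF T] x)
  show "U (c *\<^sub>R x) = c *\<^sub>R U x" for c
    using tendsto_scaleR[OF tendsto_const[of c] lim[OF x]] lim[OF X_scale[OF x, of c]]
    by (simp add: sub_scale[OF T x] LIMSEQ_unique)
  show "U (x + y) = U x + U y" if y: "y \<in> X" for y
    using tendsto_add[OF lim[OF x] lim[OF y]] lim[OF X_add[OF x y]]
    by (simp add: sub_add[OF T x y] LIMSEQ_unique)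
next
  fix p assume p: "p \<in> pos"
  show "U p \<in> pos"
    by (rule Lim_in_closed_set[OF closed_pos _ _ lim[OF pos_X[OF p]]]) (auto simp: sub_pos[OF T] p)
qed

definition semigroup :: "(real \<Rightarrow> 'b \<Rightarrow> 'b) \<Rightarrow> bool" where
  "semigroup S \<longleftrightarrow> (\<forall>t\<ge>0. substochastic (S t)) \<and> (\<forall>x\<in>X. S 0 x = x) \<and>
     (\<forall>s\<ge>0. \<forall>t\<ge>0. \<forall>x\<in>X. S (s + t) x = S s (S t x)) \<and>
     (\<forall>x\<in>X. ((\<lambda>t. S t x) \<longlongrightarrow> x) (at_right 0))"

definition gen :: "(real \<Rightarrow> 'b \<Rightarrow> 'b) \<Rightarrow> ('b \<times> 'b) set" where
  "gen S = {(x, y). x \<in> X \<and> y \<in> X \<and> ((\<lambda>h. (1 / h) *\<^sub>R (S h x - x)) \<longlongrightarrow> y) (at_right 0)}"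

lemma semi_sub: "semigroup S \<Longrightarrow> 0 \<le> t \<Longrightarrow> substochastic (S t)"
  and semi_0: "semigroup S \<Longrightarrow> x \<in> X \<Longrightarrow> S 0 x = x"
  and semi_add: "semigroup S \<Longrightarrow> 0 \<le> s \<Longrightarrow> 0 \<le> t \<Longrightarrow> x \<in> X \<Longrightarrow> S (s + t) x = S s (S t x)"
  and semi_cont: "semigroup S \<Longrightarrow> x \<in> X \<Longrightarrow> ((\<lambda>t. S t x) \<longlongrightarrow> x) (at_right 0)"
  by (auto simp: semigroup_def)

end

text \<open>
  Telescoping: replacing one factor \<open>V\<close> by \<open>U\<close> at a time costs at most \<open>norm (U x - V x)\<close>, because
  the other factors can be moved in front of the difference and do not increase norms.
\<close>

lemma norm_commuting_powers_diff_le: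
  fixes U V :: "'b::real_normed_vector \<Rightarrow> 'b"
  assumes U: "\<And>x y. x \<in> X \<Longrightarrow> y \<in> X \<Longrightarrow> norm (U x - U y) \<le> norm (x - y)" "\<And>x. x \<in> X \<Longrightarrow> U x \<in> X"
    and V: "\<And>x y. x \<in> X \<Longrightarrow> y \<in> X \<Longrightarrow> norm (V x - V y) \<le> norm (x - y)" "\<And>x. x \<in> X \<Longrightarrow> V x \<in> X"
    and comm: "\<And>x. x \<in> X \<Longrightarrow> U (V x) = V (U x)"
    and x: "x \<in> X"
  shows "norm ((U ^^ n) x - (V ^^ n) x) \<le> real n * norm (U x - V x)"
proof (induction n)
  case (Suc n)
  have Un: "(U ^^ n) y \<in> X" "(V ^^ n) y \<in> X" if "y \<in> X" for y n
    using that by (induction n) (auto simp: U V)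
  have c: "(U ^^ n) (V y) = V ((U ^^ n) y)" if "y \<in> X" for y n
    using that by (induction n) (auto simp: comm Un)
  have n: "norm ((U ^^ n) y - (U ^^ n) z) \<le> norm (y - z)" if "y \<in> X" "z \<in> X" for y z n
    using that by (induction n) (auto intro: order_trans[OF U(1)] simp: Un)
  have "(U ^^ Suc n) x - (V ^^ Suc n) x =
      ((U ^^ n) (U x) - (U ^^ n) (V x)) + (V ((U ^^ n) x) - V ((V ^^ n) x))"
    using c[OF x] by (simp add: funpow_swap1)
  also have "norm \<dots> \<le> norm (U x - V x) + norm ((U ^^ n) x - (V ^^ n) x)"
    by (intro norm_triangle_mono n V(1) Un U V x)
  finally show ?case using Suc.IH by (simp add: algebra_simps)
qed simp

section \<open>Resolvents and implicit Euler steps\<close>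

text \<open>
  The graph of an operator with the properties that characterise generators of substochastic
  semigroups: necessity is \<open>m_dissipative_gen\<close>, sufficiency is \<open>hille_yosida\<close>. The operator
  is given by its graph, so that values outside its domain do not arise.
\<close>

locale m_dissipative = AL_space X pos e
  for X pos :: "'b::banach set" and e :: "'b \<Rightarrow> real" +
  fixes \<Gamma> :: "('b \<times> 'b) set"
  assumes subspace_graph: "subspace \<Gamma>"
    and graph_subset: "\<Gamma> \<subseteq> X \<times> X"
    and dissipative: "(x, y) \<in> \<Gamma> \<Longrightarrow> 0 < l \<Longrightarrow> l * norm x \<le> norm (l *\<^sub>R x - y)"
    and range: "0 < l \<Longrightarrow> z \<in> X \<Longrightarrow> \<exists>x. (x, l *\<^sub>R x - z) \<in> \<Gamma>"
    and resolvent_pos: "(x, l *\<^sub>R x - z) \<in> \<Gamma> \<Longrightarrow> 0 < l \<Longrightarrow> z \<in> pos \<Longrightarrow> x \<in> pos"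
    and dense: "x \<in> X \<Longrightarrow> 0 < d \<Longrightarrow> \<exists>(y, z)\<in>\<Gamma>. norm (x - y) < d"
begin

lemma graph_X: "(x, y) \<in> \<Gamma> \<Longrightarrow> x \<in> X" "(x, y) \<in> \<Gamma> \<Longrightarrow> y \<in> X"
  using graph_subset by auto

lemma graph_add: "(x, y) \<in> \<Gamma> \<Longrightarrow> (x', y') \<in> \<Gamma> \<Longrightarrow> (x + x', y + y') \<in> \<Gamma>"
  using subspace_add[OF subspace_graph, of "(x, y)" "(x', y')"] by simp

lemma graph_diff: "(x, y) \<in> \<Gamma> \<Longrightarrow> (x', y') \<in> \<Gamma> \<Longrightarrow> (x - x', y - y') \<in> \<Gamma>"
  using subspace_diff[OF subspace_graph, of "(x, y)" "(x', y')"] by simp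

lemma graph_scale: "(x, y) \<in> \<Gamma> \<Longrightarrow> (c *\<^sub>R x, c *\<^sub>R y) \<in> \<Gamma>"
  using subspace_scale[OF subspace_graph, of "(x, y)" c] by simp

lemma resolvent_unique:
  assumes l: "0 < l" and "(x, l *\<^sub>R x - z) \<in> \<Gamma>" "(y, l *\<^sub>R y - z) \<in> \<Gamma>"
  shows "x = y"
proof -
  have "(x - y, l *\<^sub>R (x - y)) \<in> \<Gamma>"
    using graph_diff[OF assms(2,3)] by (simp add: algebra_simps)
  from dissipative[OF this l] l show ?thesis by (simp add: mult_le_0_iff)
qed

definition res :: "real \<Rightarrow> 'b \<Rightarrow> 'b" where
  "res l z = (THE x. (x, l *\<^sub>R x - z) \<in> \<Gamma>)"

lemma res_eqI: "0 < l \<Longrightarrow> (x, l *\<^sub>R x - z) \<in> \<Gamma> \<Longrightarrow> res l z = x"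
  unfolding res_def by (rule the_equality) (auto dest: resolvent_unique)

lemma res_graph: "0 < l \<Longrightarrow> z \<in> X \<Longrightarrow> (res l z, l *\<^sub>R res l z - z) \<in> \<Gamma>"
  using range[of l z] res_eqI by metis

lemma res_inverse: "0 < l \<Longrightarrow> (x, y) \<in> \<Gamma> \<Longrightarrow> res l (l *\<^sub>R x - y) = x"
  by (rule res_eqI) auto

lemma res_lin: assumes l: "0 < l" shows "linear_on_X (res l)"
  unfolding linear_on_X_def
proof (intro conjI ballI allI)
  fix x assume x: "x \<in> X"
  show "res l x \<in> X" using res_graph[OF l x] graph_X by blast
  show "res l (c *\<^sub>R x) = c *\<^sub>R res l x" for c
    using graph_scale[OF res_graph[OF l x], of c] l by (intro res_eqI) (auto simp: algebra_simps)
  show "res l (x + y) = res l x + res l y" if "y \<in> X" for y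
    using graph_add[OF res_graph[OF l x] res_graph[OF l that]] l
    by (intro res_eqI) (auto simp: algebra_simps)
qed

lemma res_pos: "0 < l \<Longrightarrow> z \<in> pos \<Longrightarrow> res l z \<in> pos"
  using resolvent_pos res_graph pos_X by blast

lemma res_norm: "0 < l \<Longrightarrow> z \<in> X \<Longrightarrow> l * norm (res l z) \<le> norm z"
  using dissipative[OF res_graph] by fastforce

lemma resolvent_identity:
  assumes l: "0 < l" and m: "0 < m" and z: "z \<in> X"
  shows "res m z = res l z + (l - m) *\<^sub>R res l (res m z)"
proof -
  have "res l (l *\<^sub>R res m z - (m *\<^sub>R res m z - z)) = res m z"
    by (rule res_inverse[OF l res_graph[OF m z]])
  moreover have "l *\<^sub>R res m z - (m *\<^sub>R res m z - z) = z + (l - m) *\<^sub>R res m z"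
    by (simp add: algebra_simps)
  ultimately show ?thesis
    using res_lin[OF l] z lin_X[OF res_lin[OF m] z] by (simp add: lin_add lin_scale X_scale)
qed

text \<open>
  The implicit Euler step \<open>(I - h C)\<^sup>-\<^sup>1\<close>, where \<open>C\<close> is the operator with graph \<open>\<Gamma>\<close>. The value at
  \<open>h = 0\<close> makes the error estimates below hold for all nonnegative steps.
\<close>

definition J :: "real \<Rightarrow> 'b \<Rightarrow> 'b" where
  "J h z = (if h = 0 then z else res (1 / h) ((1 / h) *\<^sub>R z))"

lemma J_graph: "0 < h \<Longrightarrow> z \<in> X \<Longrightarrow> (J h z, (1 / h) *\<^sub>R (J h z - z)) \<in> \<Gamma>"
  using res_graph[of "1 / h" "(1 / h) *\<^sub>R z"] by (simp add: J_def X_scale scaleR_diff_right)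

lemma J_inverse: assumes "0 \<le> h" "(x, y) \<in> \<Gamma>" shows "J h (x - h *\<^sub>R y) = x"
proof (cases "h = 0")
  case False
  then have h: "0 < h" using assms by simp
  have "(1 / h) *\<^sub>R (x - h *\<^sub>R y) = (1 / h) *\<^sub>R x - y" using h by (simp add: scaleR_diff_right)
  with res_inverse[of "1 / h" x y] h assms show ?thesis by (simp add: J_def)
qed (simp add: J_def)

lemma J_sub: assumes "0 \<le> h" shows "substochastic (J h)"
proof (cases "h = 0")
  case True
  then show ?thesis using sub_id by (simp add: J_def[abs_def])
next
  case False
  then have h: "0 < h" using assms by simp
  then have l: "0 < 1 / h" by simp
  note L = res_lin[OF l]
  show ?thesis unfolding substochastic_def linear_on_X_def
  proof (intro conjI ballI allI)
    fix x assume x: "x \<in> X"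
    show "J h x \<in> X" using h by (simp add: J_def lin_X[OF L] X_scale x)
    show "norm (J h x) \<le> norm x"
      using res_norm[OF l X_scale[OF x, of "1 / h"]] h by (simp add: J_def field_simps)
    show "J h (c *\<^sub>R x) = c *\<^sub>R J h x" for c
      using h by (simp add: J_def lin_scale[OF L] X_scale x)
    show "J h (x + y) = J h x + J h y" if "y \<in> X" for y
      using h that by (simp add: J_def lin_add[OF L] X_scale x scaleR_add_right)
  next
    fix p assume "p \<in> pos" then show "J h p \<in> pos"
      using h l by (simp add: J_def res_pos pos_scale)
  qed
qed

lemmas J_X = sub_X[OF J_sub] and J_diff = sub_diff[OF J_sub] and J_scale = sub_scale[OF J_sub]
  and J_norm = sub_norm[OF J_sub]

lemma J_eq_add: "0 \<le> h \<Longrightarrow> (x, y) \<in> \<Gamma> \<Longrightarrow> J h x = x + h *\<^sub>R J h y"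
  using J_inverse[of h x y] by (simp add: J_diff J_scale graph_X X_scale algebra_simps)

lemma J_graph_commute:
  assumes "0 \<le> h" "(x, y) \<in> \<Gamma>" shows "(J h x, J h y) \<in> \<Gamma>"
proof (cases "h = 0")
  case False
  then have h: "0 < h" using assms by simp
  show ?thesis using J_graph[OF h graph_X(1)[OF assms(2)]] J_eq_add[OF assms] h by simp
qed (simp add: J_def assms)

lemma J_commute:
  assumes a: "0 \<le> a" and b: "0 \<le> b" and z: "z \<in> X" shows "J a (J b z) = J b (J a z)"
proof (cases "b = 0")
  case False
  then have b: "0 < b" using b by simp
  have "(J a (J b z), (1 / b) *\<^sub>R (J a (J b z) - J a z)) \<in> \<Gamma>"
    using J_graph_commute[OF a J_graph[OF b z]] a b z
    by (simp add: J_diff J_scale X_diff X_scale J_X)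
  from J_inverse[OF _ this, of b] b show ?thesis by simp
qed (simp add: J_def)

text \<open>
  On the domain of \<open>C\<^sup>2\<close> one has \<open>J a J b - J (a + b) = - a b J a J b J (a + b) C\<^sup>2\<close>, because
  \<open>(I - a C) (I - b C) = (I - (a + b) C) + a b C\<^sup>2\<close>. With \<open>a = b\<close> this compares the Euler scheme with
  its refinement, and with \<open>n\<close> steps of sizes \<open>s / n\<close> and \<open>t / n\<close> it gives the semigroup law in the
  limit.
\<close>

lemma J_two_steps:
  assumes a: "0 \<le> a" and b: "0 \<le> b" and xy: "(x, y) \<in> \<Gamma>" and yz: "(y, z) \<in> \<Gamma>"
  shows "norm (J a (J b x) - J (a + b) x) \<le> a * b * norm z"
proof -
  let ?K = "\<lambda>w. J a (J b (J (a + b) w))"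
  note X = graph_X[OF xy] graph_X[OF yz]
  have c: "0 \<le> a + b" using a b by simp
  note R = J_diff J_scale J_X X_diff X_scale X a b c sub_add[OF J_sub] X_add
  have "J a (J b (J (a + b) (x - (a + b) *\<^sub>R y))) = ?K x - (a + b) *\<^sub>R ?K y"
    by (simp add: R)
  then have 1: "J a (J b x) = ?K x - (a + b) *\<^sub>R ?K y"
    by (simp only: J_inverse[OF c xy])
  have "(x - a *\<^sub>R y, y - a *\<^sub>R z) \<in> \<Gamma>"
    by (intro graph_diff graph_scale xy yz)
  from J_inverse[OF b this] have "J a (J b (x - a *\<^sub>R y - b *\<^sub>R (y - a *\<^sub>R z))) = x"
    using J_inverse[OF a xy] by simp
  then have "J (a + b) x = J (a + b) (J a (J b (x - (a + b) *\<^sub>R y + (a * b) *\<^sub>R z)))"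
    by (simp add: algebra_simps)
  also have "\<dots> = ?K (x - (a + b) *\<^sub>R y + (a * b) *\<^sub>R z)"
    using J_commute[OF c a] J_commute[OF c b] by (simp add: R)
  also have "\<dots> = ?K x - (a + b) *\<^sub>R ?K y + (a * b) *\<^sub>R ?K z"
    by (simp add: R)
  finally have "J a (J b x) - J (a + b) x =
      (?K x - (a + b) *\<^sub>R ?K y) - (?K x - (a + b) *\<^sub>R ?K y + (a * b) *\<^sub>R ?K z)"
    by (rule arg_cong2[where f = minus, OF 1])
  also have "\<dots> = - ((a * b) *\<^sub>R ?K z)" by simp
  finally have "J a (J b x) - J (a + b) x = - ((a * b) *\<^sub>R ?K z)" .
  moreover have "norm (?K z) \<le> norm z"
    using J_norm[OF a] J_norm[OF b] J_norm[OF c] by (meson J_X X a b c order_trans)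
  ultimately show ?thesis using a b by (simp add: mult_left_mono)
qed

text \<open>
  \<open>J h\<close> maps the domain of \<open>C\<close> into that of \<open>C\<^sup>2\<close>, and it moves a point \<open>y\<close> of the domain by at most
  \<open>h\<close> times the norm of \<open>C y\<close>.
\<close>

lemma dense_graph_square:
  assumes x: "x \<in> X" and d: "0 < d"
  shows "\<exists>y z w. (y, z) \<in> \<Gamma> \<and> (z, w) \<in> \<Gamma> \<and> norm (x - y) < d"
proof -
  obtain y z where yz: "(y, z) \<in> \<Gamma>" "norm (x - y) < d / 2"
    using dense[OF x, of "d / 2"] d by auto
  define h where "h = d / (2 * (norm z + 1))"
  have h: "0 < h" unfolding h_def using d by (intro divide_pos_pos) (auto simp: add_nonneg_pos)
  have "h * norm z < d / 2"
  proof -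
    have "h * norm z < h * (norm z + 1)" using h by simp
    also have "\<dots> = d / 2" unfolding h_def by (simp add: field_simps add_nonneg_eq_0_iff)
    finally show ?thesis .
  qed
  moreover have "norm (y - J h y) \<le> h * norm z"
    using J_eq_add[OF _ yz(1), of h] J_norm[of h z] graph_X[OF yz(1)] h by simp
  ultimately have "norm (x - J h y) < d"
    using yz(2) norm_triangle_ineq[of "x - y" "y - J h y"] by simp
  moreover have "(J h y, J h z) \<in> \<Gamma>" using J_graph_commute yz h by simp
  moreover have "(J h z, (1 / h) *\<^sub>R (J h z - z)) \<in> \<Gamma>"
    by (rule J_graph[OF h]) (rule graph_X[OF yz(1)])
  ultimately show ?thesis by blast
qed

end

section \<open>The Hille-Yosida theorem by the implicit Euler scheme\<close>

lemma norm_add_diff_le: "norm (a + b - c) \<le> norm a + norm b + norm (c::'b::real_normed_vector)"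
  using norm_triangle_ineq4[of "a + b" c] norm_triangle_ineq[of a b] by linarith

context m_dissipative
begin

lemma J_power_two_steps:
  assumes a: "0 \<le> a" and b: "0 \<le> b" and xy: "(x, y) \<in> \<Gamma>" and yz: "(y, z) \<in> \<Gamma>"
  shows "norm (((\<lambda>w. J a (J b w)) ^^ n) x - (J (a + b) ^^ n) x) \<le> real n * (a * b * norm z)"
proof -
  have c: "0 \<le> a + b" using a b by simp
  note ab = sub_comp[OF J_sub[OF a] J_sub[OF b]]
  have "norm (((\<lambda>w. J a (J b w)) ^^ n) x - (J (a + b) ^^ n) x)
      \<le> real n * norm (J a (J b x) - J (a + b) x)"
    using J_commute[OF a c] J_commute[OF b c]
    by (intro norm_commuting_powers_diff_le[where X = X])
       (auto simp: sub_norm_diff[OF ab] sub_norm_diff[OF J_sub[OF c]] J_X a b c graph_X[OF xy])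
  also have "\<dots> \<le> real n * (a * b * norm z)"
    by (intro mult_left_mono J_two_steps[OF assms]) simp
  finally show ?thesis .
qed

text \<open>
  The Euler scheme along the dyadic step sizes suffices: refinement by halving makes the successive
  differences summable.
\<close>

definition euler :: "nat \<Rightarrow> real \<Rightarrow> 'b \<Rightarrow> 'b" where
  "euler k t = J (t / 2 ^ k) ^^ (2 ^ k)"

lemma euler_sub: "0 \<le> t \<Longrightarrow> substochastic (euler k t)"
  unfolding euler_def by (intro sub_funpow J_sub) simp

lemma euler_Suc_diff:
  assumes t: "0 \<le> t" and xy: "(x, y) \<in> \<Gamma>" and yz: "(y, z) \<in> \<Gamma>"
  shows "norm (euler (Suc k) t x - euler k t x) \<le> t\<^sup>2 / 4 * norm z * (1 / 2) ^ k"
proof -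
  define h where "h = t / 2 ^ Suc k"
  have h: "0 \<le> h" "h + h = t / 2 ^ k" using t by (auto simp: h_def)
  have "(\<lambda>w. J h (J h w)) = J h ^^ 2" by (simp add: fun_eq_iff numeral_2_eq_2)
  then have "(\<lambda>w. J h (J h w)) ^^ 2 ^ k = J h ^^ 2 ^ Suc k" by (simp add: funpow_mult)
  then have "norm (euler (Suc k) t x - euler k t x) \<le> real (2 ^ k) * (h * h * norm z)"
    using J_power_two_steps[OF h(1) h(1) xy yz, of "2 ^ k"] h(2) by (simp add: euler_def h_def)
  also have "\<dots> = t\<^sup>2 / 4 * norm z * (1 / 2) ^ k"
    by (simp add: h_def power2_eq_square power_one_over field_simps)
  finally show ?thesis .
qed

lemma euler_limit:
  assumes t: "0 \<le> t" and xy: "(x, y) \<in> \<Gamma>" and yz: "(y, z) \<in> \<Gamma>"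
  shows "\<exists>w. (\<lambda>k. euler k t x) \<longlonglongrightarrow> w \<and> norm (w - J t x) \<le> t\<^sup>2 / 2 * norm z"
proof -
  let ?d = "\<lambda>k. euler (Suc k) t x - euler k t x" and ?g = "\<lambda>k. t\<^sup>2 / 4 * norm z * (1 / 2) ^ k"
  note le = euler_Suc_diff[OF assms]
  have g: "?g sums (t\<^sup>2 / 4 * norm z * 2)"
    using sums_mult[OF geometric_sums[of "1 / 2 :: real"], of "t\<^sup>2 / 4 * norm z"] by simp
  then have d: "summable ?d" using le by (auto intro: summable_comparison_test' sums_summable)
  have "(\<lambda>n. euler 0 t x + (\<Sum>k<n. ?d k)) \<longlonglongrightarrow> euler 0 t x + suminf ?d"
    by (intro tendsto_add tendsto_const summable_LIMSEQ d)
  moreover have "euler 0 t x + (\<Sum>k<n. ?d k) = euler n t x" for n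
    by (subst sum_lessThan_telescope) simp
  moreover have "norm (suminf ?d) \<le> suminf ?g"
    by (rule norm_suminf_le[OF le]) (use g in \<open>rule sums_summable\<close>)
  moreover have "suminf ?g = t\<^sup>2 / 2 * norm z"
    by (subst sums_unique[OF g, symmetric]) simp
  moreover have "euler 0 t x = J t x" by (simp add: euler_def)
  ultimately have "(\<lambda>n. euler n t x) \<longlonglongrightarrow> J t x + suminf ?d"
    "norm (J t x + suminf ?d - J t x) \<le> t\<^sup>2 / 2 * norm z" by (simp_all only: add_diff_cancel_left')
  then show ?thesis by blast
qed

lemma euler_convergent:
  assumes t: "0 \<le> t" and x: "x \<in> X"
  shows "convergent (\<lambda>k. euler k t x)"
proof (rule Cauchy_convergent, rule CauchyI)
  fix d :: real assume d: "0 < d"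
  obtain y z w where yz: "(y, z) \<in> \<Gamma>" "(z, w) \<in> \<Gamma>" "norm (x - y) < d / 3"
    using dense_graph_square[OF x, of "d / 3"] d by auto
  have "Cauchy (\<lambda>k. euler k t y)" using euler_limit[OF t yz(1,2)] LIMSEQ_imp_Cauchy by blast
  from CauchyD[OF this, of "d / 3"] d obtain N
    where N: "\<And>m n. m \<ge> N \<Longrightarrow> n \<ge> N \<Longrightarrow> norm (euler m t y - euler n t y) < d / 3" by auto
  have le: "norm (euler m t x - euler m t y) < d / 3" for m
    using sub_norm_diff[OF euler_sub[OF t] x graph_X(1)[OF yz(1)], of m] yz(3) by linarith
  have "norm (euler m t x - euler n t x) < d" if "m \<ge> N" "n \<ge> N" for m n
  proof -
    have "euler m t x - euler n t x = (euler m t x - euler m t y) + (euler m t y - euler n t y)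
        - (euler n t x - euler n t y)" by simp
    then have "norm (euler m t x - euler n t x) \<le> norm (euler m t x - euler m t y)
        + norm (euler m t y - euler n t y) + norm (euler n t x - euler n t y)"
      by (simp only: norm_add_diff_le)
    then show ?thesis using le[of m] le[of n] N[OF that] by linarith
  qed
  then show "\<exists>M. \<forall>m\<ge>M. \<forall>n\<ge>M. norm (euler m t x - euler n t x) < d" by blast
qed

definition Q :: "real \<Rightarrow> 'b \<Rightarrow> 'b" where
  "Q t x = lim (\<lambda>k. euler k t x)"

lemma Q_limit: "0 \<le> t \<Longrightarrow> x \<in> X \<Longrightarrow> (\<lambda>k. euler k t x) \<longlonglongrightarrow> Q t x"
  unfolding Q_def using euler_convergent convergent_LIMSEQ_iff by blast

lemma Q_sub: "0 \<le> t \<Longrightarrow> substochastic (Q t)"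
  using sub_limit[OF euler_sub Q_limit] by blast

lemmas Q_X = sub_X[OF Q_sub]

text \<open>
  The \<open>2 ^ k\<close> Euler steps for \<open>s\<close> and those for \<open>t\<close> can be interleaved, since all steps commute; pairing
  them costs at most a multiple of \<open>s t / 4 ^ k\<close> per pair.
\<close>

lemma Q_add_square:
  assumes s: "0 \<le> s" and t: "0 \<le> t" and xy: "(x, y) \<in> \<Gamma>" and yz: "(y, z) \<in> \<Gamma>"
  shows "Q (s + t) x = Q s (Q t x)"
proof -
  note x = graph_X(1)[OF xy]
  have comm: "((\<lambda>w. J a (J b w)) ^^ n) x = (J a ^^ n) ((J b ^^ n) x)"
    if ab: "0 \<le> a" "0 \<le> b" for a b n
  proof (induction n)
    case (Suc n)
    have "J b ((J a ^^ n) w) = (J a ^^ n) (J b w)" if "w \<in> X" for w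
    proof (induction n)
      case (Suc n)
      have "(J a ^^ n) w \<in> X" using sub_X[OF sub_funpow[OF J_sub[OF ab(1)]] that] .
      from J_commute[OF ab this] Suc.IH show ?case by simp
    qed simp
    then show ?case
      using Suc ab by (simp add: sub_X[OF sub_funpow[OF J_sub]] x)
  qed simp
  have "(\<lambda>k. euler k s (euler k t x) - euler k (s + t) x) \<longlonglongrightarrow> 0"
  proof (rule Lim_null_comparison[OF always_eventually])
    show "\<forall>k. norm (euler k s (euler k t x) - euler k (s + t) x) \<le> s * t * norm z * (1 / 2) ^ k"
    proof
      fix k
      have "0 \<le> s / 2 ^ k" "0 \<le> t / 2 ^ k" using s t by auto
      from J_power_two_steps[OF this xy yz, of "2 ^ k"] comm[OF this, of "2 ^ k"]
      have "norm (euler k s (euler k t x) - euler k (s + t) x)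
          \<le> real (2 ^ k) * (s / 2 ^ k * (t / 2 ^ k) * norm z)"
        by (simp add: euler_def add_divide_distrib)
      also have "\<dots> = s * t * norm z * (1 / 2) ^ k" by (simp add: power_one_over)
      finally show "norm (euler k s (euler k t x) - euler k (s + t) x)
          \<le> s * t * norm z * (1 / 2) ^ k" .
    qed
    show "(\<lambda>k. s * t * norm z * (1 / 2) ^ k) \<longlonglongrightarrow> 0"
      by (intro tendsto_mult_right_zero LIMSEQ_power_zero) simp
  qed
  moreover have "(\<lambda>k. euler k s (euler k t x) - Q s (Q t x)) \<longlonglongrightarrow> 0"
  proof (rule Lim_null_comparison[OF always_eventually])
    show "\<forall>k. norm (euler k s (euler k t x) - Q s (Q t x))
        \<le> norm (euler k t x - Q t x) + norm (euler k s (Q t x) - Q s (Q t x))"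
    proof
      fix k
      have "norm (euler k s (euler k t x) - euler k s (Q t x)) \<le> norm (euler k t x - Q t x)"
        by (intro sub_norm_diff euler_sub sub_X[OF euler_sub] Q_X s t x)
      then show "norm (euler k s (euler k t x) - Q s (Q t x))
        \<le> norm (euler k t x - Q t x) + norm (euler k s (Q t x) - Q s (Q t x))"
        using norm_triangle_ineq[of "euler k s (euler k t x) - euler k s (Q t x)"
            "euler k s (Q t x) - Q s (Q t x)"] by simp
    qed
    show "(\<lambda>k. norm (euler k t x - Q t x) + norm (euler k s (Q t x) - Q s (Q t x))) \<longlonglongrightarrow> 0"
      using tendsto_add[OF tendsto_norm_zero[OF LIM_zero[OF Q_limit[OF t x]]]
          tendsto_norm_zero[OF LIM_zero[OF Q_limit[OF s Q_X[OF t x]]]]] by simp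
  qed
  ultimately have "(\<lambda>k. (euler k s (euler k t x) - Q s (Q t x))
      - (euler k s (euler k t x) - euler k (s + t) x)) \<longlonglongrightarrow> 0 - 0"
    by (intro tendsto_diff)
  then have "(\<lambda>k. euler k (s + t) x) \<longlonglongrightarrow> Q s (Q t x)" by (simp add: LIM_zero_iff)
  with Q_limit[of "s + t" x] x s t show ?thesis by (simp add: LIMSEQ_unique)
qed

lemma Q_add:
  assumes s: "0 \<le> s" and t: "0 \<le> t" and x: "x \<in> X"
  shows "Q (s + t) x = Q s (Q t x)"
proof -
  have "norm (Q (s + t) x - Q s (Q t x)) \<le> 0 + d" if d: "0 < d" for d
  proof -
    obtain y z w where yz: "(y, z) \<in> \<Gamma>" "(z, w) \<in> \<Gamma>" "norm (x - y) < d / 2"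
      using dense_graph_square[OF x, of "d / 2"] d by auto
    note y = graph_X(1)[OF yz(1)]
    have "norm (Q (s + t) x - Q (s + t) y) \<le> norm (x - y)"
      using s t x y by (intro sub_norm_diff Q_sub) auto
    moreover have "norm (Q s (Q t x) - Q s (Q t y)) \<le> norm (x - y)"
      using s t x y by (intro sub_norm_diff[OF sub_comp[of "Q s" "Q t"]] Q_sub)
    moreover have "Q (s + t) y = Q s (Q t y)" by (rule Q_add_square[OF s t yz(1,2)])
    ultimately show ?thesis
      using yz(3) norm_triangle_ineq4[of "Q (s + t) x - Q (s + t) y" "Q s (Q t x) - Q s (Q t y)"]
      by simp
  qed
  then have "norm (Q (s + t) x - Q s (Q t x)) \<le> 0" by (rule field_le_epsilon)
  then show ?thesis by simp
qed

text \<open>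
  Strong continuity at 0 is visible on the dense domain, where the family is Lipschitz, and
  contractivity transports it to \<open>X\<close>. It is applied both to \<open>J\<close> and to \<open>Q\<close>.
\<close>

lemma tendsto_at_0_from_graph:
  assumes T: "\<And>t. 0 < t \<Longrightarrow> substochastic (T t)"
    and le: "\<And>t x y. 0 < t \<Longrightarrow> (x, y) \<in> \<Gamma> \<Longrightarrow> norm (T t x - x) \<le> t * norm y"
    and x: "x \<in> X"
  shows "((\<lambda>t. T t x) \<longlongrightarrow> x) (at_right 0)"
proof (rule tendstoI)
  fix d :: real assume d: "0 < d"
  obtain y z where yz: "(y, z) \<in> \<Gamma>" "norm (x - y) < d / 3"
    using dense[OF x, of "d / 3"] d by auto
  note y = graph_X(1)[OF yz(1)]
  define b where "b = d / (3 * (norm z + 1))"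
  have b: "0 < b" unfolding b_def using d by (intro divide_pos_pos) (auto simp: add_nonneg_pos)
  show "\<forall>\<^sub>F t in at_right 0. dist (T t x) x < d"
  proof (rule eventually_at_right_less[THEN eventually_rev_mp, of 0],
         rule eventually_mono[OF eventually_at_rightI[of 0 b "\<lambda>t. t < b"]])
    fix t :: real assume t: "t < b"
    show "0 < t \<longrightarrow> dist (T t x) x < d"
    proof
      assume t0: "0 < t"
      have "t * norm z \<le> b * (norm z + 1)" using t t0 b by (intro mult_mono) auto
      also have "\<dots> = d / 3" unfolding b_def by (simp add: field_simps add_nonneg_eq_0_iff)
      finally have 1: "norm (T t y - y) \<le> d / 3" using le[OF t0 yz(1)] by simp
      have 2: "norm (T t x - T t y) \<le> norm (x - y)" by (rule sub_norm_diff[OF T[OF t0] x y])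
      have "T t x - x = (T t x - T t y) + (T t y - y) - (x - y)" by simp
      then have "norm (T t x - x) \<le> norm (T t x - T t y) + norm (T t y - y) + norm (x - y)"
        by (simp only: norm_add_diff_le)
      then show "dist (T t x) x < d" using 1 2 yz(2) by (simp add: dist_norm)
    qed
  qed (use b in auto)
qed

lemma J_tendsto: "x \<in> X \<Longrightarrow> ((\<lambda>t. J t x) \<longlongrightarrow> x) (at_right 0)"
proof (rule tendsto_at_0_from_graph)
  show "norm (J t x - x) \<le> t * norm y" if "0 < t" "(x, y) \<in> \<Gamma>" for t x y
    using J_eq_add[of t x y] J_norm[of t y] graph_X[OF that(2)] that by simp
qed (auto simp: J_sub)

lemma Q_lipschitz:
  assumes t: "0 \<le> t" and xy: "(x, y) \<in> \<Gamma>"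
  shows "norm (Q t x - x) \<le> t * norm y"
proof (rule LIMSEQ_le_const2)
  note x = graph_X(1)[OF xy]
  show "(\<lambda>k. norm (euler k t x - x)) \<longlonglongrightarrow> norm (Q t x - x)"
    by (intro tendsto_intros Q_limit t x)
  have "norm (euler k t x - x) \<le> t * norm y" for k
  proof -
    have h: "0 \<le> t / 2 ^ k" using t by simp
    have "norm ((J (t / 2 ^ k) ^^ (2 ^ k)) x - (id ^^ (2 ^ k)) x)
        \<le> real (2 ^ k) * norm (J (t / 2 ^ k) x - id x)"
      by (rule norm_commuting_powers_diff_le[where X = X])
         (auto simp: sub_norm_diff[OF J_sub[OF h]] J_X[OF h] x)
    also have "norm (J (t / 2 ^ k) x - id x) \<le> t / 2 ^ k * norm y"
      using J_eq_add[OF h xy] J_norm[OF h graph_X(2)[OF xy]] t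
      by (simp add: divide_right_mono mult_left_mono)
    finally show ?thesis by (simp add: euler_def)
  qed
  then show "\<exists>N. \<forall>n\<ge>N. norm (euler n t x - x) \<le> t * norm y" by blast
qed

text \<open>The Euler scheme with a single step is already within \<open>O(t\<^sup>2)\<close> of \<open>Q t x\<close> and of \<open>x + t C x\<close>.\<close>

lemma Q_diff_quotient_square:
  assumes t: "0 < t" and xy: "(x, y) \<in> \<Gamma>" and yz: "(y, z) \<in> \<Gamma>"
  shows "norm ((1 / t) *\<^sub>R (Q t x - x) - y) \<le> 2 * t * norm z"
proof -
  have t': "0 \<le> t" using t by simp
  have le: "norm (Q t x - J t x) \<le> t\<^sup>2 / 2 * norm z"
    using euler_limit[OF t' xy yz] Q_limit[OF t' graph_X(1)[OF xy]] LIMSEQ_unique by blast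
  have "t\<^sup>2 / 2 * norm z \<le> t\<^sup>2 * norm z" by simp
  with le have "norm (Q t x - J t x) \<le> t\<^sup>2 * norm z" by (rule order_trans)
  moreover have "J t x - x - t *\<^sub>R y = (t * t) *\<^sub>R J t z"
    using J_eq_add[OF t' xy] J_eq_add[OF t' yz] by (simp add: algebra_simps)
  then have "norm (J t x - x - t *\<^sub>R y) \<le> t\<^sup>2 * norm z"
    using J_norm[OF t' graph_X(2)[OF yz]] by (simp add: power2_eq_square mult_left_mono)
  ultimately have "norm ((Q t x - J t x) + (J t x - x - t *\<^sub>R y)) \<le> 2 * (t\<^sup>2 * norm z)"
    by (intro order_trans[OF norm_triangle_ineq]) linarith
  moreover have "(Q t x - J t x) + (J t x - x - t *\<^sub>R y) = Q t x - x - t *\<^sub>R y" by simp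
  ultimately have "norm (Q t x - x - t *\<^sub>R y) \<le> 2 * t\<^sup>2 * norm z"
    by (simp only: mult.assoc)
  moreover have "(1 / t) *\<^sub>R (Q t x - x) - y = (1 / t) *\<^sub>R (Q t x - x - t *\<^sub>R y)"
    using t by (simp add: scaleR_diff_right)
  ultimately show ?thesis using t by (simp add: divide_simps power2_eq_square mult_ac)
qed

text \<open>
  For \<open>x\<close> in the domain of \<open>C\<close> only, replace \<open>x\<close> by \<open>J a x\<close>, which lies in the domain of \<open>C\<^sup>2\<close>. By the
  Lipschitz bound the difference quotients change by at most \<open>norm (C x - C (J a x))\<close>, uniformly in
  the time step, and this is small for small \<open>a\<close>.
\<close>

lemma graph_subset_gen_Q: "\<Gamma> \<subseteq> gen Q"
proof (rule subrelI)
  fix x y assume xy: "(x, y) \<in> \<Gamma>"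
  have "((\<lambda>h. (1 / h) *\<^sub>R (Q h x - x)) \<longlongrightarrow> y) (at_right 0)"
  proof (rule tendstoI)
    fix d :: real assume d: "0 < d"
    have "\<forall>\<^sub>F a in at_right 0. 0 < a \<and> dist (J a y) y < d / 3"
      using tendstoD[OF J_tendsto[OF graph_X(2)[OF xy]], of "d / 3"] d eventually_at_right_less[of 0]
      by (auto intro: eventually_conj)
    then obtain a where a: "0 < a" "norm (y - J a y) < d / 3"
      using eventually_happens'[of "at_right (0::real)"] by (auto simp: dist_norm norm_minus_commute)
    define x' where "x' = J a x"
    define y' where "y' = J a y"
    define z' where "z' = (1 / a) *\<^sub>R (J a y - y)"
    have xy': "(x', y') \<in> \<Gamma>" and yz': "(y', z') \<in> \<Gamma>"
      unfolding x'_def y'_def z'_def using a J_graph_commute[OF _ xy] J_graph graph_X[OF xy] by auto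
    have "((\<lambda>h::real. 2 * h * norm z') \<longlongrightarrow> 2 * 0 * norm z') (at_right 0)" by (intro tendsto_intros)
    then have "\<forall>\<^sub>F h in at_right 0. 2 * h * norm z' < d / 3"
      using d by (intro order_tendstoD(2)) auto
    then show "\<forall>\<^sub>F h in at_right 0. dist ((1 / h) *\<^sub>R (Q h x - x)) y < d"
    proof (rule eventually_rev_mp[OF eventually_conj[OF eventually_at_right_less]],
        intro always_eventually allI impI)
      fix h :: real assume h: "0 < h \<and> 2 * h * norm z' < d / 3"
      have q: "(1 / h) *\<^sub>R (Q h (x - x') - (x - x')) =
          (1 / h) *\<^sub>R (Q h x - x) - (1 / h) *\<^sub>R (Q h x' - x')"
      proof -
        have "Q h (x - x') = Q h x - Q h x'"
          using h by (intro sub_diff[OF Q_sub] graph_X[OF xy] graph_X[OF xy']) simp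
        then have "Q h (x - x') - (x - x') = (Q h x - x) - (Q h x' - x')" by simp
        then show ?thesis by (simp only: scaleR_diff_right)
      qed
      have "norm (Q h (x - x') - (x - x')) \<le> h * norm (y - y')"
        using h by (intro Q_lipschitz graph_diff xy xy') simp
      then have "norm ((1 / h) *\<^sub>R (Q h (x - x') - (x - x'))) \<le> norm (y - y')"
        using h by (simp add: divide_le_eq mult.commute)
      then have 1: "norm ((1 / h) *\<^sub>R (Q h (x - x') - (x - x'))) < d / 3"
        using a(2) unfolding y'_def by linarith
      have 2: "norm ((1 / h) *\<^sub>R (Q h x' - x') - y') < d / 3"
        using Q_diff_quotient_square[OF _ xy' yz', of h] h by simp
      have "(1 / h) *\<^sub>R (Q h x - x) - y = (1 / h) *\<^sub>R (Q h (x - x') - (x - x'))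
          + ((1 / h) *\<^sub>R (Q h x' - x') - y') - (y - y')" unfolding q by simp
      then have "norm ((1 / h) *\<^sub>R (Q h x - x) - y) \<le> norm ((1 / h) *\<^sub>R (Q h (x - x') - (x - x')))
          + norm ((1 / h) *\<^sub>R (Q h x' - x') - y') + norm (y - y')"
        by (simp only: norm_add_diff_le)
      then show "dist ((1 / h) *\<^sub>R (Q h x - x)) y < d"
        using 1 2 a(2) unfolding dist_norm y'_def by linarith
    qed
  qed
  then show "(x, y) \<in> gen Q" using graph_X[OF xy] by (simp add: gen_def)
qed

theorem hille_yosida: "semigroup Q"
  unfolding semigroup_def
proof (intro conjI allI impI ballI)
  show "substochastic (Q t)" if "0 \<le> t" for t by (rule Q_sub[OF that])
  show "Q (s + t) x = Q s (Q t x)" if "0 \<le> s" "0 \<le> t" "x \<in> X" for s t x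
    by (rule Q_add[OF that])
  fix x assume x: "x \<in> X"
  have "euler k 0 x = x" for k
  proof -
    have "J 0 = id" by (simp add: fun_eq_iff J_def)
    then show ?thesis by (simp add: euler_def)
  qed
  then show "Q 0 x = x" using Q_limit[of 0 x] x by (simp add: LIMSEQ_const_iff)
  show "((\<lambda>t. Q t x) \<longlongrightarrow> x) (at_right 0)"
    by (rule tendsto_at_0_from_graph[OF _ _ x]) (auto simp: Q_sub Q_lipschitz)
qed

end

section \<open>Generators of substochastic semigroups\<close>

lemma right_difference_quotient_tendsto:
  fixes f :: "real \<Rightarrow> 'b::real_normed_vector"
  assumes f: "(f has_vector_derivative d) (at x within {0..b})" and x: "0 \<le> x" "x < b"
  shows "((\<lambda>h. (1 / h) *\<^sub>R (f (x + h) - f x)) \<longlongrightarrow> d) (at_right 0)"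
proof -
  have "(f has_vector_derivative d) (at x within {x..b})"
    by (rule has_vector_derivative_within_subset[OF f]) (use x in auto)
  then have "((\<lambda>y. (1 / norm (y - x)) *\<^sub>R (f y - (f x + (y - x) *\<^sub>R d))) \<longlongrightarrow> 0) (at_right x)"
    using x(2) by (simp add: has_vector_derivative_def has_derivative_within at_within_Icc_at_right)
  then have "((\<lambda>h. (1 / norm h) *\<^sub>R (f (h + x) - (f x + h *\<^sub>R d))) \<longlongrightarrow> 0) (at_right 0)"
    by (subst (asm) at_right_to_0) (simp add: filterlim_filtermap)
  then have "((\<lambda>h. (1 / h) *\<^sub>R (f (x + h) - f x) - d) \<longlongrightarrow> 0) (at_right 0)"
  proof (rule Lim_transform_eventually)
    show "\<forall>\<^sub>F h in at_right 0. (1 / norm h) *\<^sub>R (f (h + x) - (f x + h *\<^sub>R d)) =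
        (1 / h) *\<^sub>R (f (x + h) - f x) - d"
      using eventually_at_right_less[of 0]
      by (rule eventually_mono) (simp add: scaleR_diff_right scaleR_add_right add.commute)
  qed
  then show ?thesis by (rule LIM_zero_cancel)
qed

context AL_space
begin

lemma orbit_continuous:
  assumes S: "semigroup S" and x: "x \<in> X"
  shows "continuous_on {0..} (\<lambda>t. S t x)"
  unfolding continuous_on_iff
proof (intro ballI allI impI)
  fix t d :: real assume t: "t \<in> {0..}" and d: "0 < d"
  have "\<forall>\<^sub>F h in at_right 0. dist (S h x) x < d" by (rule tendstoD[OF semi_cont[OF S x] d])
  then obtain b where b: "0 < b" "\<And>h. 0 < h \<Longrightarrow> h < b \<Longrightarrow> dist (S h x) x < d"
    by (auto simp: eventually_at_right_field)
  have less: "dist (S (r + h) x) (S r x) < d" if "0 \<le> r" "0 \<le> h" "h < b" for r h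
  proof (cases "h = 0")
    case False
    have "S (r + h) x = S r (S h x)" using that by (intro semi_add[OF S]) (auto simp: x)
    then have "dist (S (r + h) x) (S r x) \<le> dist (S h x) x"
      unfolding dist_norm using that sub_norm_diff[OF semi_sub[OF S, of r]]
        sub_X[OF semi_sub[OF S, of h] x] x by simp
    also have "\<dots> < d" using that False by (intro b) auto
    finally show ?thesis .
  qed (use d in simp)
  show "\<exists>b>0. \<forall>s\<in>{0..}. dist s t < b \<longrightarrow> dist (S s x) (S t x) < d"
  proof (intro exI[of _ b] conjI ballI impI b(1))
    fix s assume s: "s \<in> {0..}" "dist s t < b"
    show "dist (S s x) (S t x) < d"
    proof (cases "t \<le> s")
      case True
      then show ?thesis using less[of t "s - t"] s t by (simp add: dist_real_def)
    next
      case False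
      then show ?thesis using less[of s "t - s"] s t by (simp add: dist_real_def dist_commute)
    qed
  qed
qed

text \<open>
  Riemann sums are combinations with nonnegative coefficients, so the integral cannot leave a
  closed convex cone.
\<close>

lemma has_integral_in_closed_cone:
  fixes C :: "'b set"
  assumes f: "(f has_integral I) {a..b}" and C: "\<And>t::real. a \<le> t \<Longrightarrow> t \<le> b \<Longrightarrow> f t \<in> C"
    and closed: "closed C" and 0: "0 \<in> C" and add: "\<And>p q. p \<in> C \<Longrightarrow> q \<in> C \<Longrightarrow> p + q \<in> C"
    and scale: "\<And>p c. p \<in> C \<Longrightarrow> 0 \<le> c \<Longrightarrow> c *\<^sub>R p \<in> C"
  shows "I \<in> C"
proof (rule Lim_in_closed_set[OF closed])
  show "((\<lambda>p. \<Sum>(x, k)\<in>p. measure lborel k *\<^sub>R f x) \<longlongrightarrow> I) (division_filter (cbox a b))"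
    using f by (simp add: has_integral_cbox flip: box_real)
  have sum: "sum g J \<in> C" if "\<And>j. j \<in> J \<Longrightarrow> g j \<in> C" for g and J :: "(real \<times> real set) set"
    using that by (induction J rule: infinite_finite_induct) (auto simp: 0 add)
  show "\<forall>\<^sub>F p in division_filter (cbox a b). (\<Sum>(x, k)\<in>p. measure lborel k *\<^sub>R f x) \<in> C"
  proof (rule eventually_mono[OF eventually_division_filter_tagged_division])
    fix p assume p: "p tagged_division_of cbox a b"
    show "(\<Sum>(x, k)\<in>p. measure lborel k *\<^sub>R f x) \<in> C"
    proof (rule sum, clarify)
      fix x k assume "(x, k) \<in> p"
      then have "x \<in> cbox a b" using tagged_division_ofD(2,3)[OF p] by blast
      then show "measure lborel k *\<^sub>R f x \<in> C" by (intro scale C) auto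
    qed
  qed
qed (rule division_filter_not_empty)

lemma has_integral_X:
  "(f has_integral I) {a..b} \<Longrightarrow> (\<And>t::real. a \<le> t \<Longrightarrow> t \<le> b \<Longrightarrow> f t \<in> X) \<Longrightarrow> I \<in> X"
  by (rule has_integral_in_closed_cone[OF _ _ closed_X X_0 X_add X_scale])

lemma has_integral_pos:
  "(f has_integral I) {a..b} \<Longrightarrow> (\<And>t::real. a \<le> t \<Longrightarrow> t \<le> b \<Longrightarrow> f t \<in> pos) \<Longrightarrow> I \<in> pos"
  by (rule has_integral_in_closed_cone[OF _ _ closed_pos pos_0 pos_add pos_scale])

text \<open>\<open>T\<close> is linear and bounded on \<open>X\<close> only; this is enough because all Riemann sums lie in \<open>X\<close>.\<close>

lemma has_integral_substochastic:
  assumes T: "substochastic T" and f: "(f has_integral I) {a..b}"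
    and X: "\<And>t::real. a \<le> t \<Longrightarrow> t \<le> b \<Longrightarrow> f t \<in> X"
  shows "((\<lambda>t. T (f t)) has_integral T I) {a..b}"
proof -
  have I: "I \<in> X" by (rule has_integral_X[OF f X])
  let ?sum = "\<lambda>f p. \<Sum>(x, k)\<in>p. measure lborel k *\<^sub>R (f x :: 'b)"
  let ?F = "division_filter (cbox a b)"
  have lim: "(?sum f \<longlongrightarrow> I) ?F" using f by (simp add: has_integral_cbox flip: box_real)
  have "((\<lambda>p. ?sum (\<lambda>t. T (f t)) p - T I) \<longlongrightarrow> 0) ?F"
  proof (rule Lim_null_comparison)
    show "((\<lambda>p. norm (?sum f p - I)) \<longlongrightarrow> 0) ?F" by (rule tendsto_norm_zero[OF LIM_zero[OF lim]])
    show "\<forall>\<^sub>F p in ?F. norm (?sum (\<lambda>t. T (f t)) p - T I) \<le> norm (?sum f p - I)"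
    proof (rule eventually_mono[OF eventually_division_filter_tagged_division])
      fix p assume p: "p tagged_division_of cbox a b"
      have fX: "f x \<in> X" if "(x, k) \<in> p" for x k
      proof -
        have "x \<in> cbox a b" using tagged_division_ofD(2,3)[OF p] that by blast
        then show ?thesis by (intro X) auto
      qed
      have sX: "?sum f p \<in> X" by (rule X_sum) (auto intro: X_scale fX)
      have "?sum (\<lambda>t. T (f t)) p = T (?sum f p)"
        by (subst lin_sum[OF sub_lin[OF T]]) (auto intro!: sum.cong simp: sub_scale[OF T] X_scale fX)
      then show "norm (?sum (\<lambda>t. T (f t)) p - T I) \<le> norm (?sum f p - I)"
        using sub_norm_diff[OF T sX I] by simp
    qed
  qed
  then show ?thesis by (simp add: has_integral_cbox LIM_zero_iff flip: box_real)
qed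

lemma neumann_series:
  assumes T: "substochastic T" and c: "0 \<le> c" "c < 1" and z: "z \<in> X"
  shows "\<exists>u\<in>X. u - c *\<^sub>R T u = z \<and> (z \<in> pos \<longrightarrow> u \<in> pos)"
proof -
  define f where "f n = c ^ n *\<^sub>R (T ^^ n) z" for n
  have TX: "(T ^^ n) z \<in> X" for n by (rule sub_X[OF sub_funpow[OF T] z])
  have "summable f"
  proof (rule summable_comparison_test')
    show "summable (\<lambda>n. c ^ n * norm z)" using c by (intro summable_mult2 summable_geometric) simp
    show "norm (f n) \<le> c ^ n * norm z" for n
      using sub_norm[OF sub_funpow[OF T] z, of n] c by (simp add: f_def mult_left_mono)
  qed
  then have lim: "(\<lambda>N. \<Sum>n<N. f n) \<longlonglongrightarrow> suminf f" by (rule summable_LIMSEQ)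
  have sX: "(\<Sum>n<N. f n) \<in> X" for N by (rule X_sum) (simp add: f_def X_scale TX)
  have uX: "suminf f \<in> X" by (rule Lim_in_closed_set[OF closed_X _ _ lim]) (auto simp: sX)
  have Tlim: "(\<lambda>N. T (\<Sum>n<N. f n)) \<longlonglongrightarrow> T (suminf f)"
  proof (rule LIM_zero_cancel)
    show "(\<lambda>N. T (\<Sum>n<N. f n) - T (suminf f)) \<longlonglongrightarrow> 0"
      by (rule Lim_null_comparison[OF always_eventually tendsto_norm_zero[OF LIM_zero[OF lim]]])
         (simp add: sub_norm_diff[OF T] sX uX)
  qed
  have rec: "(\<Sum>n<Suc N. f n) = z + c *\<^sub>R T (\<Sum>n<N. f n)" for N
  proof -
    have "c *\<^sub>R T (f n) = f (Suc n)" for n by (simp add: f_def sub_scale[OF T TX])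
    then show ?thesis
      by (subst lin_sum[OF sub_lin[OF T]])
         (auto simp: f_def X_scale TX sum.lessThan_Suc_shift scaleR_sum_right sub_scale[OF T TX]
           simp del: sum.lessThan_Suc)
  qed
  have "(\<lambda>N. z + c *\<^sub>R T (\<Sum>n<N. f n)) \<longlonglongrightarrow> z + c *\<^sub>R T (suminf f)" by (intro tendsto_intros Tlim)
  moreover have "(\<lambda>N. \<Sum>n<Suc N. f n) \<longlonglongrightarrow> suminf f" using lim by (rule LIMSEQ_Suc)
  ultimately have "suminf f = z + c *\<^sub>R T (suminf f)" unfolding rec by (simp add: LIMSEQ_unique)
  moreover have "suminf f \<in> pos" if "z \<in> pos"
    by (rule Lim_in_closed_set[OF closed_pos _ _ lim])
       (auto intro!: always_eventually pos_sum pos_scale sub_pos[OF sub_funpow[OF T]]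
         simp: f_def that c)
  ultimately show ?thesis using uX by (intro bexI[of _ "suminf f"]) (auto simp: algebra_simps)
qed

text \<open>
  Shifting the variable gives \<open>exp (- l h) S h w = \<integral>\<^sub>h\<^bsup>a + h\<^esup> F\<close>, so the difference quotient of \<open>w\<close> along
  the rescaled semigroup is a difference of two short averages of \<open>F\<close>, near \<open>a\<close> and near 0. The case
  \<open>l > 0\<close>, \<open>a = 1\<close> yields the resolvent, the case \<open>l = 0\<close>, \<open>a \<longlongrightarrow> 0\<close> the density of the domain.
\<close>

lemma orbit_integral:
  fixes l :: real
  assumes S: "semigroup S" and u: "u \<in> X" and a: "0 < a"
  defines "F \<equiv> \<lambda>t. exp (- l * t) *\<^sub>R S t u"
  defines "w \<equiv> integral {0..a} F"
  shows "(w, l *\<^sub>R w + exp (- l * a) *\<^sub>R S a u - u) \<in> gen S" (is ?gen)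
    and "u \<in> pos \<Longrightarrow> w \<in> pos"
    and "((\<lambda>h. (1 / h) *\<^sub>R integral {0..h} F) \<longlongrightarrow> u) (at_right 0)"
proof -
  have FX: "F t \<in> X" if "0 \<le> t" for t
    unfolding F_def by (intro X_scale sub_X[OF semi_sub[OF S that] u])
  have cont: "continuous_on {0..b} F" for b
    unfolding F_def using orbit_continuous[OF S u]
    by (intro continuous_intros) (auto intro: continuous_on_subset)
  have int: "F integrable_on {c..b}" if "0 \<le> c" for c b
    using cont[of b] that by (intro integrable_continuous_real) (auto intro: continuous_on_subset)
  have int_w: "(F has_integral w) {0..a}" unfolding w_def using int by blast
  have wX: "w \<in> X" by (rule has_integral_X[OF int_w FX])
  show "w \<in> pos" if "u \<in> pos"
    by (rule has_integral_pos[OF int_w])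
       (auto simp: F_def intro!: pos_scale sub_pos[OF semi_sub[OF S]] that)
  define \<Phi> where "\<Phi> s = integral {0..s} F" for s
  have F0: "F 0 = u" by (simp add: F_def semi_0[OF S u])
  have deriv: "(\<Phi> has_vector_derivative F x) (at x within {0..b})" if "0 \<le> x" "x \<le> b" for x b
    unfolding \<Phi>_def using that by (intro integral_has_vector_derivative cont) auto
  have lim_a: "((\<lambda>h. (1 / h) *\<^sub>R (\<Phi> (a + h) - \<Phi> a)) \<longlongrightarrow> F a) (at_right 0)"
    by (rule right_difference_quotient_tendsto[where b = "a + 1"]) (use a deriv in auto)
  have "((\<lambda>h. (1 / h) *\<^sub>R (\<Phi> (0 + h) - \<Phi> 0)) \<longlongrightarrow> F 0) (at_right 0)"
    by (rule right_difference_quotient_tendsto[where b = "1"]) (use deriv in auto)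
  then have lim_0: "((\<lambda>h. (1 / h) *\<^sub>R \<Phi> h) \<longlongrightarrow> u) (at_right 0)"
    by (simp add: \<Phi>_def F0)
  then show "((\<lambda>h. (1 / h) *\<^sub>R integral {0..h} F) \<longlongrightarrow> u) (at_right 0)" by (simp add: \<Phi>_def)
  have shift: "S h w = exp (l * h) *\<^sub>R (\<Phi> (a + h) - \<Phi> h)" if h: "0 < h" for h
  proof -
    have h': "0 \<le> h" using h by simp
    have "((\<lambda>t. S h (F t)) has_integral S h w) {0..a}"
      by (rule has_integral_substochastic[OF semi_sub[OF S h'] int_w FX])
    then have "((\<lambda>t. exp (- l * h) *\<^sub>R S h (F t)) has_integral exp (- l * h) *\<^sub>R S h w) {0..a}"
      by (rule has_integral_cmul)
    moreover have "exp (- l * h) *\<^sub>R S h (F t) = (F \<circ> (+) h) t" if "t \<in> {0..a}" for t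
    proof -
      have t: "0 \<le> t" using that by simp
      have "S h (F t) = exp (- l * t) *\<^sub>R S h (S t u)"
        unfolding F_def by (rule sub_scale[OF semi_sub[OF S h'] sub_X[OF semi_sub[OF S t] u]])
      also have "S h (S t u) = S (h + t) u" using semi_add[OF S h' t u] by simp
      finally show ?thesis by (simp add: F_def algebra_simps flip: exp_add)
    qed
    ultimately have "((F \<circ> (+) h) has_integral exp (- l * h) *\<^sub>R S h w) {0..a}"
      by (rule has_integral_eq[rotated])
    then have "(F has_integral exp (- l * h) *\<^sub>R S h w) {h..a + h}"
      by (simp add: has_integral_shift_Icc_real)
    moreover have "\<Phi> h + integral {h..a + h} F = \<Phi> (a + h)"
      unfolding \<Phi>_def by (intro Henstock_Kurzweil_Integration.integral_combine int) (use h a in auto)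
    ultimately have "exp (- l * h) *\<^sub>R S h w = \<Phi> (a + h) - \<Phi> h"
      by (auto simp: integral_unique algebra_simps)
    then have "exp (l * h) *\<^sub>R (exp (- l * h) *\<^sub>R S h w) = exp (l * h) *\<^sub>R (\<Phi> (a + h) - \<Phi> h)" by simp
    then show ?thesis by (simp flip: exp_add)
  qed
  have "((\<lambda>h. (exp (l * h) - 1) / h) \<longlongrightarrow> l) (at 0)"
  proof -
    have "((\<lambda>h. exp (l * h)) has_real_derivative l) (at 0)"
      by (auto intro!: derivative_eq_intros)
    then show ?thesis by (simp add: has_field_derivative_def DERIV_def field_has_derivative_at)
  qed
  then have lim_exp: "((\<lambda>h. (exp (l * h) - 1) / h) \<longlongrightarrow> l) (at_right 0)"
    by (rule tendsto_within_subset) simp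
  have lim_1: "((\<lambda>h. exp (l * h)) \<longlongrightarrow> exp (l * 0)) (at_right 0)" by (intro tendsto_intros)
  have "((\<lambda>h. exp (l * h) *\<^sub>R ((1 / h) *\<^sub>R (\<Phi> (a + h) - \<Phi> a) - (1 / h) *\<^sub>R \<Phi> h)
      + ((exp (l * h) - 1) / h) *\<^sub>R w) \<longlongrightarrow> exp (l * 0) *\<^sub>R (F a - u) + l *\<^sub>R w) (at_right 0)"
    by (intro tendsto_add tendsto_scaleR tendsto_diff lim_1 lim_a lim_0 lim_exp tendsto_const)
  then have "((\<lambda>h. (1 / h) *\<^sub>R (S h w - w)) \<longlongrightarrow> exp (l * 0) *\<^sub>R (F a - u) + l *\<^sub>R w) (at_right 0)"
  proof (rule Lim_transform_eventually)
    have w: "\<Phi> a = w" by (simp add: \<Phi>_def w_def)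
    show "\<forall>\<^sub>F h in at_right 0. exp (l * h) *\<^sub>R ((1 / h) *\<^sub>R (\<Phi> (a + h) - \<Phi> a) - (1 / h) *\<^sub>R \<Phi> h)
        + ((exp (l * h) - 1) / h) *\<^sub>R w = (1 / h) *\<^sub>R (S h w - w)"
      using eventually_at_right_less[of 0]
      by (rule eventually_mono) (simp add: shift w algebra_simps diff_divide_distrib)
  qed
  then show ?gen
    using wX FX[of a] a u by (simp add: gen_def F_def X_add X_diff X_scale algebra_simps)
qed

text \<open>
  If \<open>u\<close> solves \<open>u - exp (- l) S 1 u = z\<close>, the integral of the rescaled orbit of \<open>u\<close> over \<open>[0, 1]\<close> is the
  resolvent at \<open>z\<close>: a Neumann series and a proper integral replace the Laplace transform.
  Dissipativity is the contractivity of \<open>S h\<close> read off the difference quotient.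
\<close>

theorem m_dissipative_gen:
  assumes S: "semigroup S"
  shows "m_dissipative X pos e (gen S)"
proof -
  have lin: "linear_on_X (S h)" if "0 < h" for h by (rule sub_lin[OF semi_sub[OF S]]) (use that in simp)
  have diss: "l * norm x \<le> norm (l *\<^sub>R x - y)" if xy: "(x, y) \<in> gen S" and l: "0 < l" for l x y
  proof (rule tendsto_lowerbound)
    show "((\<lambda>h. norm (l *\<^sub>R x - (1 / h) *\<^sub>R (S h x - x))) \<longlongrightarrow> norm (l *\<^sub>R x - y)) (at_right 0)"
      using xy unfolding gen_def by (intro tendsto_intros) auto
    show "\<forall>\<^sub>F h in at_right 0. l * norm x \<le> norm (l *\<^sub>R x - (1 / h) *\<^sub>R (S h x - x))"
      using eventually_at_right_less[of 0]
    proof (rule eventually_mono)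
      fix h :: real assume h: "0 < h"
      have x: "x \<in> X" using xy by (simp add: gen_def)
      have "norm ((1 / h) *\<^sub>R S h x) \<le> (1 / h) * norm x"
        using sub_norm[OF semi_sub[OF S] x, of h] h by (simp add: divide_right_mono)
      moreover have "norm ((l + 1 / h) *\<^sub>R x) = l * norm x + (1 / h) * norm x"
        using h l by (simp add: distrib_right)
      moreover have "l *\<^sub>R x - (1 / h) *\<^sub>R (S h x - x) = (l + 1 / h) *\<^sub>R x - (1 / h) *\<^sub>R S h x"
        by (simp add: algebra_simps)
      ultimately show "l * norm x \<le> norm (l *\<^sub>R x - (1 / h) *\<^sub>R (S h x - x))"
        using norm_triangle_ineq2[of "(l + 1 / h) *\<^sub>R x" "(1 / h) *\<^sub>R S h x"] by simp
    qed
  qed simp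
  have sub: "subspace (gen S)"
  proof (rule subspaceI)
    show "0 \<in> gen S"
    proof -
      have "\<forall>\<^sub>F h in at_right 0. 0 = (1 / h) *\<^sub>R (S h 0 - 0)"
        using eventually_at_right_less[of 0] by (rule eventually_mono) (simp add: lin_0[OF lin])
      then show ?thesis
        using X_0 by (auto simp: gen_def zero_prod_def intro: Lim_transform_eventually[OF tendsto_const])
    qed
  next
    fix p q assume "p \<in> gen S" "q \<in> gen S"
    then obtain x y x' y' where pq: "p = (x, y)" "q = (x', y')" and X: "x \<in> X" "x' \<in> X" "y \<in> X" "y' \<in> X"
      and lim: "((\<lambda>h. (1 / h) *\<^sub>R (S h x - x)) \<longlongrightarrow> y) (at_right 0)"
        "((\<lambda>h. (1 / h) *\<^sub>R (S h x' - x')) \<longlongrightarrow> y') (at_right 0)"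
      unfolding gen_def by blast
    have "((\<lambda>h. (1 / h) *\<^sub>R (S h (x + x') - (x + x'))) \<longlongrightarrow> y + y') (at_right 0)"
      by (rule Lim_transform_eventually[OF tendsto_add[OF lim]],
          rule eventually_mono[OF eventually_at_right_less[of 0]])
         (simp add: lin_add[OF lin] X algebra_simps)
    then show "p + q \<in> gen S" using X by (simp add: pq gen_def X_add)
  next
    fix c p assume "p \<in> gen S"
    then obtain x y where p: "p = (x, y)" and X: "x \<in> X" "y \<in> X"
      and lim: "((\<lambda>h. (1 / h) *\<^sub>R (S h x - x)) \<longlongrightarrow> y) (at_right 0)"
      unfolding gen_def by blast
    have "((\<lambda>h. (1 / h) *\<^sub>R (S h (c *\<^sub>R x) - c *\<^sub>R x)) \<longlongrightarrow> c *\<^sub>R y) (at_right 0)"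
      by (rule Lim_transform_eventually[OF tendsto_scaleR[OF tendsto_const lim]],
          rule eventually_mono[OF eventually_at_right_less[of 0]])
         (simp add: lin_scale[OF lin] X algebra_simps)
    then show "c *\<^sub>R p \<in> gen S" using X by (simp add: p gen_def X_scale)
  qed
  have range: "\<exists>x. (x, l *\<^sub>R x - z) \<in> gen S \<and> (z \<in> pos \<longrightarrow> x \<in> pos)" if l: "0 < l" and z: "z \<in> X" for l z
  proof -
    have "exp (- l * 1) < 1" using l by simp
    from neumann_series[OF semi_sub[OF S, of 1] _ this z]
    obtain u where u: "u \<in> X" "u - exp (- l * 1) *\<^sub>R S 1 u = z" "z \<in> pos \<longrightarrow> u \<in> pos" by auto
    obtain w where w: "(w, l *\<^sub>R w + exp (- l * 1) *\<^sub>R S 1 u - u) \<in> gen S" "u \<in> pos \<longrightarrow> w \<in> pos"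
      using orbit_integral(1,2)[OF S u(1), of 1 l] by force
    have "l *\<^sub>R w + exp (- l * 1) *\<^sub>R S 1 u - u = l *\<^sub>R w - z"
      unfolding u(2)[symmetric] by simp
    with w u(3) show ?thesis by (intro exI[of _ w]) (simp only:, blast)
  qed
  show ?thesis
  proof (unfold_locales)
    show "subspace (gen S)" by (rule sub)
    show "gen S \<subseteq> X \<times> X" by (auto simp: gen_def)
    show "l * norm x \<le> norm (l *\<^sub>R x - y)" if "(x, y) \<in> gen S" "0 < l" for l x y
      by (rule diss[OF that])
    show "\<exists>x. (x, l *\<^sub>R x - z) \<in> gen S" if "0 < l" "z \<in> X" for l z using range[OF that] by blast
    show "x \<in> pos" if x: "(x, l *\<^sub>R x - z) \<in> gen S" and l: "0 < l" and z: "z \<in> pos" for x l z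
    proof -
      obtain w where w: "(w, l *\<^sub>R w - z) \<in> gen S" "w \<in> pos" using range[OF l pos_X[OF z]] z by blast
      have "(x - w, l *\<^sub>R (x - w)) \<in> gen S"
        using subspace_diff[OF sub x w(1)] by (simp add: algebra_simps)
      from diss[OF this l] l have "x = w" by (simp add: mult_le_0_iff)
      with w show ?thesis by simp
    qed
    show "\<exists>(y, z)\<in>gen S. norm (x - y) < d" if x: "x \<in> X" and d: "0 < d" for x d
    proof -
      let ?w = "\<lambda>h. (1 / h) *\<^sub>R integral {0..h} (\<lambda>t. exp (- 0 * t) *\<^sub>R S t x)"
      have "(?w \<longlongrightarrow> x) (at_right 0)" by (rule orbit_integral(3)[OF S x, of 1 0]) simp
      then have "\<forall>\<^sub>F h in at_right 0. 0 < h \<and> dist (?w h) x < d"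
        using d by (intro eventually_conj eventually_at_right_less tendstoD)
      then obtain h where h: "0 < h" "dist (?w h) x < d"
        using eventually_happens'[of "at_right (0::real)"] by auto
      from subspace_scale[OF sub orbit_integral(1)[OF S x h(1), of 0], of "1 / h"] h(2)
      show ?thesis
        by (intro bexI) (auto simp: dist_norm norm_minus_commute)
    qed
  qed
qed

end

section \<open>The perturbation series of Kato\<close>

text \<open>
  \<open>\<Gamma>\<close> is the graph of the operator \<open>A\<close>, and \<open>balance\<close> says that \<open>A + B\<close> neither creates nor destroys
  mass on the positive part of its domain.
\<close>

locale kato_perturbation = m_dissipative X pos e \<Gamma>
  for X pos :: "'b::banach set" and e :: "'b \<Rightarrow> real" and \<Gamma> :: "('b \<times> 'b) set" +
  fixes B :: "'b \<Rightarrow> 'b"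
  assumes B_X: "x \<in> Domain \<Gamma> \<Longrightarrow> B x \<in> X"
    and B_add: "x \<in> Domain \<Gamma> \<Longrightarrow> y \<in> Domain \<Gamma> \<Longrightarrow> B (x + y) = B x + B y"
    and B_scale: "x \<in> Domain \<Gamma> \<Longrightarrow> B (c *\<^sub>R x) = c *\<^sub>R B x"
    and B_pos: "x \<in> Domain \<Gamma> \<Longrightarrow> x \<in> pos \<Longrightarrow> B x \<in> pos"
    and balance: "(x, y) \<in> \<Gamma> \<Longrightarrow> x \<in> pos \<Longrightarrow> e (y + B x) = 0"
begin

lemma res_Domain: "0 < l \<Longrightarrow> z \<in> X \<Longrightarrow> res l z \<in> Domain \<Gamma>"
  using res_graph by blast

definition K :: "real \<Rightarrow> 'b \<Rightarrow> 'b" where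
  "K l z = B (res l z)"

text \<open>Conservation of mass: a positive \<open>z\<close> is split between \<open>l R(l, A) z\<close> and \<open>B R(l, A) z\<close>.\<close>

lemma norm_balance:
  assumes l: "0 < l" and z: "z \<in> pos"
  shows "l * norm (res l z) + norm (K l z) = norm z"
proof -
  note zX = pos_X[OF z]
  have p: "res l z \<in> pos" "K l z \<in> pos"
    unfolding K_def using res_pos[OF l z] B_pos[OF res_Domain[OF l zX]] by auto
  have "e (l *\<^sub>R res l z - z + K l z) = 0"
    unfolding K_def by (rule balance[OF res_graph[OF l zX] p(1)])
  then show ?thesis
    using p z by (simp add: e_add e_diff e_scale e_pos X_scale X_diff pos_X)
qed

lemma K_sub: assumes l: "0 < l" shows "substochastic (K l)"
proof -
  note r = lin_add[OF res_lin[OF l]] lin_scale[OF res_lin[OF l]] res_Domain[OF l]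
  have lin: "linear_on_X (K l)"
    unfolding linear_on_X_def K_def by (auto simp: r B_X B_add B_scale)
  have "norm (K l z) \<le> 1 * norm z" if "z \<in> X" for z
    by (rule norm_le_from_pos[OF lin _ that]) (use norm_balance[OF l] l in \<open>smt (verit) mult_nonneg_nonneg norm_ge_zero\<close>)
  moreover have "K l p \<in> pos" if "p \<in> pos" for p
    unfolding K_def using that by (intro B_pos res_Domain res_pos l pos_X)
  ultimately show ?thesis using lin by (auto simp: substochastic_def)
qed

lemmas Kn_sub = sub_funpow[OF K_sub]
lemmas Kn_X = sub_X[OF Kn_sub] and Kn_pos = sub_pos[OF Kn_sub]

lemma norm_balance_iterated:
  assumes l: "0 < l" and z: "z \<in> pos"
  shows "l * (\<Sum>n<N. norm (res l ((K l ^^ n) z))) = norm z - norm ((K l ^^ N) z)"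
proof (induction N)
  case (Suc N)
  then show ?case using norm_balance[OF l Kn_pos[OF l z, of N]] by (simp add: distrib_left)
qed simp

lemma summable_norm_series:
  assumes l: "0 < l" and z: "z \<in> X"
  shows "summable (\<lambda>n. norm (res l ((K l ^^ n) z)))"
proof -
  have pos: "summable (\<lambda>n. norm (res l ((K l ^^ n) p)))" if p: "p \<in> pos" for p
  proof (rule summableI_nonneg_bounded)
    show "(\<Sum>n<N. norm (res l ((K l ^^ n) p))) \<le> norm p / l" for N
    proof -
      have "l * (\<Sum>n<N. norm (res l ((K l ^^ n) p))) \<le> norm p"
        unfolding norm_balance_iterated[OF l p] by simp
      then show ?thesis using l by (simp add: field_simps)
    qed
  qed simp
  obtain p q where pq: "p \<in> pos" "q \<in> pos" "z = p - q" using decomp[OF z] by blast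
  show ?thesis
  proof (rule summable_comparison_test'[OF summable_add[OF pos[OF pq(1)] pos[OF pq(2)]]])
    fix n
    have "res l ((K l ^^ n) z) = res l ((K l ^^ n) p) - res l ((K l ^^ n) q)"
      by (simp add: pq sub_diff[OF Kn_sub[OF l]] lin_diff[OF res_lin[OF l]] Kn_X[OF l] pos_X)
    then show "norm (norm (res l ((K l ^^ n) z)))
        \<le> norm (res l ((K l ^^ n) p)) + norm (res l ((K l ^^ n) q))"
      by (simp add: norm_triangle_ineq4)
  qed
qed

text \<open>The resolvent of the generator of the minimal semigroup, as a series.\<close>

definition G :: "real \<Rightarrow> 'b \<Rightarrow> 'b" where
  "G l z = (\<Sum>n. res l ((K l ^^ n) z))"

lemma summable_series: "0 < l \<Longrightarrow> z \<in> X \<Longrightarrow> summable (\<lambda>n. res l ((K l ^^ n) z))"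
  by (rule summable_norm_cancel[OF summable_norm_series])

lemma G_limit: "0 < l \<Longrightarrow> z \<in> X \<Longrightarrow> (\<lambda>N. \<Sum>n<N. res l ((K l ^^ n) z)) \<longlonglongrightarrow> G l z"
  unfolding G_def by (intro summable_LIMSEQ summable_series)

lemma G_lin: assumes l: "0 < l" shows "linear_on_X (G l)"
  unfolding linear_on_X_def
proof (intro conjI ballI allI)
  note r = sub_add[OF Kn_sub[OF l]] sub_scale[OF Kn_sub[OF l]] lin_add[OF res_lin[OF l]]
    lin_scale[OF res_lin[OF l]] Kn_X[OF l] lin_X[OF res_lin[OF l]]
  fix x assume x: "x \<in> X"
  show "G l x \<in> X"
    by (rule Lim_in_closed_set[OF closed_X _ _ G_limit[OF l x]]) (auto intro!: always_eventually X_sum simp: r x)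
  show "G l (c *\<^sub>R x) = c *\<^sub>R G l x" for c
    unfolding G_def by (simp add: r x suminf_scaleR_right summable_series[OF l x])
  show "G l (x + y) = G l x + G l y" if "y \<in> X" for y
    unfolding G_def using that by (simp add: r x suminf_add summable_series[OF l])
qed

lemma G_pos:
  assumes l: "0 < l" and z: "z \<in> pos" shows "G l z \<in> pos"
  by (rule Lim_in_closed_set[OF closed_pos _ _ G_limit[OF l pos_X[OF z]]])
     (auto intro!: always_eventually pos_sum res_pos Kn_pos l z)

text \<open>
  The identity behind the stability criterion: the mass that is not returned by the iterates of
  \<open>B R(l, A)\<close> is exactly \<open>l\<close> times the mass of the resolvent.
\<close>

lemma norm_Kn_tendsto:
  assumes l: "0 < l" and z: "z \<in> pos"
  shows "(\<lambda>N. norm ((K l ^^ N) z)) \<longlonglongrightarrow> norm z - l * norm (G l z)"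
proof -
  have "(\<lambda>N. norm (\<Sum>n<N. res l ((K l ^^ n) z))) \<longlonglongrightarrow> norm (G l z)"
    by (intro tendsto_norm G_limit l pos_X z)
  moreover have "norm (\<Sum>n<N. res l ((K l ^^ n) z)) = (\<Sum>n<N. norm (res l ((K l ^^ n) z)))" for N
    by (intro norm_sum_pos res_pos Kn_pos l z)
  ultimately have "(\<lambda>N. norm z - l * (\<Sum>n<N. norm (res l ((K l ^^ n) z)))) \<longlonglongrightarrow> norm z - l * norm (G l z)"
    by (intro tendsto_intros) simp
  then show ?thesis by (simp add: norm_balance_iterated[OF l z])
qed

lemma G_norm:
  assumes l: "0 < l" and z: "z \<in> X" shows "l * norm (G l z) \<le> norm z"
proof -
  have "norm (G l p) \<le> (1 / l) * norm p" if "p \<in> pos" for p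
  proof -
    have "0 \<le> norm p - l * norm (G l p)"
      by (rule LIMSEQ_le_const[OF norm_Kn_tendsto[OF l that]]) simp
    then show ?thesis using l by (simp add: field_simps)
  qed
  from norm_le_from_pos[OF G_lin[OF l] this z] l show ?thesis by (simp add: field_simps)
qed

lemma G_continuous:
  assumes l: "0 < l" and f: "f \<longlonglongrightarrow> x" and X: "\<And>n. f n \<in> X" "x \<in> X"
  shows "(\<lambda>n. G l (f n)) \<longlonglongrightarrow> G l x"
proof (rule LIM_zero_cancel, rule Lim_null_comparison[OF always_eventually])
  show "\<forall>n. norm (G l (f n) - G l x) \<le> (1 / l) * norm (f n - x)"
    using G_norm[OF l X_diff[OF X]] l by (simp add: lin_diff[OF G_lin[OF l]] X field_simps)
  show "(\<lambda>n. (1 / l) * norm (f n - x)) \<longlonglongrightarrow> 0"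
    by (intro tendsto_mult_right_zero tendsto_norm_zero LIM_zero f)
qed

lemma G_Kn_tendsto_0:
  assumes l: "0 < l" and z: "z \<in> X" shows "(\<lambda>N. G l ((K l ^^ N) z)) \<longlonglongrightarrow> 0"
proof -
  have "G l ((K l ^^ N) z) = G l z - (\<Sum>n<N. res l ((K l ^^ n) z))" for N
    using suminf_minus_initial_segment[OF summable_series[OF l z], of N]
    by (simp add: G_def funpow_add)
  then show ?thesis using LIM_zero[OF G_limit[OF l z]] tendsto_minus[OF LIM_zero[OF G_limit[OF l z]]] by simp
qed

text \<open>Telescoping: \<open>(l - A - B)\<close> maps the \<open>N\<close>-th partial sum of \<open>G l z\<close> to \<open>z - (K l)\<^sup>N z\<close>.\<close>

lemma partial_sum_graph:
  assumes l: "0 < l" and z: "z \<in> X"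
  shows "\<exists>y. ((\<Sum>n<N. res l ((K l ^^ n) z)), y) \<in> \<Gamma> \<and>
    y + B (\<Sum>n<N. res l ((K l ^^ n) z)) = l *\<^sub>R (\<Sum>n<N. res l ((K l ^^ n) z)) - z + (K l ^^ N) z"
proof (induction N)
  case 0
  have "B 0 = 0" using B_scale[of 0 0] subspace_0[OF subspace_graph] by (auto simp: zero_prod_def)
  then show ?case using subspace_0[OF subspace_graph] by (auto simp: zero_prod_def)
next
  case (Suc N)
  define v where "v = (\<Sum>n<N. res l ((K l ^^ n) z))"
  define r where "r = res l ((K l ^^ N) z)"
  obtain y where y: "(v, y) \<in> \<Gamma>" "y + B v = l *\<^sub>R v - z + (K l ^^ N) z"
    using Suc unfolding v_def by blast
  have r: "(r, l *\<^sub>R r - (K l ^^ N) z) \<in> \<Gamma>" unfolding r_def by (intro res_graph l Kn_X z)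
  have "B (v + r) = B v + K l ((K l ^^ N) z)"
    using B_add[of v r] y(1) r unfolding K_def r_def[symmetric] by blast
  then have "(y + (l *\<^sub>R r - (K l ^^ N) z)) + B (v + r) = (y + B v) + l *\<^sub>R r - (K l ^^ N) z + (K l ^^ Suc N) z"
    by simp
  also have "\<dots> = l *\<^sub>R (v + r) - z + (K l ^^ Suc N) z" unfolding y(2) by (simp add: scaleR_add_right)
  finally show ?case
    using graph_add[OF y(1) r] by (auto simp flip: v_def r_def)
qed

text \<open>
  With \<open>w = (l - A) x\<close> one has \<open>K l w = B x\<close>, and \<open>G l w - G l (K l w)\<close> is the first term of the series
  for \<open>G l w\<close>.
\<close>

lemma G_left_inverse:
  assumes l: "0 < l" and xy: "(x, y) \<in> \<Gamma>" shows "G l (l *\<^sub>R x - (y + B x)) = x"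
proof -
  define w where "w = l *\<^sub>R x - y"
  have w: "w \<in> X" unfolding w_def using graph_X[OF xy] by (intro X_diff X_scale)
  have rw: "res l w = x" unfolding w_def by (rule res_inverse[OF l xy])
  have Kw: "K l w = B x" by (simp add: K_def rw)
  have "G l w = res l w + G l (K l w)"
    unfolding G_def using suminf_split_head[OF summable_series[OF l w]]
    by (simp add: funpow_swap1)
  moreover have "G l (w - K l w) = G l w - G l (K l w)"
    by (rule lin_diff[OF G_lin[OF l] w sub_X[OF K_sub[OF l] w]])
  moreover have "l *\<^sub>R x - (y + B x) = w - K l w" unfolding Kw by (simp add: w_def)
  ultimately show ?thesis by (simp only: rw) simp
qed

text \<open>
  On the cone the resolvent of \<open>A\<close>, the operator \<open>K\<close> and the whole series decrease in \<open>l\<close>. The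
  differences are arranged so that positive operators act on positive elements.
\<close>

lemma res_antimono:
  assumes m: "0 < m" "m \<le> l" and z: "z \<in> pos" shows "res m z - res l z \<in> pos"
proof -
  have l: "0 < l" using m by simp
  have "res m z - res l z = (l - m) *\<^sub>R res l (res m z)"
    using resolvent_identity[OF l m(1) pos_X[OF z]] by (simp add: algebra_simps)
  then show ?thesis using m l z by (simp add: pos_scale res_pos)
qed

lemma K_antimono:
  assumes m: "0 < m" "m \<le> l" and z: "z \<in> pos" shows "K m z - K l z \<in> pos"
proof -
  have l: "0 < l" using m by simp
  note D = res_Domain[OF m(1) pos_X[OF z]] res_Domain[OF l pos_X[OF z]]
  obtain a b where ab: "(res m z, a) \<in> \<Gamma>" "(res l z, b) \<in> \<Gamma>" using D by blast
  have d: "res m z - res l z \<in> Domain \<Gamma>" using graph_diff[OF ab] by blast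
  have "K m z = B (res m z - res l z) + K l z"
    unfolding K_def using B_add[OF d D(2)] by simp
  then show ?thesis using B_pos[OF d res_antimono[OF assms]] by simp
qed

lemma Kn_antimono:
  assumes m: "0 < m" "m \<le> l" and z: "z \<in> pos" shows "(K m ^^ n) z - (K l ^^ n) z \<in> pos"
proof (induction n)
  case (Suc n)
  have l: "0 < l" using m by simp
  note pX = Kn_X[OF m(1) pos_X[OF z], of n] Kn_X[OF l pos_X[OF z], of n]
  have "(K m ^^ Suc n) z - (K l ^^ Suc n) z =
      K m ((K m ^^ n) z - (K l ^^ n) z) + (K m ((K l ^^ n) z) - K l ((K l ^^ n) z))"
    by (simp add: sub_diff[OF K_sub[OF m(1)] pX])
  also have "\<dots> \<in> pos"
    by (intro pos_add sub_pos[OF K_sub] K_antimono Kn_pos Suc m l z)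
  finally show ?case .
qed (simp add: pos_0)

lemma G_antimono:
  assumes m: "0 < m" "m \<le> l" and z: "z \<in> pos" shows "G m z - G l z \<in> pos"
proof (rule Lim_in_closed_set[OF closed_pos])
  have l: "0 < l" using m by simp
  note zX = pos_X[OF z]
  show "(\<lambda>N. (\<Sum>n<N. res m ((K m ^^ n) z)) - (\<Sum>n<N. res l ((K l ^^ n) z))) \<longlonglongrightarrow> G m z - G l z"
    by (intro tendsto_diff G_limit m l zX)
  have "res m ((K m ^^ n) z) - res l ((K l ^^ n) z) \<in> pos" for n
  proof -
    have "res m ((K m ^^ n) z) - res l ((K l ^^ n) z) =
        res m ((K m ^^ n) z - (K l ^^ n) z) + (res m ((K l ^^ n) z) - res l ((K l ^^ n) z))"
      by (simp add: lin_diff[OF res_lin[OF m(1)]] Kn_X m l zX)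
    also have "\<dots> \<in> pos" by (intro pos_add res_pos Kn_antimono res_antimono Kn_pos m l z)
    finally show ?thesis .
  qed
  then show "\<forall>\<^sub>F N in sequentially.
      (\<Sum>n<N. res m ((K m ^^ n) z)) - (\<Sum>n<N. res l ((K l ^^ n) z)) \<in> pos"
    by (intro always_eventually allI) (simp add: pos_sum flip: sum_subtractf)
qed simp

text \<open>
  For \<open>l = m\<close> this is the tail of a convergent series; for larger \<open>l\<close> it follows because \<open>G l \<le> G m\<close> on
  the cone.
\<close>

lemma G_Kn_tendsto_0_le:
  assumes m: "0 < m" "m \<le> l" and z: "z \<in> X" shows "(\<lambda>N. G l ((K m ^^ N) z)) \<longlonglongrightarrow> 0"
proof -
  have l: "0 < l" using m by simp
  have pos: "(\<lambda>N. G l ((K m ^^ N) p)) \<longlonglongrightarrow> 0" if p: "p \<in> pos" for p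
  proof (rule Lim_null_comparison[OF always_eventually])
    show "\<forall>N. norm (G l ((K m ^^ N) p)) \<le> norm (G m ((K m ^^ N) p))"
      by (intro allI norm_mono_pos G_pos G_antimono Kn_pos m l p)
    show "(\<lambda>N. norm (G m ((K m ^^ N) p))) \<longlonglongrightarrow> 0"
      by (intro tendsto_norm_zero G_Kn_tendsto_0 m pos_X p)
  qed
  obtain p q where pq: "p \<in> pos" "q \<in> pos" "z = p - q" using decomp[OF z] by blast
  show ?thesis
    using tendsto_diff[OF pos[OF pq(1)] pos[OF pq(2)]]
    by (simp add: pq(3) sub_diff[OF Kn_sub[OF m(1)]] lin_diff[OF G_lin[OF l]] Kn_X m pos_X pq)
qed

text \<open>
  \<open>G l\<close> inverts \<open>l - A - B\<close> on the partial sums of \<open>G m z\<close>; the remainder \<open>G l ((K m)\<^sup>N z)\<close> vanishes in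
  the limit.
\<close>

lemma G_resolvent_identity:
  assumes m: "0 < m" "m \<le> l" and z: "z \<in> X"
  shows "G m z = G l (z + (l - m) *\<^sub>R G m z)"
proof -
  have l: "0 < l" using m by simp
  define v where "v N = (\<Sum>n<N. res m ((K m ^^ n) z))" for N
  have vX: "v N \<in> X" for N
    unfolding v_def by (intro X_sum lin_X[OF res_lin] Kn_X m z)
  note GX = lin_X[OF G_lin[OF m(1)] z] and KX = Kn_X[OF m(1) z]
  have v: "v N = G l ((z + (l - m) *\<^sub>R v N) - (K m ^^ N) z)" for N
  proof -
    obtain y where y: "(v N, y) \<in> \<Gamma>" "y + B (v N) = m *\<^sub>R v N - z + (K m ^^ N) z"
      using partial_sum_graph[OF m(1) z, of N] unfolding v_def by blast
    from G_left_inverse[OF l y(1)] show ?thesis unfolding y(2) by (simp add: algebra_simps)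
  qed
  have lim: "v \<longlonglongrightarrow> G m z" unfolding v_def[abs_def] by (rule G_limit[OF m(1) z])
  have "(\<lambda>N. G l (z + (l - m) *\<^sub>R v N) - G l ((K m ^^ N) z)) \<longlonglongrightarrow> G l (z + (l - m) *\<^sub>R G m z) - 0"
    by (intro tendsto_diff G_continuous G_Kn_tendsto_0_le tendsto_intros lim l m z X_add X_scale vX GX)
  moreover have "G l (z + (l - m) *\<^sub>R v N) - G l ((K m ^^ N) z) = v N" for N
    by (subst (2) v) (simp add: lin_diff[OF G_lin[OF l]] X_add X_scale vX z KX)
  ultimately have "v \<longlonglongrightarrow> G l (z + (l - m) *\<^sub>R G m z)" by simp
  with lim show ?thesis by (rule LIMSEQ_unique)
qed

text \<open>
  The graph of the operator whose resolvent at \<open>l\<close> is \<open>G l\<close>; it does not depend on \<open>l\<close>. The closure of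
  \<open>A + B\<close> may be strictly smaller, which is why the operator is defined through \<open>G\<close>.
\<close>

definition kato_graph :: "real \<Rightarrow> ('b \<times> 'b) set" where
  "kato_graph l = {(x, y). x \<in> X \<and> y \<in> X \<and> x = G l (l *\<^sub>R x - y)}"

lemma kato_graph_subset:
  assumes m: "0 < m" "m \<le> l" shows "kato_graph m \<subseteq> kato_graph l"
proof (rule subrelI)
  fix x y assume "(x, y) \<in> kato_graph m"
  then have xy: "x \<in> X" "y \<in> X" "G m (m *\<^sub>R x - y) = x" by (simp_all add: kato_graph_def)
  have "x = G l ((m *\<^sub>R x - y) + (l - m) *\<^sub>R x)"
    using G_resolvent_identity[OF m X_diff[OF X_scale[OF xy(1), of m] xy(2)]] xy(3) by simp
  then show "(x, y) \<in> kato_graph l" using xy by (simp add: kato_graph_def algebra_simps)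
qed

lemma subspace_kato_graph: assumes l: "0 < l" shows "subspace (kato_graph l)"
proof (rule subspaceI)
  note G = lin_add[OF G_lin[OF l]] lin_scale[OF G_lin[OF l]]
  show "0 \<in> kato_graph l" using lin_0[OF G_lin[OF l]] X_0 by (simp add: kato_graph_def zero_prod_def)
  fix p q assume p: "p \<in> kato_graph l"
  obtain x y where xy: "p = (x, y)" "x \<in> X" "y \<in> X" "x = G l (l *\<^sub>R x - y)"
    using p by (auto simp: kato_graph_def)
  show "c *\<^sub>R p \<in> kato_graph l" for c
    using G(2)[of "l *\<^sub>R x - y" c] xy
    by (simp add: kato_graph_def X_scale X_diff scaleR_diff_right mult.commute)
  assume "q \<in> kato_graph l"
  then obtain x' y' where xy': "q = (x', y')" "x' \<in> X" "y' \<in> X" "x' = G l (l *\<^sub>R x' - y')"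
    by (auto simp: kato_graph_def)
  have "l *\<^sub>R (x + x') - (y + y') = (l *\<^sub>R x - y) + (l *\<^sub>R x' - y')" by (simp add: algebra_simps)
  then have "G l (l *\<^sub>R (x + x') - (y + y')) = G l (l *\<^sub>R x - y) + G l (l *\<^sub>R x' - y')"
    using G(1)[of "l *\<^sub>R x - y" "l *\<^sub>R x' - y'"] xy xy' by (simp only: X_scale X_diff)
  with xy(4) xy'(4) have "x + x' = G l (l *\<^sub>R (x + x') - (y + y'))" by simp
  then show "p + q \<in> kato_graph l" using xy(1-3) xy'(1-3) by (simp add: kato_graph_def X_add)
qed

lemma G_kato_graph: assumes "0 < l" "z \<in> X" shows "(G l z, l *\<^sub>R G l z - z) \<in> kato_graph l"
  using assms lin_X[OF G_lin] by (simp add: kato_graph_def X_diff X_scale)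

text \<open>
  Write \<open>C\<^sub>l\<close> for the operator with graph \<open>kato_graph l\<close>. Then \<open>C\<^sub>l\<close> extends \<open>C\<^sub>m\<close>, while \<open>m - C\<^sub>m\<close> is
  surjective and \<open>m - C\<^sub>l\<close> is injective, so the extension cannot be proper.
\<close>

lemma kato_graph_eq:
  assumes m: "0 < m" "m \<le> l" shows "kato_graph m = kato_graph l"
proof (intro equalityI kato_graph_subset[OF m] subrelI)
  have l: "0 < l" using m by simp
  fix x y assume xy: "(x, y) \<in> kato_graph l"
  then have X: "x \<in> X" "y \<in> X" by (auto simp: kato_graph_def)
  define w where "w = m *\<^sub>R x - y"
  define d where "d = x - G m w"
  have w: "w \<in> X" unfolding w_def by (intro X_diff X_scale X)
  have Gw: "(G m w, m *\<^sub>R G m w - w) \<in> kato_graph m" by (rule G_kato_graph[OF m(1) w])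
  have "(x - G m w, y - (m *\<^sub>R G m w - w)) \<in> kato_graph l"
    using subspace_diff[OF subspace_kato_graph[OF l] xy] Gw kato_graph_subset[OF m] by fastforce
  moreover have "y - (m *\<^sub>R G m w - w) = m *\<^sub>R d" by (simp add: d_def w_def algebra_simps)
  ultimately have "(d, m *\<^sub>R d) \<in> kato_graph l" by (simp add: d_def)
  then have dX: "d \<in> X" and d: "d = G l ((l - m) *\<^sub>R d)" by (simp_all add: kato_graph_def scaleR_diff_left)
  have "l * norm d \<le> norm ((l - m) *\<^sub>R d)"
    using G_norm[OF l X_scale[OF dX, of "l - m"]] d by simp
  also have "\<dots> = (l - m) * norm d" using m by simp
  finally have "m * norm d \<le> 0" by (simp add: left_diff_distrib)
  then have "x = G m w" using m by (simp add: mult_le_0_iff d_def)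
  then show "(x, y) \<in> kato_graph m" using X by (simp add: kato_graph_def w_def)
qed

lemma kato_graph_1: "0 < l \<Longrightarrow> kato_graph l = kato_graph 1"
  using kato_graph_eq[of l 1] kato_graph_eq[of 1 l] by (cases "l \<le> 1") auto

lemma graph_in_kato_graph: "(x, y) \<in> \<Gamma> \<Longrightarrow> (x, y + B x) \<in> kato_graph 1"
  using G_left_inverse[of 1 x y] graph_X[of x y] B_X[of x]
  by (auto simp: kato_graph_def X_add DomainI)

theorem m_dissipative_kato_graph: "m_dissipative X pos e (kato_graph 1)"
proof unfold_locales
  show "subspace (kato_graph 1)" by (rule subspace_kato_graph) simp
  show "kato_graph 1 \<subseteq> X \<times> X" by (auto simp: kato_graph_def)
  fix l :: real assume l: "0 < l"
  note C = kato_graph_1[OF l, symmetric]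
  show "l * norm x \<le> norm (l *\<^sub>R x - y)" if "(x, y) \<in> kato_graph 1" for x y
    using that G_norm[OF l, of "l *\<^sub>R x - y"] unfolding C by (simp add: kato_graph_def X_diff X_scale)
  show "\<exists>x. (x, l *\<^sub>R x - z) \<in> kato_graph 1" if "z \<in> X" for z
    using G_kato_graph[OF l that] unfolding C by blast
  show "x \<in> pos" if "(x, l *\<^sub>R x - z) \<in> kato_graph 1" "z \<in> pos" for x z
    using that G_pos[OF l that(2)] unfolding C by (simp add: kato_graph_def)
next
  fix x d assume "x \<in> X" "0 < (d::real)"
  from dense[OF this] graph_in_kato_graph show "\<exists>(y, z)\<in>kato_graph 1. norm (x - y) < d" by blast
qed

theorem kato_voigt_semigroup:
  "\<exists>Q. semigroup Q \<and> (\<forall>(x, y)\<in>\<Gamma>. (x, y + B x) \<in> gen Q) \<and>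
       (\<forall>l>0. \<forall>z\<in>X. (G l z, l *\<^sub>R G l z - z) \<in> gen Q)"
proof -
  interpret C: m_dissipative X pos e "kato_graph 1" by (rule m_dissipative_kato_graph)
  show ?thesis
    using C.hille_yosida C.graph_subset_gen_Q graph_in_kato_graph G_kato_graph kato_graph_1
    by (intro exI[of _ C.Q]) blast
qed

end

section \<open>Decay of mass along orbits\<close>

context AL_space
begin

lemma norm_orbit_antimono:
  assumes S: "semigroup S" and st: "0 \<le> s" "s \<le> t" and x: "x \<in> X"
  shows "norm (S t x) \<le> norm (S s x)"
proof -
  have "S t x = S (t - s) (S s x)" using semi_add[OF S, of "t - s" s x] st x by simp
  then show ?thesis
    using sub_norm[OF semi_sub[OF S, of "t - s"] sub_X[OF semi_sub[OF S st(1)] x]] st by simp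
qed

text \<open>
  A single \<open>h\<close> serves all times, because \<open>S t\<close> does not increase the error of the difference quotient
  at time 0.
\<close>

lemma gen_quotient_along_orbit:
  assumes S: "semigroup S" and xy: "(x, y) \<in> gen S" and d: "0 < d" and b: "0 < b"
  shows "\<exists>h>0. h < b \<and> (\<forall>t\<ge>0. \<bar>(e (S (t + h) x) - e (S t x)) / h - e (S t y)\<bar> \<le> d)"
proof -
  have X: "x \<in> X" "y \<in> X" using xy by (auto simp: gen_def)
  have "((\<lambda>h. (1 / h) *\<^sub>R (S h x - x)) \<longlongrightarrow> y) (at_right 0)" using xy by (simp add: gen_def)
  then have "\<forall>\<^sub>F h in at_right 0. 0 < h \<and> h < b \<and> dist ((1 / h) *\<^sub>R (S h x - x)) y < d"
    using b d by (intro eventually_conj eventually_at_right_less tendstoD eventually_at_rightI[of 0 b]) auto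
  then obtain h where h: "0 < h" "h < b" "dist ((1 / h) *\<^sub>R (S h x - x)) y < d"
    using eventually_happens'[of "at_right (0::real)"] by auto
  have "\<bar>(e (S (t + h) x) - e (S t x)) / h - e (S t y)\<bar> \<le> d" if t: "0 \<le> t" for t
  proof -
    note St = semi_sub[OF S t]
    have hX: "S h x \<in> X" using sub_X[OF semi_sub[OF S, of h]] h X by simp
    define w where "w = (1 / h) *\<^sub>R (S h x - x) - y"
    have wX: "w \<in> X" unfolding w_def by (intro X_diff X_scale hX X)
    have "S t w = (1 / h) *\<^sub>R (S (t + h) x - S t x) - S t y"
      unfolding w_def using semi_add[OF S t _ X(1), of h] h
      by (simp add: sub_diff[OF St] sub_scale[OF St] X_diff X_scale hX X)
    moreover have "S (t + h) x \<in> X" using sub_X[OF semi_sub[OF S, of "t + h"]] t h X by simp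
    ultimately have "e (S t w) = (e (S (t + h) x) - e (S t x)) / h - e (S t y)"
      by (simp add: e_diff e_scale X_diff X_scale sub_X[OF St] X)
    moreover have "\<bar>e (S t w)\<bar> \<le> norm w"
      using abs_e_le[OF sub_X[OF St wX]] sub_norm[OF St wX] by simp
    ultimately show ?thesis using h(3) by (simp add: dist_norm w_def)
  qed
  with h show ?thesis by blast
qed

text \<open>
  The mass of \<open>S t g\<close> decreases to a limit, so its derivative, which is \<open>l\<close> times the mass of \<open>S t g\<close>
  minus the mass of \<open>S t x\<close>, is close to 0 at late times.
\<close>

lemma orbit_eventually_small:
  assumes S: "semigroup S" and g: "(g, l *\<^sub>R g - x) \<in> gen S" "g \<in> pos" and x: "x \<in> pos"
    and l: "0 < l" and d: "0 < d"
  shows "\<exists>t\<ge>0. norm (S t x) \<le> l * norm g + d"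
proof -
  obtain h where h: "0 < h" and q: "\<And>t. 0 \<le> t \<Longrightarrow>
      \<bar>(e (S (t + h) g) - e (S t g)) / h - e (S t (l *\<^sub>R g - x))\<bar> \<le> d / 2"
    using gen_quotient_along_orbit[OF S g(1), of "d / 2" 1] d by auto
  define a where "a n = norm (S (real n * h) g)" for n
  have dec: "decseq a"
    unfolding decseq_Suc_iff a_def using h
    by (intro allI norm_orbit_antimono[OF S] pos_X g(2)) (auto simp: algebra_simps)
  have "0 \<le> a n" for n by (simp add: a_def)
  with dec obtain L where L: "a \<longlonglongrightarrow> L" using decseq_convergent by blast
  have "(\<lambda>n. a n - a (Suc n)) \<longlonglongrightarrow> L - L" by (intro tendsto_diff L LIMSEQ_Suc)
  then have "\<forall>\<^sub>F n in sequentially. a n - a (Suc n) < h * d / 2"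
    using h d by (intro order_tendstoD(2)) auto
  then obtain n where n: "a n - a (Suc n) < h * d / 2"
    using eventually_happens'[OF sequentially_bot] by blast
  define t where "t = real n * h"
  have t: "0 \<le> t" using h by (simp add: t_def)
  note St = semi_sub[OF S t]
  have th: "t + h = real (Suc n) * h" by (simp add: t_def distrib_right)
  have "0 \<le> t + h" using t h by simp
  from e_pos[OF sub_pos[OF semi_sub[OF S this] g(2)]] e_pos[OF sub_pos[OF St g(2)]]
  have an: "e (S t g) = a n" "e (S (t + h) g) = a (Suc n)"
    unfolding a_def th by (simp_all add: t_def)
  have "e (S t (l *\<^sub>R g - x)) = l * a n - norm (S t x)"
    using sub_pos[OF St x] g(2) x
    by (simp add: sub_diff[OF St] sub_scale[OF St] e_diff e_scale X_scale pos_X sub_X[OF St] an e_pos)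
  moreover have "(a n - a (Suc n)) / h < d / 2" using n h by (simp add: field_simps)
  ultimately have "norm (S t x) \<le> l * a n + d"
    using q[OF t] unfolding an diff_divide_distrib by linarith
  moreover have "a n \<le> norm g"
    unfolding a_def using sub_norm[OF St pos_X[OF g(2)]] by (simp add: t_def)
  then have "l * a n \<le> l * norm g" using l by (intro mult_left_mono) auto
  ultimately show ?thesis using t by (intro exI[of _ t]) simp
qed

text \<open>
  The function \<open>p t = norm (S t v)\<close> satisfies \<open>p' \<ge> l p - norm (S t u)\<close>, and it is bounded. A bounded
  solution with a source that is at most \<open>norm u\<close> up to time \<open>T\<close> and at most \<open>c\<close> afterwards stays below
  \<open>(T + 1) norm u + c / l\<close>. The positive defect \<open>k\<close>
  admits the partial sums of \<open>G l u\<close> for \<open>v\<close>.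
\<close>

lemma resolvent_mass_bound:
  assumes S: "semigroup S" and v: "(v, l *\<^sub>R v - u + k) \<in> gen S" "v \<in> pos"
    and u: "u \<in> pos" and k: "k \<in> pos" and l: "0 < l" and T: "0 \<le> T"
    and small: "\<And>t. T \<le> t \<Longrightarrow> norm (S t u) \<le> c"
  shows "l * norm v \<le> l * (T + 1) * norm u + c"
proof (rule field_le_epsilon)
  fix d :: real assume d: "0 < d"
  have c: "0 \<le> c" using small[of T] norm_ge_zero order_trans by blast
  obtain h where h: "0 < h" "h < 1" and q: "\<And>t. 0 \<le> t \<Longrightarrow>
      \<bar>(e (S (t + h) v) - e (S t v)) / h - e (S t (l *\<^sub>R v - u + k))\<bar> \<le> d"
    using gen_quotient_along_orbit[OF S v(1) d, of 1] by auto
  \<comment> \<open>The barrier \<open>a\<close> falls at rate \<open>norm u\<close>, which pays for the source before time \<open>T\<close>. It reaches 0 at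
    \<open>T + 1\<close> and not at \<open>T\<close>, so that it still falls at this rate on all of \<open>[t, t + h]\<close> if \<open>t < T\<close>, \<open>h < 1\<close>.\<close>
  define a where "a t = norm u * max 0 (T + 1 - t)" for t
  define r where "r t = norm (S t v) - a t" for t
  have a0: "0 \<le> a t" for t by (simp add: a_def)
  have step: "r t * (1 + l * h) \<le> r (t + h) + h * (c + d)" if t: "0 \<le> t" for t
  proof -
    note St = semi_sub[OF S t]
    have "0 \<le> t + h" using t h by simp
    note Sth = semi_sub[OF S this]
    note p = sub_pos[OF St v(2)] sub_pos[OF St u] sub_pos[OF St k] sub_pos[OF Sth v(2)]
    have "e (S t (l *\<^sub>R v - u + k)) = l * norm (S t v) - norm (S t u) + norm (S t k)"
      using p by (simp add: sub_diff[OF St] sub_add[OF St] sub_scale[OF St] e_diff e_add e_scale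
          X_scale X_diff pos_X v u k e_pos)
    then have "l * norm (S t v) - norm (S t u) - d \<le> (norm (S (t + h) v) - norm (S t v)) / h"
      using q[OF t] p by (simp add: e_pos abs_le_iff) (smt (verit) norm_ge_zero)
    then have 1: "norm (S t v) + h * (l * norm (S t v)) \<le> norm (S (t + h) v) + h * norm (S t u) + h * d"
      using h by (simp add: field_simps)
    have 2: "h * norm (S t u) \<le> h * c + a t - a (t + h)"
    proof (cases "T \<le> t")
      case True
      have "a (t + h) \<le> a t" unfolding a_def using h by (intro mult_left_mono) auto
      moreover have "h * norm (S t u) \<le> h * c" using small[OF True] h by simp
      ultimately show ?thesis by linarith
    next
      case False
      then have "a t - a (t + h) = h * norm u" using h by (simp add: a_def algebra_simps max_def)
      moreover have "h * norm (S t u) \<le> h * norm u"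
        using sub_norm[OF St pos_X[OF u]] h by simp
      moreover have "0 \<le> h * c" using h c by simp
      ultimately show ?thesis by linarith
    qed
    have "r t * (1 + l * h) = norm (S t v) + h * (l * norm (S t v)) - a t - l * h * a t"
      by (simp add: r_def algebra_simps)
    also have "\<dots> \<le> norm (S (t + h) v) + h * norm (S t u) + h * d - a t"
      using 1 mult_nonneg_nonneg[OF _ a0[of t], of "l * h"] l h by simp
    also have "\<dots> \<le> r (t + h) + h * (c + d)" using 2 by (simp add: r_def algebra_simps)
    finally show ?thesis .
  qed
  define s where "s = (SUP t\<in>{0..}. r t)"
  have bdd: "bdd_above (r ` {0..})"
  proof (rule bdd_aboveI2)
    fix t :: real assume "t \<in> {0..}"
    then show "r t \<le> norm v"
      using sub_norm[OF semi_sub[OF S] pos_X[OF v(2)], of t] a0[of t] by (simp add: r_def)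
  qed
  have lh: "0 < 1 + l * h" using l h by (simp add: add_pos_pos)
  \<comment> \<open>One time step improves the supremum of \<open>r\<close> by a factor, up to the source term.\<close>
  have "s \<le> (s + h * (c + d)) / (1 + l * h)"
    unfolding s_def
  proof (rule cSUP_least)
    fix t :: real assume "t \<in> {0..}"
    then have t: "0 \<le> t" by simp
    have "r (t + h) \<le> s" unfolding s_def by (rule cSUP_upper[OF _ bdd]) (use t h in simp)
    with step[OF t] show "r t \<le> ((SUP t\<in>{0..}. r t) + h * (c + d)) / (1 + l * h)"
      using lh by (simp add: s_def pos_le_divide_eq)
  qed simp
  then have "h * (l * s) \<le> h * (c + d)" using lh by (simp add: pos_le_divide_eq algebra_simps)
  then have "l * s \<le> c + d" using h by simp
  moreover have "r 0 \<le> s" unfolding s_def by (rule cSUP_upper[OF _ bdd]) simp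
  then have "l * r 0 \<le> l * s" using l by simp
  moreover have "r 0 = norm v - norm u * (T + 1)"
    using semi_0[OF S pos_X[OF v(2)]] T by (simp add: r_def a_def)
  ultimately show "l * norm v \<le> l * (T + 1) * norm u + c + d" by (simp add: algebra_simps)
qed

end

text \<open>
  The partial sums of \<open>G l z\<close> lie in the domain of \<open>A\<close>, where the generator of \<open>P\<close> is known; the
  iterate \<open>(K l)\<^sup>N z\<close> is the positive defect.
\<close>

lemma (in kato_perturbation) mass_loss_bound:
  assumes P: "semigroup P" "\<And>x y. (x, y) \<in> \<Gamma> \<Longrightarrow> (x, y + B x) \<in> gen P"
    and l: "0 < l" and z: "z \<in> pos" and T: "0 \<le> T" "\<And>t. T \<le> t \<Longrightarrow> norm (P t z) \<le> c"
  shows "norm z - norm ((K l ^^ N) z) \<le> l * (T + 1) * norm z + c"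
proof -
  let ?v = "\<Sum>n<N. res l ((K l ^^ n) z)"
  have rp: "res l ((K l ^^ n) z) \<in> pos" for n by (intro res_pos Kn_pos l z)
  obtain y where y: "(?v, y) \<in> \<Gamma>" "y + B ?v = l *\<^sub>R ?v - z + (K l ^^ N) z"
    using partial_sum_graph[OF l pos_X[OF z]] by blast
  have "l * norm ?v \<le> l * (T + 1) * norm z + c"
    by (rule resolvent_mass_bound[OF P(1) _ _ z Kn_pos[OF l z] l T])
       (use P(2)[OF y(1)] in \<open>auto simp: y(2) intro: pos_sum rp\<close>)
  then show ?thesis
    using norm_balance_iterated[OF l z, of N] by (simp add: norm_sum_pos rp)
qed

section \<open>Functionals on \<open>L\<^sup>1\<close> and completeness\<close>

lemma L1I: "integrable M u \<Longrightarrow> u \<in> L1 M" and L1D: "u \<in> L1 M \<Longrightarrow> integrable M u"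
  by (auto simp: L1_def)

lemma L1_add: "u \<in> L1 M \<Longrightarrow> v \<in> L1 M \<Longrightarrow> (\<lambda>x. u x + v x) \<in> L1 M"
  and L1_diff: "u \<in> L1 M \<Longrightarrow> v \<in> L1 M \<Longrightarrow> (\<lambda>x. u x - v x) \<in> L1 M"
  and L1_scale: "u \<in> L1 M \<Longrightarrow> (\<lambda>x. c * u x) \<in> L1 M"
  by (auto simp: L1_def)

lemma integrable_mult_Linf:
  assumes u: "u \<in> L1 M" and g: "g \<in> Linf M"
  shows "integrable M (\<lambda>x. u x * g x)"
proof -
  note [measurable] = borel_measurable_integrable[OF L1D[OF u]]
  obtain c where c: "AE x in M. \<bar>g x\<bar> \<le> c" and [measurable]: "g \<in> borel_measurable M"
    using g by (auto simp: Linf_def)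
  show ?thesis
  proof (rule Bochner_Integration.integrable_bound[of _ "\<lambda>x. \<bar>c\<bar> * u x"])
    show "integrable M (\<lambda>x. \<bar>c\<bar> * u x)" using u by (auto simp: L1_def)
    show "AE x in M. norm (u x * g x) \<le> norm (\<bar>c\<bar> * u x)"
      using c
    proof eventually_elim
      case (elim x)
      have "\<bar>u x\<bar> * \<bar>g x\<bar> \<le> \<bar>u x\<bar> * \<bar>c\<bar>" using elim by (intro mult_left_mono) auto
      then show ?case by (simp add: abs_mult mult.commute)
    qed
  qed measurable
qed

lemma abs_integral_mult_le:
  assumes u: "u \<in> L1 M" and g: "g \<in> Linf M" and c: "AE x in M. \<bar>g x\<bar> \<le> c"
  shows "\<bar>LINT x|M. u x * g x\<bar> \<le> c * L1_norm M u"
proof -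
  have "\<bar>LINT x|M. u x * g x\<bar> \<le> (LINT x|M. \<bar>u x * g x\<bar>)"
    using integral_norm_bound[of M "\<lambda>x. u x * g x"] by simp
  also have "\<dots> \<le> (LINT x|M. c * \<bar>u x\<bar>)"
  proof (rule integral_mono_AE)
    show "integrable M (\<lambda>x. \<bar>u x * g x\<bar>)" using integrable_mult_Linf[OF u g] by simp
    show "integrable M (\<lambda>x. c * \<bar>u x\<bar>)" using L1D[OF u] by simp
    show "AE x in M. \<bar>u x * g x\<bar> \<le> c * \<bar>u x\<bar>"
      using c by eventually_elim (simp add: abs_mult mult.commute mult_right_mono)
  qed
  finally show ?thesis by (simp add: L1_norm_def)
qed

lemma L1_norm_0_iff: "u \<in> L1 M \<Longrightarrow> L1_norm M u = 0 \<longleftrightarrow> (AE x in M. u x = 0)"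
  unfolding L1_norm_def by (subst integral_nonneg_eq_0_iff_AE) (auto dest: L1D)

context sigma_finite_measure
begin

text \<open>
  The weight \<open>w\<close> makes both functions integrable, so that the set on which the inequality fails can be
  tested even if its measure is infinite.
\<close>

lemma AE_le_if_weighted_integrals_le:
  fixes w a b :: "'a \<Rightarrow> real"
  assumes [measurable]: "w \<in> borel_measurable M" and w: "\<And>x. 0 < w x"
    and [measurable]: "a \<in> borel_measurable M" "b \<in> borel_measurable M"
    and int: "integrable M (\<lambda>x. w x * a x)" "integrable M (\<lambda>x. w x * b x)"
    and le: "\<And>A. A \<in> sets M \<Longrightarrow>
      (LINT x|M. w x * indicator A x * a x) \<le> (LINT x|M. w x * indicator A x * b x)"
  shows "AE x in M. a x \<le> b x"
proof -
  define A where "A = {x \<in> space M. b x < a x}"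
  have [measurable]: "A \<in> sets M" unfolding A_def by measurable
  define d where "d x = w x * indicator A x * a x - w x * indicator A x * b x" for x
  have i: "integrable M (\<lambda>x. w x * indicator A x * a x)" "integrable M (\<lambda>x. w x * indicator A x * b x)"
    using int[THEN integrable_mult_indicator[OF \<open>A \<in> sets M\<close>]] by (simp_all add: mult_ac)
  have nn: "0 \<le> d x" for x
    using w[of x] by (auto simp: d_def A_def indicator_def)
  have id: "integrable M d" unfolding d_def using i by simp
  have "integral\<^sup>L M d = 0"
  proof (rule antisym)
    show "integral\<^sup>L M d \<le> 0" unfolding d_def using le[of A] i by simp
    show "0 \<le> integral\<^sup>L M d" using nn by simp
  qed
  then have "AE x in M. d x = 0" using integral_nonneg_eq_0_iff_AE[OF id] nn by simp
  then show ?thesis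
    using AE_space
  proof eventually_elim
    case (elim x)
    then show ?case using w[of x] by (auto simp: d_def A_def indicator_def split: if_splits)
  qed
qed

lemma AE_le_if_integrals_le:
  assumes a: "a \<in> Linf M" and b: "b \<in> Linf M"
    and le: "\<And>u. u \<in> L1 M \<Longrightarrow> (\<And>x. 0 \<le> u x) \<Longrightarrow> (LINT x|M. u x * a x) \<le> (LINT x|M. u x * b x)"
  shows "AE x in M. a x \<le> b x"
proof -
  obtain w :: "'a \<Rightarrow> real" where w: "w \<in> borel_measurable M" "\<And>x. 0 < w x" "integrable M w"
    using obtain_positive_integrable_function by metis
  show ?thesis
  proof (rule AE_le_if_weighted_integrals_le[OF w(1,2)])
    show "a \<in> borel_measurable M" "b \<in> borel_measurable M" using a b by (auto simp: Linf_def)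
    show "integrable M (\<lambda>x. w x * a x)" "integrable M (\<lambda>x. w x * b x)"
      by (rule integrable_mult_Linf[OF L1I[OF w(3)]], rule a b)+
    fix A assume "A \<in> sets M"
    then have "(\<lambda>x. w x * indicator A x) \<in> L1 M"
      using integrable_mult_indicator[OF _ w(3), of A] by (simp add: L1_def mult.commute)
    then show "(LINT x|M. w x * indicator A x * a x) \<le> (LINT x|M. w x * indicator A x * b x)"
      by (rule le) (use w(2) in \<open>auto simp: indicator_def intro: less_imp_le\<close>)
  qed
qed

text \<open>
  The functions \<open>w * indicator A\<close> span a dense subspace: this is the approximation by step functions in
  \<open>L\<^sup>1\<close> of the measure with density \<open>w\<close>.
\<close>

lemma functional_eq_0:
  fixes \<Psi> :: "('a \<Rightarrow> real) \<Rightarrow> real"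
  assumes add: "\<And>u v. u \<in> L1 M \<Longrightarrow> v \<in> L1 M \<Longrightarrow> \<Psi> (\<lambda>x. u x + v x) = \<Psi> u + \<Psi> v"
    and scale: "\<And>k u. u \<in> L1 M \<Longrightarrow> \<Psi> (\<lambda>x. k * u x) = k * \<Psi> u"
    and bound: "\<And>u. u \<in> L1 M \<Longrightarrow> \<bar>\<Psi> u\<bar> \<le> c * L1_norm M u"
    and [measurable]: "w \<in> borel_measurable M" and w: "\<And>x. 0 < w x" "integrable M w"
    and 0: "\<And>A. A \<in> sets M \<Longrightarrow> \<Psi> (\<lambda>x. w x * indicator A x) = 0"
    and u: "u \<in> L1 M"
  shows "\<Psi> u = 0"
proof -
  let ?N = "density M (\<lambda>x. ennreal (w x))"
  have w0: "AE x in M. 0 \<le> w x" using w(1) by (auto intro: less_imp_le)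
  have iN: "integrable ?N f \<longleftrightarrow> integrable M (\<lambda>x. w x * f x)" if "f \<in> borel_measurable M" for f :: "'a \<Rightarrow> real"
    using integrable_density[OF that _ w0] by simp
  have "integrable ?N f \<Longrightarrow> \<Psi> (\<lambda>x. w x * f x) = 0" for f :: "'a \<Rightarrow> real"
  proof (induction rule: integrable_induct)
    case (base A k)
    then have A: "A \<in> sets M" by simp
    have L: "(\<lambda>x. w x * indicator A x) \<in> L1 M"
      using integrable_mult_indicator[OF A w(2)] by (simp add: L1_def mult.commute)
    show ?case using scale[OF L, of k] 0[OF A] by (simp add: mult_ac)
  next
    case (add f g)
    then have fg: "f \<in> borel_measurable M" "g \<in> borel_measurable M"
      using borel_measurable_integrable by fastforce+
    show ?case
      using assms(1)[of "\<lambda>x. w x * f x" "\<lambda>x. w x * g x"] add.hyps add.IH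
      by (simp add: iN fg L1_def distrib_left)
  next
    case (lim f s)
    have [measurable]: "f \<in> borel_measurable M" "\<And>i. s i \<in> borel_measurable M"
      using borel_measurable_integrable[OF lim.hyps(4)] borel_measurable_integrable[OF lim.hyps(1)] by simp_all
    have L: "(\<lambda>x. w x * f x) \<in> L1 M" "\<And>i. (\<lambda>x. w x * s i x) \<in> L1 M"
      using lim.hyps(1,4) by (simp_all add: iN L1_def)
    have "(\<lambda>i. LINT x|M. \<bar>w x * f x - w x * s i x\<bar>) \<longlonglongrightarrow> (LINT x|M. 0)"
    proof (rule integral_dominated_convergence[where w = "\<lambda>x. 3 * \<bar>w x * f x\<bar>"])
      show "integrable M (\<lambda>x. 3 * \<bar>w x * f x\<bar>)" using L1D[OF L(1)] by simp
      show "AE x in M. (\<lambda>i. \<bar>w x * f x - w x * s i x\<bar>) \<longlonglongrightarrow> 0"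
      proof (rule AE_I2)
        fix x assume "x \<in> space M"
        then have "(\<lambda>i. s i x) \<longlonglongrightarrow> f x" using lim.hyps(2) by simp
        then have "(\<lambda>i. \<bar>w x * f x - w x * s i x\<bar>) \<longlonglongrightarrow> \<bar>w x * f x - w x * f x\<bar>"
          by (intro tendsto_intros)
        then show "(\<lambda>i. \<bar>w x * f x - w x * s i x\<bar>) \<longlonglongrightarrow> 0" by simp
      qed
      show "AE x in M. norm \<bar>w x * f x - w x * s i x\<bar> \<le> 3 * \<bar>w x * f x\<bar>" for i
      proof (rule AE_I2)
        fix x assume "x \<in> space M"
        then have "\<bar>s i x\<bar> \<le> 2 * \<bar>f x\<bar>" using lim.hyps(3) by simp
        then have "w x * \<bar>f x - s i x\<bar> \<le> w x * (3 * \<bar>f x\<bar>)"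
          using w(1)[of x] by (intro mult_left_mono) auto
        then show "norm \<bar>w x * f x - w x * s i x\<bar> \<le> 3 * \<bar>w x * f x\<bar>"
          using w(1)[of x] by (simp add: abs_mult flip: right_diff_distrib)
      qed
    qed measurable
    then have to_0: "(\<lambda>i. c * L1_norm M (\<lambda>x. w x * f x - w x * s i x)) \<longlonglongrightarrow> c * 0"
      unfolding L1_norm_def by (intro tendsto_mult tendsto_const) simp
    have "\<bar>\<Psi> (\<lambda>x. w x * f x)\<bar> \<le> c * L1_norm M (\<lambda>x. w x * f x - w x * s i x)" for i
    proof -
      have d: "(\<lambda>x. w x * f x - w x * s i x) \<in> L1 M" by (intro L1_diff L)
      have "\<Psi> (\<lambda>x. w x * f x) = \<Psi> (\<lambda>x. w x * f x - w x * s i x)"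
        using assms(1)[OF d L(2)[of i]] lim.IH[of i] by simp
      then show ?thesis using bound[OF d] by simp
    qed
    then have "\<bar>\<Psi> (\<lambda>x. w x * f x)\<bar> \<le> c * 0" by (intro LIMSEQ_le_const[OF to_0]) auto
    then show ?case by simp
  qed
  moreover have "integrable ?N (\<lambda>x. u x / w x)"
    using w(1) L1D[OF u] by (subst iN) (auto simp: less_imp_neq[symmetric] dest: borel_measurable_integrable)
  ultimately have "\<Psi> (\<lambda>x. w x * (u x / w x)) = 0" by blast
  then show ?thesis using w(1) by (simp add: less_imp_neq[symmetric])
qed

text \<open>
  The density is a Radon-Nikodym derivative: \<open>A \<mapsto> \<Phi> (w * indicator A)\<close> is a finite measure that is
  absolutely continuous, and dividing its derivative by \<open>w\<close> gives \<open>h\<close>. This provides the adjoints of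
  bounded positive operators.
\<close>

lemma positive_functional_density:
  fixes \<Phi> :: "('a \<Rightarrow> real) \<Rightarrow> real"
  assumes add: "\<And>u v. u \<in> L1 M \<Longrightarrow> v \<in> L1 M \<Longrightarrow> \<Phi> (\<lambda>x. u x + v x) = \<Phi> u + \<Phi> v"
    and scale: "\<And>k u. u \<in> L1 M \<Longrightarrow> \<Phi> (\<lambda>x. k * u x) = k * \<Phi> u"
    and bound: "\<And>u. u \<in> L1 M \<Longrightarrow> \<bar>\<Phi> u\<bar> \<le> c * L1_norm M u"
    and pos: "\<And>u. u \<in> L1 M \<Longrightarrow> (\<And>x. 0 \<le> u x) \<Longrightarrow> 0 \<le> \<Phi> u"
  shows "\<exists>h\<in>Linf M. \<forall>u\<in>L1 M. \<Phi> u = (LINT x|M. u x * h x)"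
proof -
  obtain w :: "'a \<Rightarrow> real" where w': "w \<in> borel_measurable M" and w: "\<And>x. 0 < w x" "integrable M w"
    using obtain_positive_integrable_function by metis
  note w' [measurable]
  define wi where "wi A x = w x * indicator A x" for A x
  have wiL: "wi A \<in> L1 M" if "A \<in> sets M" for A
    unfolding wi_def[abs_def] using integrable_mult_indicator[OF that w(2)] by (simp add: L1_def mult.commute)
  have wi_nn: "0 \<le> wi A x" for A x using w(1)[of x] by (simp add: wi_def indicator_def)
  have \<Phi>_nn: "0 \<le> \<Phi> (wi A)" if "A \<in> sets M" for A by (intro pos wiL that wi_nn)
  have L1n: "L1_norm M (wi A) = (LINT x|M. wi A x)" for A
    unfolding L1_norm_def using wi_nn[of A] by (simp add: abs_of_nonneg)
  have sums: "(\<lambda>i. \<Phi> (wi (F i))) sums \<Phi> (wi (\<Union>i. F i))"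
    if F: "range F \<subseteq> sets M" "disjoint_family F" for F :: "nat \<Rightarrow> 'a set"
  proof -
    have FM: "F i \<in> sets M" for i using F(1) by auto
    have UM: "(\<Union>i<n. F i) \<in> sets M" "(\<Union>i. F i) - (\<Union>i<n. F i) \<in> sets M" "(\<Union>i. F i) \<in> sets M" for n
      using FM by auto
    have fin: "\<Phi> (wi (\<Union>i<n. F i)) = (\<Sum>i<n. \<Phi> (wi (F i)))" for n
    proof (induction n)
      case 0
      have "wi {} = (\<lambda>x. 0 * wi {} x)" by (simp add: fun_eq_iff wi_def)
      then have "\<Phi> (wi {}) = 0 * \<Phi> (wi {})" using scale[OF wiL[of "{}"], of 0] by simp
      then show ?case by simp
    next
      case (Suc n)
      have "F i \<inter> F n = {}" if "i < n" for i using F(2) that by (simp add: disjoint_family_on_def)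
      then have "(\<Union>i<n. F i) \<inter> F n = {}" by blast
      then have "wi (\<Union>i<Suc n. F i) = (\<lambda>x. wi (\<Union>i<n. F i) x + wi (F n) x)"
        by (auto simp: fun_eq_iff wi_def indicator_def lessThan_Suc)
      then show ?case using add[OF wiL[OF UM(1)] wiL[OF FM[of n]]] Suc by simp
    qed
    have "(\<lambda>n. LINT x|M. wi ((\<Union>i. F i) - (\<Union>i<n. F i)) x) \<longlonglongrightarrow> (LINT x|M. 0)"
    proof (rule integral_dominated_convergence[where w = w])
      show "wi ((\<Union>i. F i) - (\<Union>i<n. F i)) \<in> borel_measurable M" for n
        by (rule borel_measurable_integrable[OF L1D[OF wiL[OF UM(2)]]])
      show "AE x in M. norm (wi ((\<Union>i. F i) - (\<Union>i<n. F i)) x) \<le> w x" for n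
        using w(1) by (auto intro!: AE_I2 simp: wi_def indicator_def less_imp_le)
      show "AE x in M. (\<lambda>n. wi ((\<Union>i. F i) - (\<Union>i<n. F i)) x) \<longlonglongrightarrow> 0"
      proof (rule AE_I2)
        fix x
        have "\<forall>\<^sub>F n in sequentially. 0 = wi ((\<Union>i. F i) - (\<Union>i<n. F i)) x"
        proof (cases "\<exists>i. x \<in> F i")
          case True
          then obtain i where i: "x \<in> F i" by blast
          show ?thesis using eventually_gt_at_top[of i] by eventually_elim (use i in \<open>auto simp: wi_def indicator_def\<close>)
        next
          case False
          then show ?thesis by (auto simp: wi_def)
        qed
        then show "(\<lambda>n. wi ((\<Union>i. F i) - (\<Union>i<n. F i)) x) \<longlonglongrightarrow> 0"
          by (rule Lim_transform_eventually[OF tendsto_const])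
      qed
    qed (use w(2) in auto)
    then have to_0: "(\<lambda>n. c * L1_norm M (wi ((\<Union>i. F i) - (\<Union>i<n. F i)))) \<longlonglongrightarrow> 0"
      unfolding L1n by (intro tendsto_mult_right_zero) simp
    have "(\<lambda>n. \<Phi> (wi (\<Union>i. F i)) - \<Phi> (wi (\<Union>i<n. F i))) \<longlonglongrightarrow> 0"
    proof (rule Lim_null_comparison[OF always_eventually to_0], rule allI)
      fix n
      have "wi (\<Union>i. F i) = (\<lambda>x. wi ((\<Union>i. F i) - (\<Union>i<n. F i)) x + wi (\<Union>i<n. F i) x)"
        by (auto simp: fun_eq_iff wi_def indicator_def)
      then have "\<Phi> (wi (\<Union>i. F i)) = \<Phi> (wi ((\<Union>i. F i) - (\<Union>i<n. F i))) + \<Phi> (wi (\<Union>i<n. F i))"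
        using add[OF wiL[OF UM(2)] wiL[OF UM(1)]] by simp
      then show "norm (\<Phi> (wi (\<Union>i. F i)) - \<Phi> (wi (\<Union>i<n. F i)))
          \<le> c * L1_norm M (wi ((\<Union>i. F i) - (\<Union>i<n. F i)))"
        using bound[OF wiL[OF UM(2)[of n]]] by simp
    qed
    from tendsto_diff[OF tendsto_const[of "\<Phi> (wi (\<Union>i. F i))"] this]
    show ?thesis unfolding sums_def fin[symmetric] by simp
  qed
  define N where "N = measure_of (space M) (sets M) (\<lambda>A. ennreal (\<Phi> (wi A)))"
  have N: "emeasure N A = ennreal (\<Phi> (wi A))" if A: "A \<in> sets M" for A
    unfolding N_def
  proof (rule emeasure_measure_of_sigma[OF sets.sigma_algebra_axioms _ _ A])
    have "wi {} = (\<lambda>x. 0 * wi {} x)" by (simp add: fun_eq_iff wi_def)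
    then have "\<Phi> (wi {}) = 0" using scale[OF wiL[of "{}"], of 0] by simp
    then show "positive (sets M) (\<lambda>A. ennreal (\<Phi> (wi A)))" by (simp add: positive_def)
    show "countably_additive (sets M) (\<lambda>A. ennreal (\<Phi> (wi A)))"
    proof (rule countably_additiveI)
      fix F :: "nat \<Rightarrow> 'a set" assume F: "range F \<subseteq> sets M" "disjoint_family F"
      have "(\<Sum>i. ennreal (\<Phi> (wi (F i)))) = ennreal (\<Sum>i. \<Phi> (wi (F i)))"
        using F by (intro suminf_ennreal2 \<Phi>_nn sums_summable[OF sums[OF F]]) auto
      then show "(\<Sum>i. ennreal (\<Phi> (wi (F i)))) = ennreal (\<Phi> (wi (\<Union>i. F i)))"
        using sums_unique[OF sums[OF F]] by simp
    qed
  qed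
  have setsN: "sets N = sets M" by (simp add: N_def)
  have "absolutely_continuous M N"
    unfolding absolutely_continuous_def
  proof
    fix A assume A: "A \<in> null_sets M"
    then have AM: "A \<in> sets M" by auto
    have "AE x in M. wi A x = 0" using AE_not_in[OF A] by eventually_elim (simp add: wi_def)
    then have "L1_norm M (wi A) = 0" using L1_norm_0_iff[OF wiL[OF AM]] by simp
    then have "\<Phi> (wi A) = 0" using bound[OF wiL[OF AM]] by simp
    then show "A \<in> null_sets N" using AM by (auto simp: null_sets_def N setsN)
  qed
  from Radon_Nikodym[OF this setsN] obtain f where [measurable]: "f \<in> borel_measurable M" and f: "density M f = N"
    by blast
  have Nf: "(\<integral>\<^sup>+x. f x * indicator A x \<partial>M) = ennreal (\<Phi> (wi A))" if "A \<in> sets M" for A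
    using N[OF that] that unfolding f[symmetric] by (simp add: emeasure_density)
  have "(\<integral>\<^sup>+x. f x \<partial>M) = ennreal (\<Phi> (wi (space M)))"
    using Nf[of "space M"] by (simp cong: nn_integral_cong_simp)
  then have "(\<integral>\<^sup>+x. f x \<partial>M) \<noteq> \<infinity>" by simp
  then have f_fin: "AE x in M. f x \<noteq> \<infinity>" by (intro nn_integral_noteq_infinite) auto
  define g where "g x = enn2real (f x)" for x
  have [measurable]: "g \<in> borel_measurable M" unfolding g_def by measurable
  have nng: "(\<integral>\<^sup>+x. ennreal (g x * indicator A x) \<partial>M) = ennreal (\<Phi> (wi A))" if A: "A \<in> sets M" for A
  proof -
    have "(\<integral>\<^sup>+x. ennreal (g x * indicator A x) \<partial>M) = (\<integral>\<^sup>+x. f x * indicator A x \<partial>M)"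
      using f_fin by (intro nn_integral_cong_AE) (auto simp: g_def indicator_def less_top elim!: eventually_mono)
    then show ?thesis using Nf[OF A] by simp
  qed
  have g_int: "(LINT x|M. g x * indicator A x) = \<Phi> (wi A)" "integrable M (\<lambda>x. g x * indicator A x)"
    if A: "A \<in> sets M" for A
  proof -
    have 0: "0 \<le> g x * indicator A x" for x by (simp add: g_def)
    from A have m: "(\<lambda>x. g x * indicator A x) \<in> borel_measurable M" by measurable
    show "(LINT x|M. g x * indicator A x) = \<Phi> (wi A)"
      by (subst integral_eq_nn_integral) (use m 0 nng[OF A] \<Phi>_nn[OF A] in auto)
    show "integrable M (\<lambda>x. g x * indicator A x)"
      by (rule integrableI_nonneg[OF m]) (use 0 nng[OF A] in auto)
  qed
  define h where "h x = g x / w x" for x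
  have [measurable]: "h \<in> borel_measurable M" unfolding h_def by measurable
  have wh: "w x * h x = g x" for x using w(1)[of x] by (simp add: h_def)
  have h0: "0 \<le> h x" for x using w(1)[of x] by (simp add: h_def g_def)
  have "AE x in M. h x \<le> c"
  proof (rule AE_le_if_weighted_integrals_le[OF _ w(1)])
    show "integrable M (\<lambda>x. w x * h x)"
    proof -
      have "integrable M (\<lambda>x. g x * indicator (space M) x) \<longleftrightarrow> integrable M g"
        by (rule Bochner_Integration.integrable_cong) auto
      then show ?thesis using g_int(2)[of "space M"] by (simp add: wh)
    qed
    show "integrable M (\<lambda>x. w x * c)" using w(2) by simp
    fix A assume A: "A \<in> sets M"
    have "(LINT x|M. w x * indicator A x * h x) = (LINT x|M. g x * indicator A x)"
      by (rule Bochner_Integration.integral_cong) (simp_all flip: wh)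
    also have "\<dots> \<le> c * L1_norm M (wi A)"
      using bound[OF wiL[OF A]] g_int(1)[OF A] by simp
    also have "\<dots> = (LINT x|M. w x * indicator A x * c)" unfolding L1n by (simp add: wi_def[abs_def])
    finally show "(LINT x|M. w x * indicator A x * h x) \<le> (LINT x|M. w x * indicator A x * c)" .
  qed auto
  then have hc: "AE x in M. \<bar>h x\<bar> \<le> c" using h0 by simp
  then have hL: "h \<in> Linf M" by (auto simp: Linf_def)
  have "\<Phi> u - (LINT x|M. u x * h x) = 0" if u: "u \<in> L1 M" for u
  proof (rule functional_eq_0[OF _ _ _ _ w _ u, where \<Psi> = "\<lambda>u. \<Phi> u - (LINT x|M. u x * h x)" and c = "2 * c"])
    note i = integrable_mult_Linf[OF _ hL]
    show "\<Phi> (\<lambda>x. u x + v x) - (LINT x|M. (u x + v x) * h x) =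
        (\<Phi> u - (LINT x|M. u x * h x)) + (\<Phi> v - (LINT x|M. v x * h x))" if "u \<in> L1 M" "v \<in> L1 M" for u v
      using that i by (simp add: add distrib_right)
    show "\<Phi> (\<lambda>x. k * u x) - (LINT x|M. k * u x * h x) = k * (\<Phi> u - (LINT x|M. u x * h x))"
      if "u \<in> L1 M" for k u
      using that by (simp add: scale right_diff_distrib mult.assoc)
    show "\<bar>\<Phi> u - (LINT x|M. u x * h x)\<bar> \<le> 2 * c * L1_norm M u" if "u \<in> L1 M" for u
      using bound[OF that] abs_integral_mult_le[OF that hL hc] by linarith
    show "\<Phi> (\<lambda>x. w x * indicator A x) - (LINT x|M. w x * indicator A x * h x) = 0" if A: "A \<in> sets M" for A
    proof -
      have "(LINT x|M. w x * indicator A x * h x) = (LINT x|M. g x * indicator A x)"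
        by (rule Bochner_Integration.integral_cong) (simp_all flip: wh)
      then show ?thesis using g_int(1)[OF A] by (simp add: wi_def[abs_def])
    qed
  qed auto
  with hL show ?thesis by auto
qed

end

text \<open>
  A subsequence converges almost everywhere, and Fatou's lemma turns its limit into the limit in
  norm of the whole sequence.
\<close>

lemma L1_complete:
  fixes s :: "nat \<Rightarrow> 'a \<Rightarrow> real"
  assumes s: "\<And>n. s n \<in> L1 M"
    and Cauchy: "\<And>d. 0 < d \<Longrightarrow> \<exists>N. \<forall>i\<ge>N. \<forall>j\<ge>N. L1_norm M (\<lambda>x. s i x - s j x) < d"
  shows "\<exists>u\<in>L1 M. (\<lambda>n. L1_norm M (\<lambda>x. s n x - u x)) \<longlonglongrightarrow> 0"
proof -
  have int: "integrable M (s n)" for n by (rule L1D[OF s])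
  note [measurable] = borel_measurable_integrable[OF int]
  obtain r :: "nat \<Rightarrow> nat" where r: "strict_mono r" "AE x in M. Cauchy (\<lambda>i. s (r i) x)"
  proof (rule cauchy_L1_AE_cauchy_subseq[OF int])
    show "\<exists>N. \<forall>i\<ge>N. \<forall>j\<ge>N. (LINT x|M. norm (s i x - s j x)) < d" if "0 < d" for d
      using Cauchy[OF that] by (simp add: L1_norm_def)
  qed
  define u where "u x = lim (\<lambda>i. s (r i) x)" for x
  have [measurable]: "u \<in> borel_measurable M" unfolding u_def[abs_def] by measurable
  have lim: "AE x in M. (\<lambda>i. s (r i) x) \<longlonglongrightarrow> u x"
    using r(2) unfolding u_def by eventually_elim (simp add: Cauchy_convergent_iff convergent_LIMSEQ_iff)
  have small: "\<exists>N. \<forall>n\<ge>N. (\<integral>\<^sup>+x. ennreal \<bar>s n x - u x\<bar> \<partial>M) \<le> ennreal d" if d: "0 < d" for d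
  proof -
    obtain N where N: "\<And>i j. N \<le> i \<Longrightarrow> N \<le> j \<Longrightarrow> L1_norm M (\<lambda>x. s i x - s j x) < d"
      using Cauchy[OF d] by blast
    have "(\<integral>\<^sup>+x. ennreal \<bar>s n x - u x\<bar> \<partial>M) \<le> ennreal d" if n: "N \<le> n" for n
    proof -
      have "(\<integral>\<^sup>+x. ennreal \<bar>s n x - u x\<bar> \<partial>M) = (\<integral>\<^sup>+x. liminf (\<lambda>i. ennreal \<bar>s n x - s (r i) x\<bar>) \<partial>M)"
      proof (rule nn_integral_cong_AE)
        show "AE x in M. ennreal \<bar>s n x - u x\<bar> = liminf (\<lambda>i. ennreal \<bar>s n x - s (r i) x\<bar>)"
          using lim
        proof eventually_elim
          case (elim x)
          then have "(\<lambda>i. ennreal \<bar>s n x - s (r i) x\<bar>) \<longlonglongrightarrow> ennreal \<bar>s n x - u x\<bar>"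
            by (intro tendsto_ennrealI tendsto_intros)
          then show ?case using lim_imp_Liminf[OF sequentially_bot] by metis
        qed
      qed
      also have "\<dots> \<le> liminf (\<lambda>i. \<integral>\<^sup>+x. ennreal \<bar>s n x - s (r i) x\<bar> \<partial>M)"
        by (rule nn_integral_liminf) measurable
      also have "\<dots> \<le> liminf (\<lambda>i::nat. ennreal d)"
      proof (rule Liminf_mono)
        show "\<forall>\<^sub>F i in sequentially. (\<integral>\<^sup>+x. ennreal \<bar>s n x - s (r i) x\<bar> \<partial>M) \<le> ennreal d"
          using eventually_ge_at_top[of N]
        proof eventually_elim
          case (elim i)
          then have "N \<le> r i" using seq_suble[OF r(1), of i] by simp
          from N[OF n this] show ?case
            using int[of n] int[of "r i"] by (subst nn_integral_eq_integral) (auto simp: L1_norm_def intro!: ennreal_leI)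
        qed
      qed
      also have "\<dots> = ennreal d" by (simp add: Liminf_const)
      finally show ?thesis .
    qed
    then show ?thesis by blast
  qed
  obtain N where N: "(\<integral>\<^sup>+x. ennreal \<bar>s N x - u x\<bar> \<partial>M) \<le> ennreal 1" using small[of 1] by auto
  have "integrable M (\<lambda>x. s N x - u x)"
  proof (rule integrableI_bounded)
    show "(\<integral>\<^sup>+x. ennreal (norm (s N x - u x)) \<partial>M) < \<infinity>"
      using N by (simp add: le_less_trans[OF N])
  qed measurable
  from Bochner_Integration.integrable_diff[OF int[of N] this] have u: "u \<in> L1 M" by (simp add: L1_def)
  have "(\<lambda>n. L1_norm M (\<lambda>x. s n x - u x)) \<longlonglongrightarrow> 0"
  proof (rule LIMSEQ_I)
    fix d :: real assume d: "0 < d"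
    obtain N where N: "\<And>n. N \<le> n \<Longrightarrow> (\<integral>\<^sup>+x. ennreal \<bar>s n x - u x\<bar> \<partial>M) \<le> ennreal (d / 2)"
      using small[of "d / 2"] d by auto
    have "L1_norm M (\<lambda>x. s n x - u x) \<le> d / 2" if "N \<le> n" for n
    proof -
      have "(\<integral>\<^sup>+x. ennreal \<bar>s n x - u x\<bar> \<partial>M) = ennreal (L1_norm M (\<lambda>x. s n x - u x))"
        unfolding L1_norm_def using L1D[OF L1_diff[OF s u]] by (intro nn_integral_eq_integral) auto
      then show ?thesis using N[OF that] d by (simp add: ennreal_le_iff)
    qed
    moreover have "0 \<le> L1_norm M v" for v by (simp add: L1_norm_def)
    ultimately show "\<exists>N. \<forall>n\<ge>N. norm (L1_norm M (\<lambda>x. s n x - u x) - 0) < d"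
      using d by (intro exI[of _ N]) force
  qed
  with u show ?thesis by blast
qed

section \<open>An isometric embedding of \<open>L\<^sup>1\<close> into a Banach space\<close>

instance bcontfun :: (metric_space, banach) banach ..

definition test_functions :: "'a measure \<Rightarrow> ('a \<Rightarrow> real) set" where
  "test_functions M = {g \<in> borel_measurable M. \<forall>x. \<bar>g x\<bar> \<le> 1}"

text \<open>
  An integrable function is represented by its integrals against all test functions. On the
  discrete index space every bounded function is continuous, so these values form an element of
  a Banach space, and the functions equal almost everywhere are identified. Functions that are
  not test functions get the value 0.
\<close>

definition emb :: "'a measure \<Rightarrow> ('a \<Rightarrow> real) \<Rightarrow> ('a \<Rightarrow> real) discrete \<Rightarrow>\<^sub>C real" where
  "emb M u = Bcontfun (\<lambda>d. if of_discrete d \<in> test_functions M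
     then LINT x|M. u x * of_discrete d x else 0)"

definition repr :: "'a measure \<Rightarrow> (('a \<Rightarrow> real) discrete \<Rightarrow>\<^sub>C real) \<Rightarrow> 'a \<Rightarrow> real" where
  "repr M z = (SOME u. u \<in> L1 M \<and> emb M u = z)"

definition lift :: "'a measure \<Rightarrow> (('a \<Rightarrow> real) \<Rightarrow> 'a \<Rightarrow> real) \<Rightarrow>
    (('a \<Rightarrow> real) discrete \<Rightarrow>\<^sub>C real) \<Rightarrow> ('a \<Rightarrow> real) discrete \<Rightarrow>\<^sub>C real" where
  "lift M T z = emb M (T (repr M z))"

definition mass :: "(('a \<Rightarrow> real) discrete \<Rightarrow>\<^sub>C real) \<Rightarrow> real" where
  "mass z = apply_bcontfun z (discrete (\<lambda>_. 1))"

abbreviation L1_pos :: "'a measure \<Rightarrow> ('a \<Rightarrow> real) set" where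
  "L1_pos M \<equiv> nonneg_part M (L1 M)"

lemma L1_zero: "(\<lambda>x. 0) \<in> L1 M"
  by (simp add: L1_def)

lemma test_functions_Linf: "g \<in> test_functions M \<Longrightarrow> g \<in> Linf M"
  unfolding test_functions_def Linf_def by (auto intro!: exI[of _ 1])

lemma test_bound:
  assumes u: "u \<in> L1 M" and g: "g \<in> test_functions M"
  shows "\<bar>LINT x|M. u x * g x\<bar> \<le> L1_norm M u"
proof -
  have "AE x in M. \<bar>g x\<bar> \<le> 1" using g by (simp add: test_functions_def)
  from abs_integral_mult_le[OF u test_functions_Linf[OF g] this] show ?thesis by simp
qed

lemma L1_norm_nonneg: "0 \<le> L1_norm M u"
  by (simp add: L1_norm_def)

lemma emb_apply:
  assumes u: "u \<in> L1 M"
  shows "apply_bcontfun (emb M u) d =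
    (if of_discrete d \<in> test_functions M then LINT x|M. u x * of_discrete d x else 0)"
  unfolding emb_def
proof (subst Bcontfun_inverse, rule bcontfun_normI)
  show "continuous_on UNIV (\<lambda>d. if of_discrete d \<in> test_functions M
      then LINT x|M. u x * of_discrete d x else 0)"
    by (simp add: continuous_on_open_vimage open_discrete)
  show "norm (if of_discrete d \<in> test_functions M then LINT x|M. u x * of_discrete d x else 0)
      \<le> L1_norm M u" for d
    using test_bound[OF u] L1_norm_nonneg[of M u] by simp
qed simp

lemma emb_apply_test:
  "u \<in> L1 M \<Longrightarrow> g \<in> test_functions M \<Longrightarrow> apply_bcontfun (emb M u) (discrete g) = (LINT x|M. u x * g x)"
  by (simp add: emb_apply discrete_inverse)

lemma mass_emb: "u \<in> L1 M \<Longrightarrow> mass (emb M u) = (LINT x|M. u x)"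
  by (simp add: mass_def emb_apply_test test_functions_def)

text \<open>The sign of \<open>u\<close> is a test function, at which the supremum is attained.\<close>

lemma norm_emb: assumes u: "u \<in> L1 M" shows "norm (emb M u) = L1_norm M u"
proof (rule antisym)
  show "norm (emb M u) \<le> L1_norm M u"
    by (rule norm_bound) (use test_bound[OF u] L1_norm_nonneg in \<open>auto simp: emb_apply[OF u]\<close>)
  note [measurable] = borel_measurable_integrable[OF L1D[OF u]]
  have "(\<lambda>x. sgn (u x)) \<in> test_functions M"
    by (auto simp: test_functions_def sgn_if)
  from emb_apply_test[OF u this] have "apply_bcontfun (emb M u) (discrete (\<lambda>x. sgn (u x))) = L1_norm M u"
    by (simp add: L1_norm_def abs_sgn)
  then show "L1_norm M u \<le> norm (emb M u)"
    using norm_bounded[of "emb M u" "discrete (\<lambda>x. sgn (u x))"] L1_norm_nonneg[of M u] by simp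
qed

lemma emb_add: "u \<in> L1 M \<Longrightarrow> v \<in> L1 M \<Longrightarrow> emb M (\<lambda>x. u x + v x) = emb M u + emb M v"
  by (rule bcontfun_eqI)
     (auto simp: emb_apply L1_add distrib_right integrable_mult_Linf test_functions_Linf)

lemma emb_scale: "u \<in> L1 M \<Longrightarrow> emb M (\<lambda>x. c * u x) = c *\<^sub>R emb M u"
  by (rule bcontfun_eqI) (auto simp: emb_apply L1_scale mult.assoc)

lemma emb_diff: "u \<in> L1 M \<Longrightarrow> v \<in> L1 M \<Longrightarrow> emb M (\<lambda>x. u x - v x) = emb M u - emb M v"
  using emb_add[of u M "\<lambda>x. (- 1) * v x"] emb_scale[of v M "- 1"] L1_scale[of v M "- 1"] by simp

lemma emb_eq_iff:
  assumes "u \<in> L1 M" "v \<in> L1 M"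
  shows "emb M u = emb M v \<longleftrightarrow> (AE x in M. u x = v x)"
proof -
  have "emb M u = emb M v \<longleftrightarrow> norm (emb M (\<lambda>x. u x - v x)) = 0" by (simp add: emb_diff assms)
  also have "\<dots> \<longleftrightarrow> (AE x in M. u x = v x)"
    unfolding norm_emb[OF L1_diff[OF assms]] L1_norm_0_iff[OF L1_diff[OF assms]] by simp
  finally show ?thesis .
qed

lemma repr_L1: "z \<in> emb M ` L1 M \<Longrightarrow> repr M z \<in> L1 M"
  and emb_repr: "z \<in> emb M ` L1 M \<Longrightarrow> emb M (repr M z) = z"
proof -
  assume "z \<in> emb M ` L1 M"
  then have "\<exists>u. u \<in> L1 M \<and> emb M u = z" by blast
  from someI_ex[OF this] show "repr M z \<in> L1 M" "emb M (repr M z) = z" unfolding repr_def by auto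
qed

lemma emb_pos_iff:
  assumes u: "u \<in> L1 M" shows "emb M u \<in> emb M ` L1_pos M \<longleftrightarrow> (AE x in M. 0 \<le> u x)"
proof
  assume "emb M u \<in> emb M ` L1_pos M"
  then obtain v where v: "v \<in> L1 M" "AE x in M. 0 \<le> v x" "emb M u = emb M v"
    by (auto simp: nonneg_part_def)
  then have "AE x in M. u x = v x" using emb_eq_iff[OF u v(1)] by simp
  with v(2) show "AE x in M. 0 \<le> u x" by eventually_elim simp
qed (use u in \<open>auto simp: nonneg_part_def\<close>)

lemma pos_repE:
  assumes "z \<in> emb M ` L1_pos M"
  obtains u where "u \<in> L1 M" "\<And>x. 0 \<le> u x" "z = emb M u"
proof -
  obtain v where v: "v \<in> L1 M" "AE x in M. 0 \<le> v x" "z = emb M v"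
    using assms by (auto simp: nonneg_part_def)
  have a: "(\<lambda>x. \<bar>v x\<bar>) \<in> L1 M" using v by (simp add: L1_def)
  have "AE x in M. v x = \<bar>v x\<bar>" using v(2) by eventually_elim simp
  then have "z = emb M (\<lambda>x. \<bar>v x\<bar>)" using v emb_eq_iff[OF v(1) a] by simp
  from that[OF a _ this] show ?thesis by simp
qed

lemma L1_limit:
  assumes z: "\<And>n. z n \<in> emb M ` L1 M" and lim: "z \<longlonglongrightarrow> y"
  shows "\<exists>u\<in>L1 M. y = emb M u \<and> (\<lambda>n. L1_norm M (\<lambda>x. repr M (z n) x - u x)) \<longlonglongrightarrow> 0"
proof -
  define s where "s n = repr M (z n)" for n
  have s: "s n \<in> L1 M" "emb M (s n) = z n" for n
    using repr_L1[OF z[of n]] emb_repr[OF z[of n]] by (auto simp: s_def)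
  have nz: "norm (z i - z j) = L1_norm M (\<lambda>x. s i x - s j x)" for i j
    using emb_diff[OF s(1) s(1), of i j] norm_emb[OF L1_diff[OF s(1) s(1)], of i j] by (simp add: s(2))
  have "\<exists>N. \<forall>i\<ge>N. \<forall>j\<ge>N. L1_norm M (\<lambda>x. s i x - s j x) < d" if "0 < d" for d
    using CauchyD[OF LIMSEQ_imp_Cauchy[OF lim] that] by (auto simp: nz)
  from L1_complete[OF s(1) this] obtain u where u: "u \<in> L1 M"
    "(\<lambda>n. L1_norm M (\<lambda>x. s n x - u x)) \<longlonglongrightarrow> 0" by blast
  have "norm (z n - emb M u) = L1_norm M (\<lambda>x. s n x - u x)" for n
    using emb_diff[OF s(1) u(1), of n] norm_emb[OF L1_diff[OF s(1) u(1)], of n] by (simp add: s(2))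
  with u(2) have "(\<lambda>n. norm (z n - emb M u)) \<longlonglongrightarrow> 0" by simp
  then have "z \<longlonglongrightarrow> emb M u" by (rule LIM_zero_cancel[OF tendsto_norm_zero_cancel])
  then have "y = emb M u" using lim LIMSEQ_unique by blast
  with u show ?thesis by (auto simp: s_def)
qed

lemma AL_space_L1: "AL_space (emb M ` L1 M) (emb M ` L1_pos M) mass"
proof
  show "subspace (emb M ` L1 M)"
  proof (rule subspaceI)
    have z: "(\<lambda>x. 0) \<in> L1 M" by (simp add: L1_def)
    from emb_scale[OF z, of 0] have "0 = emb M (\<lambda>x. 0)" by simp
    with z show "0 \<in> emb M ` L1 M" by blast
    fix x y assume "x \<in> emb M ` L1 M" "y \<in> emb M ` L1 M"
    then show "x + y \<in> emb M ` L1 M"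
      by (auto simp: emb_add[symmetric] intro!: imageI L1_add)
  next
    fix c x assume "x \<in> emb M ` L1 M"
    then show "c *\<^sub>R x \<in> emb M ` L1 M"
      by (auto simp: emb_scale[symmetric] intro!: imageI L1_scale)
  qed
  show "closed (emb M ` L1 M)"
    unfolding closed_sequential_limits using L1_limit by blast
  show "emb M ` L1_pos M \<subseteq> emb M ` L1 M" by (auto simp: nonneg_part_def)
  show "closed (emb M ` L1_pos M)"
    unfolding closed_sequential_limits
  proof (intro allI impI, elim conjE)
    fix z y assume z: "\<forall>n. z n \<in> emb M ` L1_pos M" and lim: "z \<longlonglongrightarrow> y"
    have zX: "z n \<in> emb M ` L1 M" for n using z by (auto simp: nonneg_part_def)
    obtain u where u: "u \<in> L1 M" "y = emb M u" "(\<lambda>n. L1_norm M (\<lambda>x. repr M (z n) x - u x)) \<longlonglongrightarrow> 0"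
      using L1_limit[OF zX lim] by blast
    \<comment> \<open>The negative part of the limit is dominated by the distance to the nonnegative \<open>repr M (z n)\<close>.\<close>
    let ?m = "\<lambda>x. min 0 (u x)"
    have m: "?m \<in> L1 M" using u(1) by (simp add: L1_def)
    have "L1_norm M ?m \<le> L1_norm M (\<lambda>x. repr M (z n) x - u x)" for n
      unfolding L1_norm_def
    proof (rule integral_mono_AE)
      have "AE x in M. 0 \<le> repr M (z n) x"
        using emb_pos_iff[OF repr_L1[OF zX[of n]]] z by (simp add: emb_repr[OF zX])
      then show "AE x in M. \<bar>?m x\<bar> \<le> \<bar>repr M (z n) x - u x\<bar>"
        by eventually_elim auto
    qed (use L1D[OF m] L1D[OF L1_diff[OF repr_L1[OF zX[of n]] u(1)]] in auto)
    then have "L1_norm M ?m \<le> 0" by (intro LIMSEQ_le_const[OF u(3)]) auto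
    then have "AE x in M. ?m x = 0"
      using L1_norm_0_iff[OF m] L1_norm_nonneg[of M ?m] by simp
    then have "AE x in M. 0 \<le> u x" by eventually_elim (simp add: min_def split: if_splits)
    then show "y \<in> emb M ` L1_pos M" using emb_pos_iff[OF u(1)] u(2) by simp
  qed
  show "0 \<in> emb M ` L1_pos M"
  proof -
    have z: "(\<lambda>x. 0) \<in> L1 M" by (simp add: L1_def)
    from emb_scale[OF z, of 0] have "0 = emb M (\<lambda>x. 0)" by simp
    with z show ?thesis by (auto simp: nonneg_part_def)
  qed
  show "p + q \<in> emb M ` L1_pos M" if p: "p \<in> emb M ` L1_pos M" and q: "q \<in> emb M ` L1_pos M" for p q
  proof -
    obtain u where u: "u \<in> L1 M" "\<And>x. 0 \<le> u x" "p = emb M u" using p by (rule pos_repE) blast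
    obtain v where v: "v \<in> L1 M" "\<And>x. 0 \<le> v x" "q = emb M v" using q by (rule pos_repE) blast
    show ?thesis using emb_pos_iff[OF L1_add[OF u(1) v(1)]] u v by (simp add: emb_add)
  qed
  show "c *\<^sub>R p \<in> emb M ` L1_pos M" if p: "p \<in> emb M ` L1_pos M" and c: "0 \<le> c" for p c
  proof -
    obtain u where u: "u \<in> L1 M" "\<And>x. 0 \<le> u x" "p = emb M u" using p by (rule pos_repE) blast
    then show ?thesis using emb_pos_iff[OF L1_scale[OF u(1), of c]] c by (simp add: emb_scale)
  qed
  show "\<exists>p\<in>emb M ` L1_pos M. \<exists>q\<in>emb M ` L1_pos M. x = p - q \<and> norm x = norm p + norm q"
    if x: "x \<in> emb M ` L1 M" for x
  proof -
    obtain u where u: "u \<in> L1 M" "x = emb M u" using x by blast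
    let ?p = "\<lambda>x. max 0 (u x)" and ?q = "\<lambda>x. max 0 (- u x)"
    have pq: "?p \<in> L1 M" "?q \<in> L1 M" using u(1) by (simp_all add: L1_def)
    have eq: "u = (\<lambda>x. ?p x - ?q x)" by auto
    have "x = emb M ?p - emb M ?q" unfolding u(2) by (subst eq) (rule emb_diff[OF pq])
    moreover have "norm x = norm (emb M ?p) + norm (emb M ?q)"
    proof -
      have "L1_norm M u = (LINT x|M. \<bar>?p x\<bar> + \<bar>?q x\<bar>)"
        unfolding L1_norm_def by (rule Bochner_Integration.integral_cong) auto
      also have "\<dots> = L1_norm M ?p + L1_norm M ?q"
        unfolding L1_norm_def using L1D[OF pq(1)] L1D[OF pq(2)]
        by (intro Bochner_Integration.integral_add integrable_abs)
      finally show ?thesis by (simp add: u norm_emb pq)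
    qed
    moreover have "emb M ?p \<in> emb M ` L1_pos M" "emb M ?q \<in> emb M ` L1_pos M"
      using pq by (auto simp: nonneg_part_def)
    ultimately show ?thesis by blast
  qed
  show "mass p = norm p" if p: "p \<in> emb M ` L1_pos M" for p
  proof -
    obtain u where "u \<in> L1 M" "\<And>x. 0 \<le> u x" "p = emb M u" using p by (rule pos_repE) blast
    then show ?thesis by (simp add: mass_emb norm_emb L1_norm_def)
  qed
qed (simp_all add: mass_def)

lemma lift_emb:
  assumes T: "linear_operator M T D" and u: "u \<in> D"
  shows "lift M T (emb M u) = emb M (T u)"
proof -
  have uL: "u \<in> L1 M" using T u by (auto simp: linear_operator_def)
  let ?v = "repr M (emb M u)"
  have v: "?v \<in> L1 M" "AE x in M. u x = ?v x"
    using repr_L1[of "emb M u" M] emb_repr[of "emb M u" M] emb_eq_iff[OF uL, of ?v] uL by auto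
  then have "?v \<in> D" using T u unfolding linear_operator_def by blast
  moreover from this have "AE x in M. T u x = T ?v x" using T u v(2) unfolding linear_operator_def by blast
  moreover have "T u \<in> L1 M" "T ?v \<in> L1 M" using T u \<open>?v \<in> D\<close> by (auto simp: linear_operator_def)
  ultimately show ?thesis unfolding lift_def using emb_eq_iff by metis
qed

lemma linear_operator_L1: "linear_operator M T D \<Longrightarrow> u \<in> D \<Longrightarrow> u \<in> L1 M"
  and linear_operator_image_L1: "linear_operator M T D \<Longrightarrow> u \<in> D \<Longrightarrow> T u \<in> L1 M"
  by (auto simp: linear_operator_def)

lemma emb_quotient:
  assumes "w \<in> L1 M" "u \<in> L1 M" "v \<in> L1 M"
  shows "norm ((1 / h) *\<^sub>R (emb M w - emb M u) - emb M v) = L1_norm M (\<lambda>x. (w x - u x) / h - v x)"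
proof -
  have d: "(\<lambda>x. (1 / h) * (w x - u x)) \<in> L1 M" by (intro L1_scale L1_diff assms)
  have "(1 / h) *\<^sub>R (emb M w - emb M u) - emb M v = emb M (\<lambda>x. (1 / h) * (w x - u x) - v x)"
    by (simp only: emb_diff[OF d assms(3)] emb_scale[OF L1_diff[OF assms(1,2)]] emb_diff[OF assms(1,2)])
  then show ?thesis using norm_emb[OF L1_diff[OF d assms(3)]] by simp
qed

section \<open>Semigroups of functions and of their images\<close>

lemma tendsto_at_right_0_eq:
  assumes "\<And>h. 0 < h \<Longrightarrow> norm (f h - y) = g h"
  shows "((f \<longlongrightarrow> y) (at_right (0::real)) \<longleftrightarrow> (g \<longlongrightarrow> (0::real)) (at_right 0))"
proof -
  have "(f \<longlongrightarrow> y) (at_right 0) \<longleftrightarrow> ((\<lambda>h. norm (f h - y)) \<longlongrightarrow> 0) (at_right 0)"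
    by (simp add: tendsto_norm_zero_iff LIM_zero_iff)
  also have "\<dots> \<longleftrightarrow> (g \<longlongrightarrow> 0) (at_right 0)"
    by (rule tendsto_cong, rule eventually_mono[OF eventually_at_right_less[of 0]]) (rule assms)
  finally show ?thesis .
qed

context
  fixes M :: "'a measure"
begin

interpretation AL: AL_space "emb M ` L1 M" "emb M ` L1_pos M" mass
  by (rule AL_space_L1)

lemma lift_semigroup:
  assumes S: "substochastic_semigroup M S"
  shows "AL.semigroup (\<lambda>t. lift M (S t))"
proof -
  have lin: "linear_operator M (S t) (L1 M)" if "0 \<le> t" for t
    using S that by (simp add: substochastic_semigroup_def)
  note SL = linear_operator_image_L1[OF lin]
  note L = lift_emb[OF lin]
  show ?thesis
    unfolding AL.semigroup_def AL.substochastic_def AL.linear_on_X_def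
  proof (intro conjI allI impI ballI)
    fix t :: real assume t: "0 \<le> t"
    fix z assume "z \<in> emb M ` L1 M"
    then obtain u where u: "u \<in> L1 M" "z = emb M u" by blast
    show "lift M (S t) z \<in> emb M ` L1 M" using u SL t by (auto simp: L)
    show "norm (lift M (S t) z) \<le> norm z"
      using S t u by (simp add: L norm_emb SL substochastic_semigroup_def)
    show "lift M (S t) (c *\<^sub>R z) = c *\<^sub>R lift M (S t) z" for c
    proof -
      have "AE x in M. S t (\<lambda>y. c * u y) x = c * S t u x"
        using lin[OF t] u by (simp add: linear_operator_def)
      then have "emb M (S t (\<lambda>y. c * u y)) = emb M (\<lambda>x. c * S t u x)"
        by (subst emb_eq_iff) (auto intro: SL L1_scale t u)
      then show ?thesis using u t by (simp add: L SL L1_scale flip: emb_scale)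
    qed
    fix y assume "y \<in> emb M ` L1 M"
    then obtain v where v: "v \<in> L1 M" "y = emb M v" by blast
    have "AE x in M. S t (\<lambda>y. u y + v y) x = S t u x + S t v x"
      using lin[OF t] u v by (simp add: linear_operator_def)
    then have "emb M (S t (\<lambda>y. u y + v y)) = emb M (\<lambda>x. S t u x + S t v x)"
      by (subst emb_eq_iff) (auto intro: SL L1_add t u v)
    then show "lift M (S t) (z + y) = lift M (S t) z + lift M (S t) y"
      using u v t by (simp add: L SL L1_add flip: emb_add)
  next
    fix t :: real and p assume t: "0 \<le> t" and "p \<in> emb M ` L1_pos M"
    then obtain u where u: "u \<in> L1_pos M" "p = emb M u" by blast
    then have uL: "u \<in> L1 M" by (simp add: nonneg_part_def)
    have "AE x in M. 0 \<le> S t u x"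
      using S t u by (simp add: substochastic_semigroup_def positive_on_def)
    then show "lift M (S t) p \<in> emb M ` L1_pos M"
      using t uL emb_pos_iff[OF SL[OF t uL]] by (simp add: u L)
  next
    fix z assume "z \<in> emb M ` L1 M"
    then obtain u where u: "u \<in> L1 M" "z = emb M u" by blast
    have "AE x in M. S 0 u x = u x" using S u by (simp add: substochastic_semigroup_def)
    then show "lift M (S 0) z = z" using emb_eq_iff[OF SL u(1), of 0 u] u by (simp add: L)
    show "lift M (S (s + t)) z = lift M (S s) (lift M (S t) z)" if "0 \<le> s" "0 \<le> t" for s t
    proof -
      have "AE x in M. S (s + t) u x = S s (S t u) x"
        using S u that by (simp add: substochastic_semigroup_def)
      then have "emb M (S (s + t) u) = emb M (S s (S t u))"
        using that u by (subst emb_eq_iff) (auto intro: SL)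
      then show ?thesis using that u by (simp add: L SL)
    qed
    have "((\<lambda>t. L1_norm M (\<lambda>x. S t u x - u x)) \<longlongrightarrow> 0) (at_right 0)"
      using S u by (simp add: substochastic_semigroup_def)
    then show "((\<lambda>t. lift M (S t) z) \<longlongrightarrow> z) (at_right 0)"
      by (subst tendsto_at_right_0_eq[where g = "\<lambda>t. L1_norm M (\<lambda>x. S t u x - u x)"])
         (use u SL in \<open>simp_all add: L norm_emb L1_diff flip: emb_diff\<close>)
  qed
qed

lemma lift_gen_iff:
  assumes S: "substochastic_semigroup M S" and uv: "u \<in> L1 M" "v \<in> L1 M"
  shows "(emb M u, emb M v) \<in> AL.gen (\<lambda>t. lift M (S t)) \<longleftrightarrow> (u, v) \<in> generator_graph M S"
proof -
  have lin: "linear_operator M (S t) (L1 M)" if "0 \<le> t" for t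
    using S that by (simp add: substochastic_semigroup_def)
  have "norm ((1 / h) *\<^sub>R (lift M (S h) (emb M u) - emb M u) - emb M v)
      = L1_norm M (\<lambda>x. (S h u x - u x) / h - v x)" if "0 < h" for h
    using that uv lift_emb[OF lin uv(1)] linear_operator_image_L1[OF lin uv(1)]
    by (simp add: emb_quotient)
  from tendsto_at_right_0_eq[OF this] show ?thesis
    using uv by (simp add: AL.gen_def generator_graph_def)
qed

lemma gen_lift_cases:
  assumes S: "substochastic_semigroup M S" and "(x, y) \<in> AL.gen (\<lambda>t. lift M (S t))"
  obtains u v where "u \<in> L1 M" "v \<in> L1 M" "x = emb M u" "y = emb M v" "(u, v) \<in> generator_graph M S"
proof -
  obtain u v where "u \<in> L1 M" "v \<in> L1 M" "x = emb M u" "y = emb M v"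
    using assms(2) by (auto simp: AL.gen_def)
  with that assms lift_gen_iff[OF S] show ?thesis by blast
qed

text \<open>The converse of \<open>lift_semigroup\<close>, needed because minimality refers to semigroups acting on functions.\<close>

lemma unlift_semigroup:
  assumes Q: "AL.semigroup Q"
  defines "q \<equiv> \<lambda>t u. repr M (Q t (emb M u))"
  shows "substochastic_semigroup M q"
    and "u \<in> L1 M \<Longrightarrow> v \<in> L1 M \<Longrightarrow> (emb M u, emb M v) \<in> AL.gen Q \<Longrightarrow> (u, v) \<in> generator_graph M q"
    and "u \<in> L1 M \<Longrightarrow> 0 \<le> t \<Longrightarrow> emb M (q t u) = Q t (emb M u)"
    and "u \<in> L1 M \<Longrightarrow> 0 \<le> t \<Longrightarrow> q t u \<in> L1 M"
proof -
  note sub = AL.semi_sub[OF Q]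
  have QX: "Q t (emb M u) \<in> emb M ` L1 M" if "0 \<le> t" "u \<in> L1 M" for t u
    using AL.sub_X[OF sub[OF that(1)]] that(2) by blast
  have qL: "q t u \<in> L1 M" and eq: "emb M (q t u) = Q t (emb M u)" if "0 \<le> t" "u \<in> L1 M" for t u
    unfolding q_def using repr_L1[OF QX[OF that]] emb_repr[OF QX[OF that]] by auto
  show "emb M (q t u) = Q t (emb M u)" "q t u \<in> L1 M" if "u \<in> L1 M" "0 \<le> t" for t u
    using eq qL that by auto
  have lin: "linear_operator M (q t) (L1 M)" if t: "0 \<le> t" for t
    unfolding linear_operator_def
  proof (intro conjI ballI allI impI)
    fix u v assume u: "u \<in> L1 M" and v: "v \<in> L1 M"
    have "emb M (q t (\<lambda>y. u y + v y)) = emb M (\<lambda>x. q t u x + q t v x)"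
      using t u v by (simp add: eq emb_add L1_add qL AL.sub_add[OF sub])
    then show "AE x in M. q t (\<lambda>y. u y + v y) x = q t u x + q t v x"
      by (subst (asm) emb_eq_iff) (auto intro!: qL L1_add t u v)
    show "AE x in M. q t u x = q t v x" if "AE x in M. u x = v x"
      using that emb_eq_iff[OF u v] emb_eq_iff[OF qL[OF t u] qL[OF t v]] by (simp add: eq t u v)
  next
    fix c u assume u: "u \<in> L1 M"
    have "emb M (q t (\<lambda>y. c * u y)) = emb M (\<lambda>x. c * q t u x)"
      using t u by (simp add: eq emb_scale L1_scale qL AL.sub_scale[OF sub])
    then show "AE x in M. q t (\<lambda>y. c * u y) x = c * q t u x"
      by (subst (asm) emb_eq_iff) (auto intro!: qL L1_scale t u)
  qed (auto intro: L1_add L1_scale L1_zero qL t)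
  show ss: "substochastic_semigroup M q"
    unfolding substochastic_semigroup_def
  proof (intro conjI allI impI ballI)
    show "linear_operator M (q t) (L1 M)" if "0 \<le> t" for t by (rule lin[OF that])
    show "positive_on M (q t) (L1 M)" if t: "0 \<le> t" for t
      unfolding positive_on_def
    proof
      fix u assume u: "u \<in> L1_pos M"
      then have uL: "u \<in> L1 M" by (simp add: nonneg_part_def)
      have "emb M (q t u) \<in> emb M ` L1_pos M"
        unfolding eq[OF t uL] using AL.sub_pos[OF sub[OF t]] u by blast
      then show "AE x in M. 0 \<le> q t u x" using emb_pos_iff[OF qL[OF t uL]] by simp
    qed
    show "L1_norm M (q t u) \<le> L1_norm M u" if "0 \<le> t" "u \<in> L1 M" for t u
    proof -
      have "norm (emb M (q t u)) \<le> norm (emb M u)"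
        unfolding eq[OF that] using that by (intro AL.sub_norm[OF sub]) auto
      then show ?thesis by (simp only: norm_emb[OF that(2)] norm_emb[OF qL[OF that]])
    qed
    fix u assume u: "u \<in> L1 M"
    show "AE x in M. q 0 u x = u x"
      using emb_eq_iff[OF qL u, of 0 u] AL.semi_0[OF Q, of "emb M u"] u by (simp add: eq)
    show "AE x in M. q (s + t) u x = q s (q t u) x" if "0 \<le> s" "0 \<le> t" for s t
      using AL.semi_add[OF Q that, of "emb M u"] that u
      by (subst emb_eq_iff[symmetric]) (auto simp: eq qL)
    show "((\<lambda>t. L1_norm M (\<lambda>x. q t u x - u x)) \<longlongrightarrow> 0) (at_right 0)"
      by (subst tendsto_at_right_0_eq[where f = "\<lambda>t. Q t (emb M u)" and y = "emb M u", symmetric])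
         (use u AL.semi_cont[OF Q] in \<open>auto simp: norm_emb qL L1_diff simp flip: eq emb_diff\<close>)
  qed
  show "(u, v) \<in> generator_graph M q" if u: "u \<in> L1 M" and v: "v \<in> L1 M" and uv: "(emb M u, emb M v) \<in> AL.gen Q"
  proof -
    have "norm ((1 / h) *\<^sub>R (Q h (emb M u) - emb M u) - emb M v) = L1_norm M (\<lambda>x. (q h u x - u x) / h - v x)"
      if "0 < h" for h
      using emb_quotient[OF qL[OF _ u] u v, of h h] that u by (simp add: eq)
    from tendsto_at_right_0_eq[OF this] uv show ?thesis
      using u v by (simp add: AL.gen_def generator_graph_def)
  qed
qed

end

section \<open>Almost everywhere limits of bounded functions\<close>

context sigma_finite_measure
begin

lemma bounded_AE_limit:
  assumes h: "\<And>n. h n \<in> Linf M" and le: "\<And>n. AE x in M. \<bar>h n x\<bar> \<le> c"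
    and conv: "AE x in M. convergent (\<lambda>n. h n x :: real)"
  defines "f \<equiv> \<lambda>x. lim (\<lambda>n. h n x)"
  shows "f \<in> Linf M" and "AE x in M. (\<lambda>n. h n x) \<longlonglongrightarrow> f x"
    and "u \<in> L1 M \<Longrightarrow> (\<lambda>n. LINT x|M. u x * h n x) \<longlonglongrightarrow> (LINT x|M. u x * f x)"
proof -
  have [measurable]: "h n \<in> borel_measurable M" for n using h[of n] by (simp add: Linf_def)
  show lim: "AE x in M. (\<lambda>n. h n x) \<longlonglongrightarrow> f x"
    using conv by eventually_elim (simp add: f_def convergent_LIMSEQ_iff)
  have le': "AE x in M. \<forall>n. \<bar>h n x\<bar> \<le> c" using le by (simp add: AE_all_countable)
  have "AE x in M. \<bar>f x\<bar> \<le> c"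
    using lim le'
  proof eventually_elim
    case (elim x)
    then show ?case by (intro LIMSEQ_le_const2[OF tendsto_rabs]) auto
  qed
  moreover have [measurable]: "f \<in> borel_measurable M" unfolding f_def by measurable
  ultimately show "f \<in> Linf M" by (auto simp: Linf_def)
  assume u: "u \<in> L1 M"
  note [measurable] = borel_measurable_integrable[OF L1D[OF u]]
  show "(\<lambda>n. LINT x|M. u x * h n x) \<longlonglongrightarrow> (LINT x|M. u x * f x)"
  proof (rule integral_dominated_convergence[where w = "\<lambda>x. c * \<bar>u x\<bar>"])
    show "integrable M (\<lambda>x. c * \<bar>u x\<bar>)" using L1D[OF u] by simp
    show "AE x in M. (\<lambda>n. u x * h n x) \<longlonglongrightarrow> u x * f x"
      using lim by eventually_elim (intro tendsto_intros)
    show "AE x in M. norm (u x * h n x) \<le> c * \<bar>u x\<bar>" for n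
      using le[of n] by eventually_elim (simp add: abs_mult mult.commute[of "\<bar>u x\<bar>" for x] mult_right_mono)
  qed measurable
qed

text \<open>
  By monotonicity the lower limit is a limit \<open>g \<le> 1\<close>, and dominated convergence turns the right-hand
  side into \<open>\<integral> u g = \<integral> u\<close> for all \<open>u \<ge> 0\<close>.
\<close>

lemma liminf_eq_1_iff_integrals:
  assumes f: "\<And>k. f k \<in> Linf M" and f01: "\<And>k. AE x in M. 0 \<le> f k x \<and> f k x \<le> (1::real)"
    and mono: "\<And>k. AE x in M. f k x \<le> f (Suc k) x"
  shows "{x \<in> space M. liminf (\<lambda>k. ereal (f k x)) < 1} \<in> null_sets M \<longleftrightarrow>
    (\<forall>u\<in>L1 M. (\<forall>x. 0 \<le> u x) \<longrightarrow> (\<lambda>k. LINT x|M. u x * f k x) \<longlonglongrightarrow> (LINT x|M. u x))"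
proof -
  have [measurable]: "f k \<in> borel_measurable M" for k using f[of k] by (simp add: Linf_def)
  define g where "g x = lim (\<lambda>k. f k x)" for x
  have all: "AE x in M. \<forall>k. 0 \<le> f k x \<and> f k x \<le> 1 \<and> f k x \<le> f (Suc k) x"
    using f01 mono by (simp add: AE_all_countable)
  have conv: "AE x in M. convergent (\<lambda>k. f k x)"
    using all
  proof eventually_elim
    case (elim x)
    then have "incseq (\<lambda>k. f k x)" by (simp add: incseq_Suc_iff)
    then show ?case using elim by (metis incseq_convergent convergent_def)
  qed
  have le1: "AE x in M. \<bar>f k x\<bar> \<le> 1" for k using f01[of k] by eventually_elim simp
  note L = bounded_AE_limit[OF f le1 conv, folded g_def]
  have g1: "AE x in M. g x \<le> 1"
    using L(2) all by eventually_elim (auto intro: LIMSEQ_le_const2)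
  have "AE x in M. liminf (\<lambda>k. ereal (f k x)) = ereal (g x)"
    using L(2)
  proof eventually_elim
    case (elim x)
    then have "(\<lambda>k. ereal (f k x)) \<longlonglongrightarrow> ereal (g x)" by simp
    then show ?case by (rule lim_imp_Liminf[OF sequentially_bot])
  qed
  then have "AE x in M. (\<not> liminf (\<lambda>k. ereal (f k x)) < 1) = (1 \<le> g x)"
    by eventually_elim (simp add: not_less)
  then have "(AE x in M. \<not> liminf (\<lambda>k. ereal (f k x)) < 1) \<longleftrightarrow> (AE x in M. 1 \<le> g x)"
    by (rule eventually_subst)
  moreover have "(AE x in M. \<not> liminf (\<lambda>k. ereal (f k x)) < 1) \<longleftrightarrow>
      {x \<in> space M. liminf (\<lambda>k. ereal (f k x)) < 1} \<in> null_sets M"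
    by (subst AE_iff_null) auto
  moreover have "(AE x in M. 1 \<le> g x) \<longleftrightarrow>
      (\<forall>u\<in>L1 M. (\<forall>x. 0 \<le> u x) \<longrightarrow> (\<lambda>k. LINT x|M. u x * f k x) \<longlonglongrightarrow> (LINT x|M. u x))"
  proof (intro iffI ballI impI)
    fix u assume g: "AE x in M. 1 \<le> g x" and u: "u \<in> L1 M" "\<forall>x. 0 \<le> u x"
    note [measurable] = borel_measurable_integrable[OF L1D[OF u(1)]]
    have [measurable]: "g \<in> borel_measurable M" using L(1) by (simp add: Linf_def)
    have "(LINT x|M. u x * g x) = (LINT x|M. u x)"
    proof (rule integral_cong_AE)
      show "AE x in M. u x * g x = u x" using g g1 by eventually_elim simp
    qed measurable
    then show "(\<lambda>k. LINT x|M. u x * f k x) \<longlonglongrightarrow> (LINT x|M. u x)" using L(3)[OF u(1)] by simp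
  next
    assume R: "\<forall>u\<in>L1 M. (\<forall>x. 0 \<le> u x) \<longrightarrow> (\<lambda>k. LINT x|M. u x * f k x) \<longlonglongrightarrow> (LINT x|M. u x)"
    show "AE x in M. 1 \<le> g x"
    proof (rule AE_le_if_integrals_le)
      show "(\<lambda>x. 1) \<in> Linf M" by (auto simp: Linf_def intro!: exI[of _ 1])
      show "g \<in> Linf M" by (rule L(1))
      fix u assume u: "u \<in> L1 M" "\<And>x. 0 \<le> u x"
      then have "(LINT x|M. u x * g x) = (LINT x|M. u x)"
        using R L(3)[OF u(1)] LIMSEQ_unique by blast
      then show "(LINT x|M. u x * 1) \<le> (LINT x|M. u x * g x)" by simp
    qed
  qed
  ultimately show ?thesis by simp
qed

end

section \<open>The stability criterion\<close>

text \<open>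
  The assumptions on operators acting on functions; \<open>kato\<close> below translates them into the abstract
  setting.
\<close>

locale kato_voigt = sigma_finite_measure M
  for M :: "'a measure" +
  fixes A B :: "('a \<Rightarrow> real) \<Rightarrow> 'a \<Rightarrow> real" and DA DB :: "('a \<Rightarrow> real) set"
    and S :: "real \<Rightarrow> ('a \<Rightarrow> real) \<Rightarrow> 'a \<Rightarrow> real"
  assumes A: "linear_operator M A DA" and B: "linear_operator M B DB"
    and S: "substochastic_semigroup M S" and generates: "generates M A DA S"
    and DA_DB: "DA \<subseteq> DB" and B_positive: "positive_on M B DA"
    and mass_balance: "\<forall>u\<in>nonneg_part M DA. (LINT x|M. A u x + B u x) = 0"
begin

interpretation AL: AL_space "emb M ` L1 M" "emb M ` L1_pos M" mass
  by (rule AL_space_L1)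

abbreviation graphA where
  "graphA \<equiv> AL.gen (\<lambda>t. lift M (S t))"

lemmas DA_L1 = linear_operator_L1[OF A] and A_L1 = linear_operator_image_L1[OF A]

lemma B_L1: "u \<in> DA \<Longrightarrow> B u \<in> L1 M"
  using linear_operator_image_L1[OF B] DA_DB by blast

lemma lift_B: "u \<in> DA \<Longrightarrow> lift M B (emb M u) = emb M (B u)"
  using lift_emb[OF B] DA_DB by blast

lemma graphA_emb: "u \<in> DA \<Longrightarrow> (emb M u, emb M (A u)) \<in> graphA"
  using generates by (simp add: lift_gen_iff[OF S] DA_L1 A_L1 generates_def)

lemma graphA_cases:
  assumes xy: "(x, y) \<in> graphA"
  obtains u where "u \<in> DA" "x = emb M u" "y = emb M (A u)"
proof -
  obtain u v where u: "x = emb M u" "(u, v) \<in> generator_graph M S"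
    using gen_lift_cases[OF S xy] by metis
  then have uD: "u \<in> DA" using generates by (auto simp: generates_def)
  have "y = emb M (A u)"
    using xy graphA_emb[OF uD] u(1)
    by (auto simp: AL.gen_def intro: tendsto_unique[OF trivial_limit_at_right_real])
  with uD u(1) show ?thesis by (rule that)
qed

lemma Domain_graphA: "x \<in> Domain graphA \<Longrightarrow> \<exists>u\<in>DA. x = emb M u"
  by (metis Domain.cases graphA_cases)

lemma kato: "kato_perturbation (emb M ` L1 M) (emb M ` L1_pos M) mass graphA (lift M B)"
proof -
  interpret m_dissipative "emb M ` L1 M" "emb M ` L1_pos M" mass graphA
    by (rule AL.m_dissipative_gen[OF lift_semigroup[OF S]])
  have add: "(\<lambda>x. u x + v x) \<in> DA" if "u \<in> DA" "v \<in> DA" for u v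
    using A that by (simp add: linear_operator_def)
  have scale: "(\<lambda>x. c * u x) \<in> DA" if "u \<in> DA" for c u
    using A that by (simp add: linear_operator_def)
  show ?thesis
  proof unfold_locales
    fix x assume "x \<in> Domain graphA"
    then obtain u where u: "u \<in> DA" "x = emb M u" using Domain_graphA by blast
    show "lift M B x \<in> emb M ` L1 M" using u by (simp add: lift_B B_L1)
    show "lift M B (c *\<^sub>R x) = c *\<^sub>R lift M B x" for c
    proof -
      have "AE x in M. B (\<lambda>y. c * u y) x = c * B u x"
        using B u DA_DB by (auto simp: linear_operator_def)
      then have "emb M (B (\<lambda>y. c * u y)) = emb M (\<lambda>x. c * B u x)"
        using emb_eq_iff[OF B_L1[OF scale[OF u(1)]] L1_scale[OF B_L1[OF u(1)]]] by simp
      then show ?thesis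
        using lift_B[OF scale[OF u(1), of c]] lift_B[OF u(1)] u
        by (simp add: emb_scale DA_L1 B_L1)
    qed
    show "lift M B x \<in> emb M ` L1_pos M" if "x \<in> emb M ` L1_pos M"
    proof -
      have "u \<in> nonneg_part M DA"
        using u that emb_pos_iff[OF DA_L1[OF u(1)]] by (simp add: nonneg_part_def)
      then have "AE x in M. 0 \<le> B u x" using B_positive by (simp add: positive_on_def)
      then show ?thesis using u emb_pos_iff[OF B_L1[OF u(1)]] by (simp add: lift_B)
    qed
    fix y assume "y \<in> Domain graphA"
    then obtain v where v: "v \<in> DA" "y = emb M v" using Domain_graphA by blast
    show "lift M B (x + y) = lift M B x + lift M B y"
    proof -
      have "AE x in M. B (\<lambda>y. u y + v y) x = B u x + B v x"
        using B u v DA_DB unfolding linear_operator_def by blast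
      then have "emb M (B (\<lambda>y. u y + v y)) = emb M (\<lambda>x. B u x + B v x)"
        using emb_eq_iff[OF B_L1[OF add[OF u(1) v(1)]] L1_add[OF B_L1[OF u(1)] B_L1[OF v(1)]]] by simp
      then show ?thesis
        using lift_B[OF add[OF u(1) v(1)]] lift_B[OF u(1)] lift_B[OF v(1)] u v
        by (simp add: emb_add DA_L1 B_L1)
    qed
  next
    fix x y assume xy: "(x, y) \<in> graphA" and x: "x \<in> emb M ` L1_pos M"
    obtain u where u: "u \<in> DA" "x = emb M u" "y = emb M (A u)" using xy by (rule graphA_cases)
    have "u \<in> nonneg_part M DA"
      using u x emb_pos_iff[OF DA_L1[OF u(1)]] by (simp add: nonneg_part_def)
    then have "(LINT x|M. A u x + B u x) = 0" using mass_balance by blast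
    then show "mass (y + lift M B x) = 0"
      using u by (simp add: lift_B mass_emb L1_add A_L1 B_L1 flip: emb_add)
  qed
qed

interpretation K: kato_perturbation "emb M ` L1 M" "emb M ` L1_pos M" mass graphA "lift M B"
  by (rule kato)

lemma resolvent:
  assumes l: "0 < l" and v: "v \<in> L1 M"
  shows "resolvent M A DA l v \<in> DA" and "emb M (resolvent M A DA l v) = K.res l (emb M v)"
proof -
  have vX: "emb M v \<in> emb M ` L1 M" using v by blast
  have iff: "emb M (A u) = l *\<^sub>R emb M u - emb M v \<longleftrightarrow> (AE x in M. l * u x - A u x = v x)"
    if u: "u \<in> DA" for u
  proof -
    have "emb M (A u) = l *\<^sub>R emb M u - emb M v \<longleftrightarrow> emb M (A u) = emb M (\<lambda>x. l * u x - v x)"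
      using u v by (simp add: emb_diff emb_scale L1_scale DA_L1)
    also have "\<dots> \<longleftrightarrow> (AE x in M. A u x = l * u x - v x)"
      by (rule emb_eq_iff[OF A_L1[OF u] L1_diff[OF L1_scale[OF DA_L1[OF u]] v]])
    finally show ?thesis by (simp add: algebra_simps eq_commute)
  qed
  obtain u where u: "u \<in> DA" "K.res l (emb M v) = emb M u" "l *\<^sub>R K.res l (emb M v) - emb M v = emb M (A u)"
    using K.res_graph[OF l vX] by (rule graphA_cases)
  then have "\<exists>u. u \<in> DA \<and> (AE x in M. l * u x - A u x = v x)" using iff[OF u(1)] by auto
  from someI_ex[OF this] have r: "resolvent M A DA l v \<in> DA \<and>
      (AE x in M. l * resolvent M A DA l v x - A (resolvent M A DA l v) x = v x)"
    unfolding resolvent_def .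
  then show "resolvent M A DA l v \<in> DA" ..
  have "(emb M (resolvent M A DA l v), l *\<^sub>R emb M (resolvent M A DA l v) - emb M v) \<in> graphA"
    using graphA_emb[of "resolvent M A DA l v"] iff[of "resolvent M A DA l v"] r by simp
  then have "K.res l (emb M v) = emb M (resolvent M A DA l v)" by (rule K.res_eqI[OF l])
  then show "emb M (resolvent M A DA l v) = K.res l (emb M v)" ..
qed

abbreviation BR :: "real \<Rightarrow> ('a \<Rightarrow> real) \<Rightarrow> 'a \<Rightarrow> real" where
  "BR l \<equiv> \<lambda>u. B (resolvent M A DA l u)"

lemma BR_L1: "0 < l \<Longrightarrow> u \<in> L1 M \<Longrightarrow> BR l u \<in> L1 M"
  by (intro B_L1 resolvent)

lemma emb_BR: "0 < l \<Longrightarrow> u \<in> L1 M \<Longrightarrow> emb M (BR l u) = K.K l (emb M u)"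
  by (simp add: K.K_def resolvent lift_B flip: resolvent(2))

abbreviation adj_iterate :: "real \<Rightarrow> nat \<Rightarrow> 'a \<Rightarrow> real" where
  "adj_iterate l n \<equiv> (adjoint_Linf M (BR l) ^^ n) (\<lambda>_. 1)"

text \<open>
  The \<open>n\<close>-th iterate of the adjoint at 1 is the density of the functional \<open>u \<mapsto> \<integral> (B R(l, A))\<^sup>n u\<close>. The
  choice in \<open>adjoint_Linf\<close> is meaningful at each stage because the next functional has a density.
\<close>

lemma adj_iterate:
  assumes l: "0 < l"
  shows "adj_iterate l n \<in> Linf M \<and>
    (\<forall>u\<in>L1 M. (LINT x|M. u x * adj_iterate l n x) = mass ((K.K l ^^ n) (emb M u)))"
proof (induction n)
  case 0
  then show ?case by (auto simp: mass_emb Linf_def intro!: exI[of _ 1])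
next
  case (Suc n)
  let ?\<Phi> = "\<lambda>u. mass ((K.K l ^^ Suc n) (emb M u))"
  note sub = K.Kn_sub[OF l, of "Suc n"]
  have X: "emb M u \<in> emb M ` L1 M" if "u \<in> L1 M" for u using that by blast
  note KX = AL.sub_X[OF sub X]
  have "\<exists>h\<in>Linf M. \<forall>u\<in>L1 M. ?\<Phi> u = (LINT x|M. u x * h x)"
  proof (rule positive_functional_density[where c = 1])
    fix u assume u: "u \<in> L1 M"
    show "?\<Phi> (\<lambda>x. k * u x) = k * ?\<Phi> u" for k
      by (simp only: emb_scale[OF u] AL.sub_scale[OF sub X[OF u]] AL.e_scale[OF KX[OF u]])
    show "\<bar>?\<Phi> u\<bar> \<le> 1 * L1_norm M u"
      using AL.abs_e_le[OF KX[OF u]] AL.sub_norm[OF sub X[OF u]] norm_emb[OF u] by simp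
    show "?\<Phi> (\<lambda>x. u x + v x) = ?\<Phi> u + ?\<Phi> v" if v: "v \<in> L1 M" for v
      by (simp only: emb_add[OF u v] AL.sub_add[OF sub X[OF u] X[OF v]] AL.e_add[OF KX[OF u] KX[OF v]])
    assume "\<And>x. 0 \<le> u x"
    then have "emb M u \<in> emb M ` L1_pos M" using emb_pos_iff[OF u] by simp
    then show "0 \<le> ?\<Phi> u" using AL.e_pos[OF AL.sub_pos[OF sub]] by (metis norm_ge_zero)
  qed
  then obtain h where h: "h \<in> Linf M" "\<And>u. u \<in> L1 M \<Longrightarrow> ?\<Phi> u = (LINT x|M. u x * h x)" by blast
  have eq: "(LINT x|M. BR l u x * adj_iterate l n x) = ?\<Phi> u" if u: "u \<in> L1 M" for u
    using Suc BR_L1[OF l u] by (simp add: emb_BR[OF l u] funpow_swap1)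
  have "\<exists>h. h \<in> Linf M \<and>
      (\<forall>u\<in>L1 M. (LINT x|M. BR l u x * adj_iterate l n x) = (LINT x|M. u x * h x))"
    using h eq by auto
  from someI_ex[OF this] have "adjoint_Linf M (BR l) (adj_iterate l n) \<in> Linf M \<and>
     (\<forall>u\<in>L1 M. (LINT x|M. BR l u x * adj_iterate l n x) =
        (LINT x|M. u x * adjoint_Linf M (BR l) (adj_iterate l n) x))"
    unfolding adjoint_Linf_def[of M "BR l" "adj_iterate l n"] .
  then show ?case using eq by simp
qed

lemma adj_iterate_bounds:
  assumes l: "0 < l"
  shows "AE x in M. 0 \<le> adj_iterate l n x" "AE x in M. adj_iterate l (Suc n) x \<le> adj_iterate l n x"
proof -
  have pos: "emb M u \<in> emb M ` L1_pos M" if "u \<in> L1 M" "\<And>x. 0 \<le> u x" for u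
    unfolding emb_pos_iff[OF that(1)] using that(2) by simp
  have int: "(LINT x|M. u x * adj_iterate l n x) = norm ((K.K l ^^ n) (emb M u))"
    if "u \<in> L1 M" "\<And>x. 0 \<le> u x" for u n
    using adj_iterate[OF l, of n] that(1) AL.e_pos[OF K.Kn_pos[OF l pos[OF that]], of n] by simp
  show "AE x in M. 0 \<le> adj_iterate l n x"
  proof (rule AE_le_if_integrals_le)
    show "(\<lambda>x. 0) \<in> Linf M" by (auto simp: Linf_def intro!: exI[of _ 0])
    show "adj_iterate l n \<in> Linf M" using adj_iterate[OF l] by blast
  qed (simp add: int)
  show "AE x in M. adj_iterate l (Suc n) x \<le> adj_iterate l n x"
  proof (rule AE_le_if_integrals_le)
    show "adj_iterate l (Suc n) \<in> Linf M" "adj_iterate l n \<in> Linf M" using adj_iterate[OF l] by blast+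
    fix u assume u: "u \<in> L1 M" "\<And>x. 0 \<le> u x"
    have "norm ((K.K l ^^ Suc n) (emb M u)) \<le> norm ((K.K l ^^ n) (emb M u))"
      using AL.sub_norm[OF K.K_sub[OF l] K.Kn_X[OF l], of "emb M u" n] u(1) by simp
    then show "(LINT x|M. u x * adj_iterate l (Suc n) x) \<le> (LINT x|M. u x * adj_iterate l n x)"
      unfolding int[OF u] .
  qed
qed

abbreviation f :: "real \<Rightarrow> 'a \<Rightarrow> real" where
  "f l \<equiv> f_lim M A B DA l"

text \<open>The last identity is the mass identity \<open>norm_Kn_tendsto\<close> read as a statement about \<open>f l\<close>.\<close>

lemma f_lim_props:
  assumes l: "0 < l"
  shows "f l \<in> Linf M" and "AE x in M. 0 \<le> f l x \<and> f l x \<le> 1"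
    and "u \<in> L1 M \<Longrightarrow> (\<And>x. 0 \<le> u x) \<Longrightarrow>
      (LINT x|M. u x * f l x) = norm (emb M u) - l * norm (K.G l (emb M u))"
proof -
  have f: "lim (\<lambda>n. adj_iterate l n x) = f l x" for x by (simp add: f_lim_def)
  have all: "AE x in M. \<forall>n. 0 \<le> adj_iterate l n x \<and> adj_iterate l (Suc n) x \<le> adj_iterate l n x"
    unfolding AE_all_countable
  proof
    fix n show "AE x in M. 0 \<le> adj_iterate l n x \<and> adj_iterate l (Suc n) x \<le> adj_iterate l n x"
      using adj_iterate_bounds[OF l, of n] by (rule AE_conjI)
  qed
  have conv: "AE x in M. (\<forall>n. 0 \<le> adj_iterate l n x \<and> adj_iterate l n x \<le> 1) \<and>
      convergent (\<lambda>n. adj_iterate l n x)"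
    using all
  proof eventually_elim
    case (elim x)
    then have dec: "decseq (\<lambda>n. adj_iterate l n x)" by (simp add: decseq_Suc_iff)
    have "adj_iterate l n x \<le> adj_iterate l 0 x" for n using decseqD[OF dec, of 0 n] by simp
    moreover have "convergent (\<lambda>n. adj_iterate l n x)"
      by (rule decseq_convergent[OF dec, of 0]) (use elim in \<open>auto simp: convergent_def\<close>)
    ultimately show ?case using elim by simp
  qed
  have le: "AE x in M. \<bar>adj_iterate l n x\<bar> \<le> 1" for n
    using conv by eventually_elim (simp add: abs_of_nonneg)
  have conv': "AE x in M. convergent (\<lambda>n. adj_iterate l n x)"
    using conv by eventually_elim simp
  have Li: "adj_iterate l n \<in> Linf M" for n using adj_iterate[OF l] by blast
  note L = bounded_AE_limit[OF Li le conv', unfolded f]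
  show "f l \<in> Linf M" by (rule L(1))
  show "AE x in M. 0 \<le> f l x \<and> f l x \<le> 1"
    using L(2) conv
  proof eventually_elim
    case (elim x)
    have "0 \<le> f l x" by (rule LIMSEQ_le_const[OF elim(1)]) (use elim(2) in blast)
    moreover have "f l x \<le> 1" by (rule LIMSEQ_le_const2[OF elim(1)]) (use elim(2) in blast)
    ultimately show ?case ..
  qed
  assume u: "u \<in> L1 M" "\<And>x. 0 \<le> u x"
  then have p: "emb M u \<in> emb M ` L1_pos M" using emb_pos_iff[OF u(1)] by simp
  have "(LINT x|M. u x * adj_iterate l n x) = norm ((K.K l ^^ n) (emb M u))" for n
    using adj_iterate[OF l, of n] u(1) AL.e_pos[OF K.Kn_pos[OF l p], of n] by simp
  then show "(LINT x|M. u x * f l x) = norm (emb M u) - l * norm (K.G l (emb M u))"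
    using L(3)[OF u(1)] K.norm_Kn_tendsto[OF l p] LIMSEQ_unique by simp
qed

text \<open>\<open>B R(l, A)\<close> decreases in \<open>l\<close>, and so do its iterates on the cone.\<close>

lemma f_lim_antimono:
  assumes m: "0 < m" "m \<le> l" shows "AE x in M. f l x \<le> f m x"
proof (rule AE_le_if_integrals_le)
  have l: "0 < l" using m by simp
  show "f l \<in> Linf M" "f m \<in> Linf M" by (intro f_lim_props l m)+
  fix u assume u: "u \<in> L1 M" "\<And>x. 0 \<le> u x"
  then have p: "emb M u \<in> emb M ` L1_pos M" using emb_pos_iff[OF u(1)] by simp
  have "norm (emb M u) - l * norm (K.G l (emb M u)) \<le> norm (emb M u) - m * norm (K.G m (emb M u))"
    by (rule LIMSEQ_le[OF K.norm_Kn_tendsto[OF l p] K.norm_Kn_tendsto[OF m(1) p]])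
       (intro exI[of _ 0] allI impI AL.norm_mono_pos K.Kn_pos K.Kn_antimono l m p)
  then show "(LINT x|M. u x * f l x) \<le> (LINT x|M. u x * f m x)"
    by (simp add: f_lim_props(3)[OF l u] f_lim_props(3)[OF m(1) u])
qed

lemma perturbed_semigroupD:
  assumes P: "perturbed_semigroup M A B DA P" and xy: "(x, y) \<in> graphA"
  shows "(x, y + lift M B x) \<in> AL.gen (\<lambda>t. lift M (P t))"
proof -
  obtain u where u: "u \<in> DA" "x = emb M u" "y = emb M (A u)" using xy by (rule graphA_cases)
  have "(u, \<lambda>x. A u x + B u x) \<in> generator_graph M P" using P u by (simp add: perturbed_semigroup_def)
  then show ?thesis
    using P u lift_gen_iff[of M P u "\<lambda>x. A u x + B u x"]
    by (simp add: perturbed_semigroup_def lift_B emb_add L1_add DA_L1 A_L1 B_L1)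
qed

lemma norm_lift_semigroup:
  assumes P: "substochastic_semigroup M P" and "0 \<le> t" "u \<in> L1 M"
  shows "norm (lift M (P t) (emb M u)) = L1_norm M (P t u)"
proof -
  have lin: "linear_operator M (P t) (L1 M)" using assms by (simp add: substochastic_semigroup_def)
  show ?thesis using lift_emb[OF lin] norm_emb[OF linear_operator_image_L1[OF lin]] assms by simp
qed

text \<open>In the bound of \<open>mass_loss_bound\<close> let \<open>N\<close> tend to infinity for fixed \<open>l\<close>, and only then \<open>l\<close> to 0.\<close>

lemma strongly_stable_imp_mass_loss:
  assumes P: "perturbed_semigroup M A B DA P" and stable: "strongly_stable M P"
    and lam: "\<And>k. 0 < lam k" "lam \<longlonglongrightarrow> 0" and z: "z \<in> emb M ` L1_pos M"
  shows "(\<lambda>k. lam k * norm (K.G (lam k) z)) \<longlonglongrightarrow> 0"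
proof (rule LIMSEQ_I)
  fix d :: real assume d: "0 < d"
  have PS: "substochastic_semigroup M P" using P by (simp add: perturbed_semigroup_def)
  obtain u where u: "u \<in> L1 M" "z = emb M u" using z by (auto simp: nonneg_part_def)
  have "((\<lambda>t. L1_norm M (P t u)) \<longlongrightarrow> 0) at_top" using stable u by (simp add: strongly_stable_def)
  from order_tendstoD(2)[OF this, of "d / 2"] d
  obtain T0 where "\<And>t. T0 \<le> t \<Longrightarrow> L1_norm M (P t u) < d / 2" by (auto simp: eventually_at_top_linorder)
  then have T: "norm (lift M (P t) z) \<le> d / 2" if "max 0 T0 \<le> t" for t
    using norm_lift_semigroup[OF PS _ u(1), of t] u(2) that by (simp add: less_imp_le)
  define T where "T = max 0 T0"
  have bound: "lam k * norm (K.G (lam k) z) \<le> lam k * (T + 1) * norm z + d / 2" for k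
  proof -
    have "norm z - norm ((K.K (lam k) ^^ N) z) \<le> lam k * (T + 1) * norm z + d / 2" for N
      by (rule K.mass_loss_bound[OF lift_semigroup[OF PS] perturbed_semigroupD[OF P] lam(1) z])
         (use T in \<open>auto simp: T_def\<close>)
    moreover have "(\<lambda>N. norm z - norm ((K.K (lam k) ^^ N) z)) \<longlonglongrightarrow>
        norm z - (norm z - lam k * norm (K.G (lam k) z))"
      by (intro tendsto_intros K.norm_Kn_tendsto lam z)
    ultimately show ?thesis by (intro LIMSEQ_le_const2[of _ "lam k * norm (K.G (lam k) z)"]) auto
  qed
  have "(\<lambda>k. lam k * (T + 1) * norm z) \<longlonglongrightarrow> 0 * (T + 1) * norm z" by (intro tendsto_intros lam)
  then have "\<forall>\<^sub>F k in sequentially. lam k * (T + 1) * norm z < d / 2" using d by (intro order_tendstoD(2)) auto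
  then obtain N where N: "\<And>k. N \<le> k \<Longrightarrow> lam k * (T + 1) * norm z < d / 2"
    by (auto simp: eventually_sequentially)
  have "norm (lam k * norm (K.G (lam k) z) - 0) < d" if "N \<le> k" for k
    using bound[of k] N[OF that] lam(1)[of k] by (simp add: abs_of_nonneg)
  then show "\<exists>N. \<forall>k\<ge>N. norm (lam k * norm (K.G (lam k) z) - 0) < d" by blast
qed

text \<open>
  Minimality enters here: \<open>P\<close> lies below the semigroup \<open>Q\<close> whose resolvent is \<open>G\<close>, and the orbits of
  \<open>Q\<close> on the cone decay because \<open>l norm (G l z)\<close> can be made small.
\<close>

lemma mass_loss_imp_strongly_stable:
  assumes P: "smallest_perturbed_semigroup M A B DA P"
    and lam: "\<And>k. 0 < lam k"
    and loss: "\<And>z. z \<in> emb M ` L1_pos M \<Longrightarrow> (\<lambda>k. lam k * norm (K.G (lam k) z)) \<longlonglongrightarrow> 0"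
  shows "strongly_stable M P"
proof -
  obtain Q where Q: "AL.semigroup Q" and ext: "\<And>x y. (x, y) \<in> graphA \<Longrightarrow> (x, y + lift M B x) \<in> AL.gen Q"
    and GQ: "\<And>l z. 0 < l \<Longrightarrow> z \<in> emb M ` L1 M \<Longrightarrow> (K.G l z, l *\<^sub>R K.G l z - z) \<in> AL.gen Q"
    using K.kato_voigt_semigroup by blast
  define q where "q t u = repr M (Q t (emb M u))" for t u
  note q = unlift_semigroup[OF Q, folded q_def]
  have "perturbed_semigroup M A B DA q"
    unfolding perturbed_semigroup_def
  proof (intro conjI ballI q(1))
    fix u assume u: "u \<in> DA"
    show "(u, \<lambda>x. A u x + B u x) \<in> generator_graph M q"
      using ext[OF graphA_emb[OF u]] u
      by (intro q(2)) (simp_all add: DA_L1 L1_add A_L1 B_L1 lift_B emb_add)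
  qed
  then have Pq: "AE x in M. P t u x \<le> q t u x" if "0 \<le> t" "u \<in> L1_pos M" for t u
    using P that by (simp add: smallest_perturbed_semigroup_def)
  have PS: "substochastic_semigroup M P"
    using P by (simp add: smallest_perturbed_semigroup_def perturbed_semigroup_def)
  note Psem = lift_semigroup[OF PS]
  have pos: "((\<lambda>t. norm (lift M (P t) z)) \<longlongrightarrow> 0) at_top" if z: "z \<in> emb M ` L1_pos M" for z
  proof (rule tendstoI)
    fix d :: real assume d: "0 < d"
    obtain u where u: "u \<in> L1_pos M" "z = emb M u" using z by blast
    then have uL: "u \<in> L1 M" by (simp add: nonneg_part_def)
    obtain k where k: "lam k * norm (K.G (lam k) z) < d / 2"
      using order_tendstoD(2)[OF loss[OF z], of "d / 2"] d eventually_happens'[OF sequentially_bot] by auto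
    obtain s where s: "0 \<le> s" "norm (Q s z) \<le> lam k * norm (K.G (lam k) z) + d / 2"
      using AL.orbit_eventually_small[OF Q GQ[OF lam[of k] AL.pos_X[OF z]] K.G_pos[OF lam z] z lam half_gt_zero[OF d]]
      by blast
    have "norm (lift M (P t) z) < d" if t: "s \<le> t" for t
    proof -
      have t0: "0 \<le> t" using s t by simp
      have lin: "linear_operator M (P t) (L1 M)" using PS t0 by (simp add: substochastic_semigroup_def)
      have PL: "P t u \<in> L1 M" by (rule linear_operator_image_L1[OF lin uL])
      have "AE x in M. 0 \<le> P t u x"
        using PS t0 u by (simp add: substochastic_semigroup_def positive_on_def)
      then have "L1_norm M (P t u) \<le> L1_norm M (q t u)"
        unfolding L1_norm_def using L1D[OF PL] L1D[OF q(4)[OF uL t0]] Pq[OF t0 u(1)]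
        by (intro integral_mono_AE) (auto elim: eventually_elim2)
      also have "\<dots> = norm (Q t z)" using norm_emb[OF q(4)[OF uL t0]] q(3)[OF uL t0] u(2) by simp
      also have "\<dots> \<le> norm (Q s z)" by (rule AL.norm_orbit_antimono[OF Q s(1) t AL.pos_X[OF z]])
      also have "\<dots> < d" using s(2) k by simp
      finally show ?thesis using norm_lift_semigroup[OF PS t0 uL] u(2) by simp
    qed
    then show "\<forall>\<^sub>F t in at_top. dist (norm (lift M (P t) z)) 0 < d"
      by (intro eventually_at_top_linorderI[of s]) simp
  qed
  show ?thesis
    unfolding strongly_stable_def
  proof
    fix u assume u: "u \<in> L1 M"
    then have uX: "emb M u \<in> emb M ` L1 M" by blast
    obtain p r where pr: "p \<in> emb M ` L1_pos M" "r \<in> emb M ` L1_pos M" "emb M u = p - r"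
      using AL.decomp[OF uX] by blast
    show "((\<lambda>t. L1_norm M (P t u)) \<longlongrightarrow> 0) at_top"
    proof (rule Lim_null_comparison)
      show "((\<lambda>t. norm (lift M (P t) p) + norm (lift M (P t) r)) \<longlongrightarrow> 0) at_top"
        using tendsto_add[OF pos[OF pr(1)] pos[OF pr(2)]] by simp
      show "\<forall>\<^sub>F t in at_top. norm (L1_norm M (P t u)) \<le> norm (lift M (P t) p) + norm (lift M (P t) r)"
        using eventually_ge_at_top[of 0]
      proof eventually_elim
        case (elim t)
        have "lift M (P t) (emb M u) = lift M (P t) p - lift M (P t) r"
          unfolding pr(3) by (intro AL.sub_diff[OF AL.semi_sub[OF Psem elim]] AL.pos_X pr)
        then have "L1_norm M (P t u) = norm (lift M (P t) p - lift M (P t) r)"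
          using norm_lift_semigroup[OF PS elim u] by simp
        then show ?case using norm_triangle_ineq4[of "lift M (P t) p"] by simp
      qed
    qed
  qed
qed

lemma integrals_f_tendsto_iff:
  assumes lam: "\<And>k. 0 < lam k"
  shows "(\<forall>u\<in>L1 M. (\<forall>x. 0 \<le> u x) \<longrightarrow> (\<lambda>k. LINT x|M. u x * f (lam k) x) \<longlonglongrightarrow> (LINT x|M. u x)) \<longleftrightarrow>
    (\<forall>z\<in>emb M ` L1_pos M. (\<lambda>k. lam k * norm (K.G (lam k) z)) \<longlonglongrightarrow> 0)"
proof -
  have iff: "(\<lambda>k. LINT x|M. u x * f (lam k) x) \<longlonglongrightarrow> (LINT x|M. u x) \<longleftrightarrow>
      (\<lambda>k. lam k * norm (K.G (lam k) (emb M u))) \<longlonglongrightarrow> 0" if u: "u \<in> L1 M" "\<And>x. 0 \<le> u x" for u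
  proof -
    have n: "norm (emb M u) = (LINT x|M. u x)" using u by (simp add: norm_emb L1_norm_def)
    have "(\<lambda>k. (LINT x|M. u x) - lam k * norm (K.G (lam k) (emb M u))) \<longlonglongrightarrow> (LINT x|M. u x) \<longleftrightarrow>
        (\<lambda>k. lam k * norm (K.G (lam k) (emb M u))) \<longlonglongrightarrow> 0" (is "(\<lambda>k. ?a - ?g k) \<longlonglongrightarrow> _ \<longleftrightarrow> _")
    proof
      assume "(\<lambda>k. ?a - ?g k) \<longlonglongrightarrow> ?a"
      from tendsto_diff[OF tendsto_const[of ?a] this] show "?g \<longlonglongrightarrow> 0" by simp
    next
      assume "?g \<longlonglongrightarrow> 0"
      from tendsto_diff[OF tendsto_const[of ?a] this] show "(\<lambda>k. ?a - ?g k) \<longlonglongrightarrow> ?a" by simp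
    qed
    then show ?thesis by (simp add: f_lim_props(3)[OF lam u] n)
  qed
  show ?thesis
  proof (intro iffI ballI impI)
    fix z assume L: "\<forall>u\<in>L1 M. (\<forall>x. 0 \<le> u x) \<longrightarrow> (\<lambda>k. LINT x|M. u x * f (lam k) x) \<longlonglongrightarrow> (LINT x|M. u x)"
      and z: "z \<in> emb M ` L1_pos M"
    obtain u where u: "u \<in> L1 M" "\<And>x. 0 \<le> u x" "z = emb M u" using z by (rule pos_repE) blast
    show "(\<lambda>k. lam k * norm (K.G (lam k) z)) \<longlonglongrightarrow> 0" using L iff[of u] u by simp
  next
    fix u assume R: "\<forall>z\<in>emb M ` L1_pos M. (\<lambda>k. lam k * norm (K.G (lam k) z)) \<longlonglongrightarrow> 0"
      and u: "u \<in> L1 M" "\<forall>x. 0 \<le> u x"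
    then have "emb M u \<in> emb M ` L1_pos M" using emb_pos_iff[OF u(1)] by simp
    from bspec[OF R this] show "(\<lambda>k. LINT x|M. u x * f (lam k) x) \<longlonglongrightarrow> (LINT x|M. u x)"
      using iff[of u] u by simp
  qed
qed

theorem strongly_stable_iff:
  assumes P: "smallest_perturbed_semigroup M A B DA P"
    and lam: "\<And>k. lam k > 0" "decseq lam" "lam \<longlonglongrightarrow> 0"
  shows "strongly_stable M P \<longleftrightarrow>
    {x \<in> space M. liminf (\<lambda>k. ereal (f (lam k) x)) < 1} \<in> null_sets M"
proof -
  have "{x \<in> space M. liminf (\<lambda>k. ereal (f (lam k) x)) < 1} \<in> null_sets M \<longleftrightarrow>
      (\<forall>z\<in>emb M ` L1_pos M. (\<lambda>k. lam k * norm (K.G (lam k) z)) \<longlonglongrightarrow> 0)"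
    unfolding integrals_f_tendsto_iff[of lam, OF lam(1), symmetric]
    by (rule liminf_eq_1_iff_integrals; intro f_lim_props f_lim_antimono lam(1) decseqD[OF lam(2)] le_SucI order_refl)
  moreover have "perturbed_semigroup M A B DA P"
    using P by (simp add: smallest_perturbed_semigroup_def)
  ultimately show ?thesis
    using strongly_stable_imp_mass_loss[of P lam, OF _ _ lam(1,3)]
      mass_loss_imp_strongly_stable[of P lam, OF P lam(1)] by blast
qed

end

theorem theorem3p5:
  fixes M :: "'a measure"
    and A B :: "('a \<Rightarrow> real) \<Rightarrow> 'a \<Rightarrow> real"
    and DA DB :: "('a \<Rightarrow> real) set"
    and S P :: "real \<Rightarrow> ('a \<Rightarrow> real) \<Rightarrow> 'a \<Rightarrow> real"
    and lam :: "nat \<Rightarrow> real"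
  assumes "sigma_finite_measure M"
    and "linear_operator M A DA"
    and "linear_operator M B DB"
    and G1: "substochastic_semigroup M S" "generates M A DA S"
    and G2: "DA \<subseteq> DB" "positive_on M B DA"
    and G3: "\<forall>u\<in>nonneg_part M DA. (LINT x|M. A u x + B u x) = 0"
    and P: "smallest_perturbed_semigroup M A B DA P"
    and lam: "\<And>k. lam k > 0" "decseq lam" "lam \<longlonglongrightarrow> 0"
  shows "strongly_stable M P \<longleftrightarrow>
    {x \<in> space M. liminf (\<lambda>k. ereal (f_lim M A B DA (lam k) x)) < 1} \<in> null_sets M"
proof -
  interpret kato_voigt M A B DA DB S
    using assms by (intro kato_voigt.intro kato_voigt_axioms.intro)
  show ?thesis using P lam by (rule strongly_stable_iff)
qed

end
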